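(* Let $k\in\{1,\ldots,n-1\}$ and $0<\alpha\leq 1$, and set $\varepsilon_0(k):=2^k\,240^{-k-1}$. Let $E\subset\mathbb{R}^n$ be a Borel set with $\mathcal{H}^k(E)<\infty$ such that for $\mathcal{H}^k$-a.e. $x\in E$ there exist a linear $k$-plane $V_x\subset\mathbb{R}^n$ and a number $\lambda>0$ (both possibly depending on $x$) such that $$\limsup_{r\to 0}\frac{1}{r^k}\mathcal{H}^k\big((E\cap B(x,r))\setminus Q_\alpha(x,V_x,\lambda)\big)<\varepsilon_0(k).$$ Then $E$ is $C^{1,\alpha}$ $\mathcal{H}^k$-rectifiable.
   Context: $B(x,r)$ is the closed Euclidean ball of center $x$ and radius $r$ in $\mathbb{R}^n$. $\mathcal{H}^k$ is the $k$-dimensional Hausdorff measure with no normalizing factor: $\mathcal{H}^k(E)=\lim_{\delta\to0}\inf\{\sum_i \mathrm{diam}(E_i)^k: E\subset\bigcup_i E_i,\ \mathrm{diam}(E_i)\le\delta\}$. For a linear subspace $V$, $P_V$ is the orthogonal projection onto $V$. For a linear $k$-plane $V$, $\lambda>0$ and $x\in\mathbb{R}^n$, the $\alpha$-paraboloid is $$Q_\alpha(x,V,\lambda):=\{y\in\mathbb{R}^n: |P_{V^\perp}(y-x)|\le\lambda|P_V(y-x)|^{1+\alpha}\}.$$ A $k$-dimensional $C^{1,\alpha}$ graph is a set $\{v+f(v):v\in V\}$, where $V$ is a linear $k$-plane of $\mathbb{R}^n$ and $f:V\to V^\perp$ is a $C^{1,\alpha}$ map ($C^1$ with $\alpha$-Hölder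 derivative). A Borel set $E\subseteq\mathbb{R}^n$ is $C^{1,\alpha}$ $\mathcal{H}^k$-rectifiable if there are countably many $k$-dimensional $C^{1,\alpha}$ graphs $\Gamma_i$ with $\mathcal{H}^k(E\setminus\bigcup_i\Gamma_i)=0$. *)

theory Defs
  imports "HOL-Analysis.Analysis"
begin

text \<open>
  The library's \<^const>\<open>diameter\<close> is meaningful only on bounded sets, so
  \<open>diam (A i) \<le> \<delta>\<close> is rendered with an explicit boundedness condition. Finite covers are
  obtained by padding with \<open>{}\<close>, which contributes \<open>0 ^ k = 0\<close>; hence these
  definitions are meant for \<open>k \<ge> 1\<close> only.
\<close>

definition hausdorff_pre :: "nat \<Rightarrow> real \<Rightarrow> 'a::metric_space set \<Rightarrow> ennreal" where
  "hausdorff_pre k \<delta> E =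
     (INF A \<in> {A :: nat \<Rightarrow> 'a set. E \<subseteq> (\<Union>i. A i) \<and> (\<forall>i. bounded (A i) \<and> diameter (A i) \<le> \<delta>)}.
        \<Sum>i. ennreal (diameter (A i) ^ k))"

definition hausdorff :: "nat \<Rightarrow> 'a::metric_space set \<Rightarrow> ennreal" where
  "hausdorff k E = Lim (at_right 0) (\<lambda>\<delta>. hausdorff_pre k \<delta> E)"

lemma hausdorff_pre_antimono:
  assumes "\<delta> \<le> \<delta>'"
  shows "hausdorff_pre k \<delta>' E \<le> hausdorff_pre k \<delta> E"
  unfolding hausdorff_pre_def
proof (rule INF_superset_mono)
  show "{A. E \<subseteq> (\<Union>i. A i) \<and> (\<forall>i. bounded (A i) \<and> diameter (A i) \<le> \<delta>)}
    \<subseteq> {A. E \<subseteq> (\<Union>i. A i) \<and> (\<forall>i. bounded (A i) \<and> diameter (A i) \<le> \<delta>')}"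
    using assms by (blast intro: order_trans)
qed simp

lemma tendsto_hausdorff_pre_SUP:
  "((\<lambda>\<delta>. hausdorff_pre k \<delta> E) \<longlongrightarrow> (SUP \<delta>\<in>{0<..}. hausdorff_pre k \<delta> E)) (at_right 0)"
proof (rule order_tendstoI)
  fix a assume "a < (SUP \<delta>\<in>{0<..}. hausdorff_pre k \<delta> E)"
  then obtain d where d: "d > 0" "a < hausdorff_pre k d E"
    by (auto simp: less_SUP_iff)
  have "\<forall>\<^sub>F \<delta> in at_right 0. \<delta> < d"
    using d(1) by (auto simp: eventually_at_right_field)
  then show "\<forall>\<^sub>F \<delta> in at_right 0. a < hausdorff_pre k \<delta> E"
    by eventually_elim (rule less_le_trans[OF d(2) hausdorff_pre_antimono], simp)
next
  fix a assume a: "(SUP \<delta>\<in>{0<..}. hausdorff_pre k \<delta> E) < a"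
  have "\<forall>\<^sub>F \<delta> in at_right (0::real). \<delta> > 0"
    by (rule eventually_at_right_less)
  then show "\<forall>\<^sub>F \<delta> in at_right 0. hausdorff_pre k \<delta> E < a"
    by eventually_elim (rule le_less_trans[OF SUP_upper a], simp)
qed

lemma hausdorff_eq_SUP: "hausdorff k E = (SUP \<delta>\<in>{0<..}. hausdorff_pre k \<delta> E)"
  unfolding hausdorff_def
  by (rule tendsto_Lim[OF _ tendsto_hausdorff_pre_SUP]) simp

definition linear_plane :: "nat \<Rightarrow> 'a::euclidean_space set \<Rightarrow> bool" where
  "linear_plane k V \<longleftrightarrow> subspace V \<and> dim V = k"

definition orth_proj :: "'a::euclidean_space set \<Rightarrow> 'a \<Rightarrow> 'a" where
  "orth_proj V x = (THE p. p \<in> V \<and> x - p \<in> V\<^sup>\<bottom>)"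

lemma orth_proj_unique:
  assumes V: "subspace V" and p: "p \<in> V" "x - p \<in> V\<^sup>\<bottom>"
  shows "orth_proj V x = p"
  unfolding orth_proj_def
proof (rule the_equality)
  fix q assume q: "q \<in> V \<and> x - q \<in> V\<^sup>\<bottom>"
  have 1: "q - p \<in> V" using V p q by (simp add: subspace_diff)
  have "(x - p) - (x - q) \<in> V\<^sup>\<bottom>"
    by (rule subspace_diff[OF subspace_orthogonal_comp p(2)]) (use q in blast)
  then have "q - p \<in> V\<^sup>\<bottom>" by simp
  with 1 have "orthogonal (q - p) (q - p)" by (auto simp: orthogonal_comp_def)
  then show "q = p" by (simp add: orthogonal_self)
qed (use p in auto)

lemma orth_proj:
  assumes V: "subspace V"
  shows "orth_proj V x \<in> V" "x - orth_proj V x \<in> V\<^sup>\<bottom>"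
proof -
  obtain y z where "y \<in> V" "z \<in> V\<^sup>\<bottom>" "x = y + z"
    using subspace_sum_orthogonal_comp[OF V] by (metis UNIV_I set_plus_elim)
  then have "y \<in> V" "x - y \<in> V\<^sup>\<bottom>" by auto
  with orth_proj_unique[OF V this] show "orth_proj V x \<in> V" "x - orth_proj V x \<in> V\<^sup>\<bottom>" by auto
qed

definition paraboloid :: "real \<Rightarrow> 'a::euclidean_space \<Rightarrow> 'a set \<Rightarrow> real \<Rightarrow> 'a set" where
  "paraboloid \<alpha> x V lam =
     {y. norm (orth_proj (V\<^sup>\<bottom>) (y - x)) \<le> lam * norm (orth_proj V (y - x)) powr (1 + \<alpha>)}"

text \<open>
  The derivative of a map on \<open>V\<close> is determined only on \<open>V\<close>; it is represented by an extension
  \<open>D v\<close> to the whole space. Since \<open>D\<close> is existentially quantified one may compose it with the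
  orthogonal projection onto \<open>V\<close>, so the norm of \<open>D v - D w\<close> can be taken to be the operator
  norm over \<open>V\<close>.
\<close>

definition C1_alpha_on :: "real \<Rightarrow> 'a::euclidean_space set \<Rightarrow> ('a \<Rightarrow> 'b::euclidean_space) \<Rightarrow> bool" where
  "C1_alpha_on \<alpha> V f \<longleftrightarrow>
     (\<exists>D :: 'a \<Rightarrow> 'a \<Rightarrow>\<^sub>L 'b.
        (\<forall>v\<in>V. (f has_derivative blinfun_apply (D v)) (at v within V)) \<and>
        continuous_on V D \<and>
        (\<exists>C. \<forall>v\<in>V. \<forall>w\<in>V. norm (D v - D w) \<le> C * norm (v - w) powr \<alpha>))"

definition C1_alpha_graph :: "nat \<Rightarrow> real \<Rightarrow> 'a::euclidean_space set \<Rightarrow> bool" where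
  "C1_alpha_graph k \<alpha> \<Gamma> \<longleftrightarrow>
     (\<exists>V f. linear_plane k V \<and> f \<in> V \<rightarrow> V\<^sup>\<bottom> \<and> C1_alpha_on \<alpha> V f \<and> \<Gamma> = {v + f v |v. v \<in> V})"

definition C1_alpha_rectifiable :: "nat \<Rightarrow> real \<Rightarrow> 'a::euclidean_space set \<Rightarrow> bool" where
  "C1_alpha_rectifiable k \<alpha> E \<longleftrightarrow>
     E \<in> sets borel \<and>
     (\<exists>G. countable G \<and> (\<forall>\<Gamma>\<in>G. C1_alpha_graph k \<alpha> \<Gamma>) \<and> hausdorff k (E - \<Union>G) = 0)"

definition eps0 :: "nat \<Rightarrow> real" where
  "eps0 k = 2 ^ k * 240 powi (- int k - 1)"

end

(*
  Only countable covers and the outer measure properties of the Hausdorff measure are used; it is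
  compared with Lebesgue measure on planes through Vitali coverings and the mass distribution principle.

  By pigeonholing one may assume that the aperture of the paraboloids and the admissible scales are
  uniform and that all planes V_x are close to a fixed plane V. Near each of its points most of E then
  lies in a cone around V, and a two-point argument shows that, up to a null set, E is a countable union
  of pieces on which the orthogonal projection P onto V has a Lipschitz inverse. Over a density point of
  the projection of such a piece any two points of the piece are well approximated, to order 1 + alpha,
  by a common third point; hence the linear maps L_x describing the planes V_x over V form, together
  with the points themselves, a Whitney jet of class C^{1,alpha} on the projection. The extension of
  this jet gives a graph containing the piece. The numerical constant enters only through
  4 * eps0 k * 44 ^ k < 1.
*)
theory Submission
  imports Defs
begin

subsection \<open>Hausdorff outer measure\<close>

text \<open>Planes, apertures and scales are picked pointwise by choice, so the pieces into which
  the set is cut are not known to be measurable. Hence the estimates are made for outer measures,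
  and a projected piece is replaced by a measurable envelope. No lower density of \<open>E\<close>
  is available either: the hypothesis only bounds the mass outside the paraboloids from above, a
  bound that passes to subsets. The lower bound comes from Lebesgue measure on a plane, normalized
  so that a disc of radius s has mass s^k. A set of diameter s fits into such a disc, so this
  measure is dominated, with constant 1, by the unnormalized Hausdorff measure. The constant: in the
  two-point argument the bad balls are at most 40 times as large as the packed discs, the ball
  containing the discs is enlarged by 11/10, and there are two bad sets; this asks for 2 *
  \<epsilon> * 44^k < 1. For the common third points the bad balls are 36 times as large as the
  disc, there are two of them, and half of the disc may be missing; this asks for 4 * \<epsilon> *
  36^k < 1.\<close>

lemma ennreal_le_mult_of_gt:
  fixes x y :: ennreal
  assumes l: "0 < l" and le: "\<And>c. x < c \<Longrightarrow> y \<le> ennreal l * c"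
  shows "y \<le> ennreal l * x"
proof (rule ennreal_le_epsilon)
  fix e :: real
  assume fin: "ennreal l * x < top" and e: "0 < e"
  have "x < top"
    using fin l by (cases "x = top") (simp_all add: ennreal_mult_top less_top)
  then have "x < x + ennreal (e / l)"
    using e l by (cases x) (simp_all add: ennreal_plus[symmetric] ennreal_less_iff del: ennreal_plus)
  then have "y \<le> ennreal l * (x + ennreal (e / l))"
    by (rule le)
  also have "\<dots> = ennreal l * x + ennreal e"
    using e l by (simp add: distrib_left ennreal_mult[symmetric])
  finally show "y \<le> ennreal l * x + ennreal e" .
qed

lemma countable_enum:
  assumes "countable C"
  obtains J :: "nat set" and e where "bij_betw e J C"
  using bij_betw_inv_into[OF inj_on_imp_bij_betw[OF inj_on_to_nat_on[OF assms]]] by (rule that)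

lemma hausdorff_pre_le:
  assumes "E \<subseteq> (\<Union>i. A i)" "\<And>i. bounded (A i)" "\<And>i. diameter (A i) \<le> \<delta>"
  shows "hausdorff_pre k \<delta> E \<le> (\<Sum>i. ennreal (diameter (A i) ^ k))"
  unfolding hausdorff_pre_def by (rule INF_lower) (use assms in blast)

lemma hausdorff_pre_less_cover:
  assumes "hausdorff_pre k \<delta> E < c"
  obtains A where "E \<subseteq> (\<Union>i. A i)" "\<And>i. bounded (A i)" "\<And>i. diameter (A i) \<le> \<delta>"
    "(\<Sum>i. ennreal (diameter (A i) ^ k)) < c"
  using assms unfolding hausdorff_pre_def INF_less_iff by blast

lemma hausdorff_pre_le_hausdorff: "0 < \<delta> \<Longrightarrow> hausdorff_pre k \<delta> E \<le> hausdorff k E"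
  unfolding hausdorff_eq_SUP by (rule SUP_upper) simp

lemma hausdorff_leI: "(\<And>\<delta>. 0 < \<delta> \<Longrightarrow> hausdorff_pre k \<delta> E \<le> b) \<Longrightarrow> hausdorff k E \<le> b"
  unfolding hausdorff_eq_SUP by (rule SUP_least) simp

lemma hausdorff_less_cover:
  assumes "hausdorff k E < c" "0 < \<delta>"
  obtains A where "E \<subseteq> (\<Union>i. A i)" "\<And>i. bounded (A i)" "\<And>i. diameter (A i) \<le> \<delta>"
    "(\<Sum>i. ennreal (diameter (A i) ^ k)) < c"
  using hausdorff_pre_less_cover[OF le_less_trans[OF hausdorff_pre_le_hausdorff[OF assms(2)] assms(1)]]
  by metis

lemma hausdorff_pre_mono: "E \<subseteq> F \<Longrightarrow> hausdorff_pre k \<delta> E \<le> hausdorff_pre k \<delta> F"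
  unfolding hausdorff_pre_def by (rule INF_superset_mono) auto

lemma hausdorff_mono: "E \<subseteq> F \<Longrightarrow> hausdorff k E \<le> hausdorff k F"
  unfolding hausdorff_eq_SUP by (intro SUP_mono) (meson hausdorff_pre_mono)

lemma hausdorff_pre_UN_le:
  "hausdorff_pre k \<delta> (\<Union>i::nat. S i) \<le> (\<Sum>i. hausdorff_pre k \<delta> (S i))"
proof (rule ennreal_le_epsilon)
  fix e :: real
  assume fin: "(\<Sum>i. hausdorff_pre k \<delta> (S i)) < top" and e: "0 < e"
  define g where "g i = hausdorff_pre k \<delta> (S i) + ennreal (e * (1/2) ^ Suc i)" for i
  have "\<exists>A. S i \<subseteq> (\<Union>j. A j) \<and> (\<forall>j. bounded (A j)) \<and> (\<forall>j. diameter (A j) \<le> \<delta>)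
      \<and> (\<Sum>j. ennreal (diameter (A j) ^ k)) < g i" for i
  proof -
    have "hausdorff_pre k \<delta> (S i) \<le> (\<Sum>i. hausdorff_pre k \<delta> (S i))"
      using sum_le_suminf[of "\<lambda>i. hausdorff_pre k \<delta> (S i)" "{i}"] by simp
    then have "hausdorff_pre k \<delta> (S i) < top" using fin by (rule le_less_trans)
    then have "hausdorff_pre k \<delta> (S i) < g i"
      using e unfolding g_def
      by (cases "hausdorff_pre k \<delta> (S i)")
        (simp_all add: ennreal_plus[symmetric] ennreal_less_iff del: ennreal_plus)
    then show ?thesis using hausdorff_pre_less_cover by metis
  qed
  then obtain A where A: "\<And>i. S i \<subseteq> (\<Union>j. A i j)" "\<And>i j. bounded (A i j)"
      "\<And>i j. diameter (A i j) \<le> \<delta>" "\<And>i. (\<Sum>j. ennreal (diameter (A i j) ^ k)) < g i"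
    by metis
  define B where "B n = (case prod_decode n of (i, j) \<Rightarrow> A i j)" for n
  have cov: "(\<Union>i. S i) \<subseteq> (\<Union>n. B n)"
  proof
    fix x assume "x \<in> (\<Union>i. S i)"
    then obtain i j where "x \<in> A i j" using A(1) by blast
    then have "x \<in> B (prod_encode (i, j))" by (simp add: B_def)
    then show "x \<in> (\<Union>n. B n)" by blast
  qed
  have "hausdorff_pre k \<delta> (\<Union>i. S i) \<le> (\<Sum>n. ennreal (diameter (B n) ^ k))"
    by (rule hausdorff_pre_le[OF cov]) (simp_all add: B_def A split: prod.split)
  also have "\<dots> = (\<Sum>n. (\<lambda>(i, j). ennreal (diameter (A i j) ^ k)) (prod_decode n))"
    by (rule arg_cong[where f=suminf]) (simp add: B_def fun_eq_iff split: prod.split)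
  also have "\<dots> = (\<Sum>i. \<Sum>j. ennreal (diameter (A i j) ^ k))"
    by (rule suminf_ennreal_2dimen) simp
  also have "\<dots> \<le> (\<Sum>i. g i)"
    by (rule suminf_le) (simp_all add: A(4) less_imp_le)
  also have "\<dots> = (\<Sum>i. hausdorff_pre k \<delta> (S i)) + (\<Sum>i. ennreal (e * (1/2) ^ Suc i))"
    unfolding g_def by (rule suminf_add[symmetric]) simp_all
  also have "(\<Sum>i. ennreal (e * (1/2) ^ Suc i)) = ennreal e"
  proof (rule suminf_ennreal_eq)
    show "(\<lambda>i. e * (1/2) ^ Suc i) sums e"
      using sums_mult[OF power_half_series, of e] by simp
  qed (use e in simp)
  finally show "hausdorff_pre k \<delta> (\<Union>i. S i) \<le> (\<Sum>i. hausdorff_pre k \<delta> (S i)) + ennreal e" .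
qed

lemma hausdorff_UN_le: "hausdorff k (\<Union>i::nat. S i) \<le> (\<Sum>i. hausdorff k (S i))"
proof (rule hausdorff_leI)
  fix \<delta> :: real assume "0 < \<delta>"
  then have "(\<Sum>i. hausdorff_pre k \<delta> (S i)) \<le> (\<Sum>i. hausdorff k (S i))"
    by (intro suminf_le hausdorff_pre_le_hausdorff) simp_all
  with hausdorff_pre_UN_le show "hausdorff_pre k \<delta> (\<Union>i. S i) \<le> (\<Sum>i. hausdorff k (S i))"
    by (rule order_trans)
qed

lemma hausdorff_singleton:
  assumes "0 < k"
  shows "hausdorff k {x} = 0"
proof -
  have "hausdorff k {x} \<le> 0"
  proof (rule hausdorff_leI)
    fix \<delta> :: real assume "0 < \<delta>"
    then have "hausdorff_pre k \<delta> {x} \<le> (\<Sum>i::nat. ennreal (diameter {x} ^ k))"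
      by (intro hausdorff_pre_le) (simp_all add: diameter_singleton)
    also have "\<dots> = 0"
      using assms by (simp add: diameter_singleton zero_power)
    finally show "hausdorff_pre k \<delta> {x} \<le> 0" .
  qed
  then show ?thesis by simp
qed

lemma hausdorff_empty:
  assumes "0 < k"
  shows "hausdorff k ({} :: 'a::metric_space set) = 0"
  using hausdorff_mono[of "{}" "{undefined :: 'a}" k] hausdorff_singleton[OF assms, of "undefined :: 'a"]
  by simp

lemma hausdorff_UN_null: "(\<And>i::nat. hausdorff k (S i) = 0) \<Longrightarrow> hausdorff k (\<Union>i. S i) = 0"
  using hausdorff_UN_le[of k S] by simp

lemma hausdorff_Un_le:
  assumes "0 < k"
  shows "hausdorff k (S \<union> T) \<le> hausdorff k S + hausdorff k T"
proof -
  define A where "A i = (if i = 0 then S else if i = 1 then T else {})" for i :: nat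
  have "S \<union> T \<subseteq> (\<Union>i. A i)"
    unfolding A_def by (auto intro: exI[of _ "0::nat"] exI[of _ "1::nat"])
  then have "hausdorff k (S \<union> T) \<le> hausdorff k (\<Union>i. A i)" by (rule hausdorff_mono)
  also have "\<dots> \<le> (\<Sum>i. hausdorff k (A i))" by (rule hausdorff_UN_le)
  also have "\<dots> = (\<Sum>i\<in>{0,1}. hausdorff k (A i))"
    by (rule suminf_finite) (simp_all add: A_def hausdorff_empty[OF assms])
  also have "\<dots> = hausdorff k S + hausdorff k T" by (simp add: A_def)
  finally show ?thesis .
qed

lemma hausdorff_Lipschitz_image_le:
  assumes L: "0 < L" and lip: "\<And>x y. x \<in> S \<Longrightarrow> y \<in> S \<Longrightarrow> dist (f x) (f y) \<le> L * dist x y"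
  shows "hausdorff k (f ` S) \<le> ennreal (L ^ k) * hausdorff k S"
proof (rule hausdorff_leI)
  fix \<delta> :: real assume \<delta>: "0 < \<delta>"
  show "hausdorff_pre k \<delta> (f ` S) \<le> ennreal (L ^ k) * hausdorff k S"
  proof (rule ennreal_le_mult_of_gt)
    fix c assume c: "hausdorff k S < c"
    have "0 < \<delta> / L" using \<delta> L by simp
    from hausdorff_less_cover[OF c this] obtain A where A: "S \<subseteq> (\<Union>i. A i)" "\<And>i. bounded (A i)"
      "\<And>i. diameter (A i) \<le> \<delta> / L" "(\<Sum>i. ennreal (diameter (A i) ^ k)) < c" by metis
    have fA: "dist u v \<le> L * diameter (A i)"
      if uv: "u \<in> f ` (S \<inter> A i)" "v \<in> f ` (S \<inter> A i)" for u v i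
    proof -
      obtain x y where xy: "x \<in> S \<inter> A i" "y \<in> S \<inter> A i" "u = f x" "v = f y" using uv by blast
      then have "dist u v \<le> L * dist x y" using lip by simp
      also have "\<dots> \<le> L * diameter (A i)"
        using L xy diameter_bounded_bound[OF A(2)] by (simp add: mult_left_mono)
      finally show ?thesis .
    qed
    have dpos: "0 \<le> diameter (A i)" for i by (rule diameter_ge_0[OF A(2)])
    have bd: "bounded (f ` (S \<inter> A i))" for i
      unfolding bounded_two_points using fA by blast
    have dm: "diameter (f ` (S \<inter> A i)) \<le> L * diameter (A i)" for i
    proof (cases "S \<inter> A i = {}")
      case False
      then show ?thesis
        unfolding diameter_def[of "f ` (S \<inter> A i)"] using fA[of _ i] by (auto intro!: cSUP_least)
    qed (use L dpos in simp)
    have "hausdorff_pre k \<delta> (f ` S) \<le> (\<Sum>i. ennreal (diameter (f ` (S \<inter> A i)) ^ k))"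
    proof (rule hausdorff_pre_le)
      show "f ` S \<subseteq> (\<Union>i. f ` (S \<inter> A i))" using A(1) by blast
      show "diameter (f ` (S \<inter> A i)) \<le> \<delta>" for i
        using dm[of i] A(3)[of i] L by (simp add: field_simps)
    qed (rule bd)
    also have "\<dots> \<le> (\<Sum>i. ennreal (L ^ k) * ennreal (diameter (A i) ^ k))"
    proof (intro suminf_le)
      fix i
      have "diameter (f ` (S \<inter> A i)) ^ k \<le> (L * diameter (A i)) ^ k"
        by (rule power_mono[OF dm diameter_ge_0[OF bd]])
      then show "ennreal (diameter (f ` (S \<inter> A i)) ^ k) \<le> ennreal (L ^ k) * ennreal (diameter (A i) ^ k)"
        using L dpos by (simp add: ennreal_mult[symmetric] power_mult_distrib ennreal_leI)
    qed simp_all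
    also have "\<dots> = ennreal (L ^ k) * (\<Sum>i. ennreal (diameter (A i) ^ k))" by simp
    also have "\<dots> \<le> ennreal (L ^ k) * c"
      using A(4) by (intro mult_left_mono) simp_all
    finally show "hausdorff_pre k \<delta> (f ` S) \<le> ennreal (L ^ k) * c" .
  qed (use L in simp)
qed

text \<open>A covering set of diameter s that meets \<open>S\<close> lies in a ball of radius s
  about a point of \<open>S\<close>, so its trace on \<open>S\<close> has measure at most t * s^k.
  Summing over a nearly optimal cover bounds the measure of \<open>S\<close> by t times itself, and
  a finite number with this property is 0.\<close>

lemma hausdorff_eq_0_of_small_density:
  fixes S :: "'a::metric_space set"
  assumes k: "0 < k" and fin: "hausdorff k S < top" and d: "0 < d" and t: "0 < t" "t < 1"
    and dens: "\<And>x r. x \<in> S \<Longrightarrow> 0 < r \<Longrightarrow> r < d \<Longrightarrow> hausdorff k (S \<inter> cball x r) \<le> ennreal (t * r ^ k)"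
  shows "hausdorff k S = 0"
proof -
  have "hausdorff k S \<le> ennreal t * hausdorff k S"
  proof (rule ennreal_le_mult_of_gt[OF t(1)])
    fix c assume c: "hausdorff k S < c"
    \<comment> \<open>Halving keeps all radii strictly below \<open>d\<close>, as
      \<open>dens\<close> requires.\<close>
    have "0 < d / 2" using d by simp
    from hausdorff_less_cover[OF c this] obtain A where A: "S \<subseteq> (\<Union>i. A i)" "\<And>i. bounded (A i)"
      "\<And>i. diameter (A i) \<le> d / 2" "(\<Sum>i. ennreal (diameter (A i) ^ k)) < c" by metis
    have piece: "hausdorff k (S \<inter> A i) \<le> ennreal t * ennreal (diameter (A i) ^ k)" for i
    proof (cases "S \<inter> A i = {}")
      case True then show ?thesis by (simp add: hausdorff_empty[OF k])
    next
      case False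
      then obtain x where x: "x \<in> S" "x \<in> A i" by blast
      have sub: "S \<inter> A i \<subseteq> S \<inter> cball x (diameter (A i))"
        using x diameter_bounded_bound[OF A(2)] by (auto simp: mem_cball)
      have d0: "0 \<le> diameter (A i)" by (rule diameter_ge_0[OF A(2)])
      show ?thesis
      \<comment> \<open>The density bound speaks of positive radii only; for diameter 0 the trace is
        a single point.\<close>
      proof (cases "diameter (A i) = 0")
        case True
        then have "S \<inter> A i \<subseteq> {x}" using sub by auto
        from hausdorff_mono[OF this, of k] show ?thesis by (simp add: hausdorff_singleton[OF k])
      next
        case False
        then have "hausdorff k (S \<inter> cball x (diameter (A i))) \<le> ennreal (t * diameter (A i) ^ k)"
          using d0 A(3)[of i] d x by (intro dens) simp_all
        then show ?thesis using hausdorff_mono[OF sub, of k] t d0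
          by (simp add: ennreal_mult[symmetric] order_trans[OF hausdorff_mono[OF sub]])
      qed
    qed
    have "hausdorff k S \<le> hausdorff k (\<Union>i. S \<inter> A i)" by (rule hausdorff_mono) (use A(1) in blast)
    also have "\<dots> \<le> (\<Sum>i. hausdorff k (S \<inter> A i))" by (rule hausdorff_UN_le)
    also have "\<dots> \<le> (\<Sum>i. ennreal t * ennreal (diameter (A i) ^ k))"
      by (intro suminf_le piece) simp_all
    also have "\<dots> = ennreal t * (\<Sum>i. ennreal (diameter (A i) ^ k))" by simp
    also have "\<dots> \<le> ennreal t * c" using A(4) by (intro mult_left_mono) simp_all
    finally show "hausdorff k S \<le> ennreal t * c" .
  qed
  moreover have "r = 0" if "r \<le> t * r" "0 \<le> r" for r
    using t that mult_less_cancel_right2[of t r] by (cases "r = 0") (simp_all add: not_less)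
  ultimately show ?thesis using fin t
    by (cases "hausdorff k S") (simp_all add: ennreal_mult[symmetric])
qed

text \<open>The packing estimate for Vitali families. Enumerating the family by a set
  \<open>J\<close> of naturals and padding with 0 treats finite and infinite families alike and
  matches the \<open>nat\<close>-indexed covers of \<open>hausdorff_pre\<close>.\<close>

lemma disjoint_sum_le_emeasure:
  assumes e: "bij_betw e J C" and disj: "pairwise (\<lambda>i j. disjnt (B i) (B j)) C"
    and B: "\<And>i. i \<in> C \<Longrightarrow> B i \<in> sets M" "\<And>i. i \<in> C \<Longrightarrow> B i \<subseteq> U" and U: "U \<in> sets M"
    and f: "\<And>i. i \<in> C \<Longrightarrow> f i \<le> emeasure M (B i)"
  shows "(\<Sum>n::nat. if n \<in> J then f (e n) else 0) \<le> emeasure M U"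
proof -
  define D where "D n = (if n \<in> J then B (e n) else {})" for n
  have eC: "e n \<in> C" if "n \<in> J" for n using e that by (auto simp: bij_betw_def)
  have dd: "disjoint_family D"
    unfolding disjoint_family_on_def
  proof (intro ballI impI)
    fix m n :: nat assume "m \<noteq> n"
    show "D m \<inter> D n = {}"
    proof (cases "m \<in> J \<and> n \<in> J")
      case True
      then have "e m \<noteq> e n" using e \<open>m \<noteq> n\<close> by (auto simp: bij_betw_def inj_on_def)
      then show ?thesis using disj eC True unfolding pairwise_def disjnt_def D_def by simp
    qed (auto simp: D_def)
  qed
  have "(\<Sum>n. if n \<in> J then f (e n) else 0) \<le> (\<Sum>n. emeasure M (D n))"
    by (rule suminf_le) (simp_all add: D_def f eC)
  also have "\<dots> = emeasure M (\<Union>n. D n)"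
    by (rule suminf_emeasure[OF _ dd]) (auto simp: D_def B eC)
  also have "\<dots> \<le> emeasure M U"
    by (rule emeasure_mono[OF _ U]) (use B(2) eC in \<open>auto simp: D_def split: if_splits\<close>)
  finally show ?thesis .
qed

text \<open>Outer regularity puts the null set \<open>N\<close> into an open set of tiny measure.
  Disjoint Vitali balls inside it pay for the sum of the k-th powers of their diameters, while their
  five-fold dilations cover \<open>S\<close>. Large mass at arbitrarily small radii is enough, since
  the radius may be chosen point by point.\<close>

lemma hausdorff_eq_0_of_dominating_measure:
  fixes S :: "'a::euclidean_space set"
  assumes k: "0 < k" and M: "sets M = sets borel" "emeasure M (space M) \<noteq> \<infinity>"
    and N: "N \<in> sets borel" "emeasure M N = 0" "S \<subseteq> N" and t: "0 < t"
    and big: "\<And>x \<delta>. x \<in> S \<Longrightarrow> 0 < \<delta> \<Longrightarrow> \<exists>r. 0 < r \<and> r < \<delta> \<and> ennreal (t * r ^ k) \<le> emeasure M (cball x r)"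
  shows "hausdorff k S = 0"
proof -
  have "hausdorff k S \<le> 0"
  proof (rule hausdorff_leI)
    fix \<delta> :: real assume \<delta>: "0 < \<delta>"
    show "hausdorff_pre k \<delta> S \<le> 0"
    proof (rule ennreal_le_epsilon)
      fix \<eta> :: real assume \<eta>: "0 < \<eta>"
      \<comment> \<open>This compensates the loss 10^k / t: the diameters are ten times the radii,
        and \<open>t\<close> relates radii to masses.\<close>
      define \<eta>' where "\<eta>' = \<eta> * t / 10 ^ k"
      have \<eta>': "0 < \<eta>'" using \<eta> t by (simp add: \<eta>'_def)
      have "emeasure M N < ennreal \<eta>'" using N \<eta>' by simp
      then have "(INF U \<in> {U. N \<subseteq> U \<and> open U}. emeasure M U) < ennreal \<eta>'"
        using outer_regular[OF M N(1)] by simp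
      then obtain U where U: "N \<subseteq> U" "open U" "emeasure M U < ennreal \<eta>'"
        unfolding INF_less_iff by blast
      \<comment> \<open>A radius of at most \<delta> / 10 keeps the diameter of the five-fold
        dilation below \<delta>.\<close>
      have "\<exists>r. 0 < r \<and> r \<le> \<delta> / 10 \<and> cball x r \<subseteq> U \<and> ennreal (t * r ^ k) \<le> emeasure M (cball x r)"
        if x: "x \<in> S" for x
      proof -
        obtain e where e: "0 < e" "cball x e \<subseteq> U"
          using U N x open_contains_cball by blast
        obtain r where r: "0 < r" "r < min e (\<delta> / 10)" "ennreal (t * r ^ k) \<le> emeasure M (cball x r)"
          using big[OF x, of "min e (\<delta> / 10)"] e \<delta> by auto
        moreover have "cball x r \<subseteq> cball x e" using r by (simp add: subset_cball)
        ultimately show ?thesis using e by (intro exI[of _ r]) auto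
      qed
      then obtain r where r: "\<And>x. x \<in> S \<Longrightarrow> 0 < r x" "\<And>x. x \<in> S \<Longrightarrow> r x \<le> \<delta> / 10"
          "\<And>x. x \<in> S \<Longrightarrow> cball x (r x) \<subseteq> U"
          "\<And>x. x \<in> S \<Longrightarrow> ennreal (t * r x ^ k) \<le> emeasure M (cball x (r x))"
        by metis
      have cov: "S \<subseteq> (\<Union>x\<in>S. cball x (r x))" using r(1) by fastforce
      have rb: "\<And>x. x \<in> S \<Longrightarrow> 0 < r x \<and> r x \<le> \<delta> / 10" using r(1,2) by blast
      obtain C where C: "countable C" "C \<subseteq> S"
          "pairwise (\<lambda>i j. disjnt (cball i (r i)) (cball j (r j))) C"
          "S \<subseteq> (\<Union>i\<in>C. cball i (5 * r i))"
        by (rule Vitali_covering_lemma_cballs[OF cov rb])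
      obtain J :: "nat set" and e where e: "bij_betw e J C" using countable_enum[OF C(1)] .
      have eC: "e n \<in> S" if "n \<in> J" for n using e C(2) that by (auto simp: bij_betw_def)
      define A where "A n = (if n \<in> J then cball (e n) (5 * r (e n)) else {})" for n
      have dA: "diameter (A n) = (if n \<in> J then 10 * r (e n) else 0)" for n
      proof (cases "n \<in> J")
        case True
        then show ?thesis using r(1)[OF eC[OF True]] by (simp add: A_def diameter_cball)
      qed (simp add: A_def)
      have "hausdorff_pre k \<delta> S \<le> (\<Sum>n. ennreal (diameter (A n) ^ k))"
      proof (rule hausdorff_pre_le)
        show "S \<subseteq> (\<Union>n. A n)"
        proof
          fix x assume "x \<in> S"
          then obtain i where i: "i \<in> C" "x \<in> cball i (5 * r i)" using C(4) by blast
          then obtain n where "n \<in> J" "e n = i" using e by (auto simp: bij_betw_def)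
          then show "x \<in> (\<Union>n. A n)" using i by (auto simp: A_def intro: exI[of _ n])
        qed
        show "diameter (A n) \<le> \<delta>" for n
          using r(2)[OF eC[of n]] \<delta> by (cases "n \<in> J") (simp_all add: dA)
      qed (simp add: A_def)
      also have "\<dots> = (\<Sum>n. ennreal (10 ^ k / t) * (if n \<in> J then ennreal (t * r (e n) ^ k) else 0))"
      proof (rule arg_cong[where f=suminf], rule ext)
        fix n
        have "ennreal (10 ^ k / t) * ennreal (t * r (e n) ^ k) = ennreal ((10 * r (e n)) ^ k)" if "n \<in> J"
          using t r(1)[OF eC[OF that]] by (simp add: ennreal_mult[symmetric] power_mult_distrib)
        then show "ennreal (diameter (A n) ^ k) =
            ennreal (10 ^ k / t) * (if n \<in> J then ennreal (t * r (e n) ^ k) else 0)"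
          using k by (simp add: dA)
      qed
      also have "\<dots> = ennreal (10 ^ k / t) * (\<Sum>n. if n \<in> J then ennreal (t * r (e n) ^ k) else 0)"
        by simp
      also have "\<dots> \<le> ennreal (10 ^ k / t) * emeasure M U"
      proof (intro mult_left_mono disjoint_sum_le_emeasure[OF e C(3)])
        show "U \<in> sets M" using U(2) M(1) by simp
        fix i assume "i \<in> C"
        then have i: "i \<in> S" using C(2) by blast
        show "cball i (r i) \<subseteq> U" by (rule r(3)[OF i])
        show "ennreal (t * r i ^ k) \<le> emeasure M (cball i (r i))" by (rule r(4)[OF i])
      qed (simp_all add: M(1))
      also have "\<dots> \<le> ennreal (10 ^ k / t) * ennreal \<eta>'"
        using U(3) by (intro mult_left_mono) simp_all
      also have "\<dots> = ennreal \<eta>"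
        using t \<eta> by (simp add: \<eta>'_def ennreal_mult[symmetric])
      finally show "hausdorff_pre k \<delta> S \<le> 0 + ennreal \<eta>" by simp
    qed
  qed
  then show ?thesis by simp
qed

subsection \<open>Normalized Lebesgue measure on a plane\<close>

text \<open>Lebesgue measure on a coordinate plane is realized as the push-forward of Lebesgue measure on
  the product of that plane with the unit cube of the complementary coordinates.\<close>

lemma plane_measure:
  fixes V :: "'a::euclidean_space set"
  assumes V: "linear_plane k V"
  obtains \<nu> :: "'a measure" where "sets \<nu> = sets borel"
    "\<And>w s. w \<in> V \<Longrightarrow> 0 < s \<Longrightarrow> emeasure \<nu> (cball w s) = ennreal (s ^ k)"
proof -
  have subV: "subspace V" and dimV: "dim V = k" using V by (auto simp: linear_plane_def)
  have "k \<le> card (Basis :: 'a set)" using dim_subset_UNIV[of V] dimV by simp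
  then obtain B :: "'a set" where B: "B \<subseteq> Basis" "card B = k" "finite B"
    by (rule obtain_subset_with_card_n)
  define W where "W = span B"
  have "dim W = k"
    unfolding W_def dim_span using B independent_Basis dim_eq_card_independent independent_mono by metis
  \<comment> \<open>\<open>V\<close> is an isometric copy of the coordinate plane \<open>W\<close>,
    so it suffices to measure discs of \<open>W\<close> by cylinders in coordinates.\<close>
  then obtain f where f: "linear f" "f ` W = V" "\<And>x. x \<in> W \<Longrightarrow> norm (f x) = norm x"
    using isometry_subspaces[of W V] subV dimV unfolding W_def by (metis subspace_span)
  define Q where "Q z = (\<Sum>b\<in>B. (z \<bullet> b) *\<^sub>R b)" for z
  have Qlin: "linear Q" unfolding Q_def by (intro linear_compose_sum) (auto intro!: linearI simp: inner_left_distrib scaleR_add_left)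
  have QW: "Q z \<in> W" for z unfolding Q_def W_def by (intro span_sum span_mul span_base)
  have Qi: "Q z \<bullet> b = (if b \<in> B then z \<bullet> b else 0)" if "b \<in> Basis" for z b
  proof -
    have "Q z \<bullet> b = (\<Sum>c\<in>B. if c = b then z \<bullet> c else 0)"
      unfolding Q_def inner_sum_left using B(1) that
      by (intro sum.cong) (auto simp: inner_Basis subset_iff)
    then show ?thesis using B(3) by simp
  qed
  have Qb: "Q b = b" if "b \<in> B" for b
    by (rule euclidean_eqI) (use that B(1) in \<open>auto simp: Qi inner_Basis subset_iff\<close>)
  have Qw: "Q w = w" if "w \<in> W" for w
    using linear_eq_on_span[OF Qlin linear_id, of B w] Qb that unfolding W_def by simp
  have W0: "w \<bullet> b = 0" if "w \<in> W" "b \<in> Basis - B" for w b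
    using Qi[of b w] Qw[OF that(1)] that(2) by simp
  \<comment> \<open>The slab restricts only the coordinates outside \<open>B\<close>; cut by it, the
    cylinder over a disc of \<open>W\<close> has finite positive volume.\<close>
  define U where "U = {z :: 'a. \<forall>b\<in>Basis - B. \<bar>z \<bullet> b\<bar> \<le> 1}"
  define h where "h z = f (Q z)" for z
  have hlin: "linear h" unfolding h_def using linear_compose[OF Qlin f(1)] by (simp add: o_def)
  have hcont: "continuous_on UNIV h" using hlin by (simp add: linear_continuous_on linear_conv_bounded_linear)
  have hmeas: "h \<in> borel_measurable borel" using hcont by (rule borel_measurable_continuous_onI)
  define Z where "Z w s = {z \<in> U. norm (Q z - w) \<le> s}" for w s
  have U_closed: "closed U"
  proof -
    have "U = (\<Inter>b\<in>Basis - B. {z. \<bar>z \<bullet> b\<bar> \<le> 1})" by (auto simp: U_def)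
    then show ?thesis by (simp, intro closed_INT ballI closed_Collect_le continuous_intros)
  qed
  have Z_closed: "closed (Z w s)" for w s
  proof -
    have "continuous_on UNIV Q" using Qlin by (simp add: linear_continuous_on linear_conv_bounded_linear)
    then have "closed {z. norm (Q z - w) \<le> s}"
      by (intro closed_Collect_le continuous_intros) auto
    moreover have "Z w s = U \<inter> {z. norm (Q z - w) \<le> s}" by (auto simp: Z_def)
    ultimately show ?thesis using U_closed by (simp add: closed_Int)
  qed
  have scale: "emeasure lborel (Z w s) = ennreal (s ^ k) * emeasure lborel (Z 0 1)"
    if w: "w \<in> W" and s: "0 < s" for w s
  proof -
    \<comment> \<open>The affine map stretches just the \<open>k\<close> directions of
      \<open>B\<close>, so its Jacobian is s^k; it preserves \<open>U\<close>, because
      \<open>w\<close> has no coordinates outside \<open>B\<close>.\<close>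
    define c where "c j = (if j \<in> B then s else 1)" for j
    define T where "T x = w + (\<Sum>j\<in>Basis. (c j * (x \<bullet> j)) *\<^sub>R j)" for x
    have T: "lborel = density (distr lborel borel T) (\<lambda>_. (\<Prod>j\<in>Basis. \<bar>c j\<bar>))"
      unfolding T_def by (rule lborel_affine_euclidean) (use s in \<open>simp add: c_def\<close>)
    have Tm: "T \<in> borel_measurable borel" unfolding T_def by simp
    have prod: "(\<Prod>j\<in>Basis. \<bar>c j\<bar>) = s ^ k"
    proof -
      have "(\<Prod>j\<in>Basis. \<bar>c j\<bar>) = (\<Prod>j\<in>B. s)"
        using B s by (intro prod.mono_neutral_cong_right) (auto simp: c_def)
      then show ?thesis using B by simp
    qed
    have Tb: "T x \<bullet> b = w \<bullet> b + c b * (x \<bullet> b)" if "b \<in> Basis" for x b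
      unfolding T_def using that by (simp add: inner_add_left)
    have QT: "Q (T x) = w + s *\<^sub>R Q x" for x
    proof -
      have "Q (T x) = (\<Sum>b\<in>B. (w \<bullet> b) *\<^sub>R b + s *\<^sub>R ((x \<bullet> b) *\<^sub>R b))"
        unfolding Q_def using B by (intro sum.cong) (auto simp: Tb c_def scaleR_add_left subset_iff)
      also have "\<dots> = Q w + s *\<^sub>R Q x" by (simp add: Q_def sum.distrib scaleR_sum_right)
      finally show ?thesis using Qw[OF w] by simp
    qed
    have pre: "T -` Z w s = Z 0 1"
    proof -
      have "T x \<in> U \<longleftrightarrow> x \<in> U" for x
        unfolding U_def using W0[OF w] by (auto simp: Tb c_def)
      then show ?thesis using s by (auto simp: Z_def QT)
    qed
    have "emeasure lborel (Z w s)
        = emeasure (density (distr lborel borel T) (\<lambda>_. (\<Prod>j\<in>Basis. \<bar>c j\<bar>))) (Z w s)"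
      using T by simp
    also have "\<dots> = ennreal (s ^ k) * emeasure (distr lborel borel T) (Z w s)"
      using Z_closed s by (subst emeasure_density_const) (simp_all add: prod)
    also have "emeasure (distr lborel borel T) (Z w s) = emeasure lborel (Z 0 1)"
      using Z_closed Tm by (subst emeasure_distr) (simp_all add: pre)
    finally show ?thesis .
  qed
  define m where "m = measure lborel (Z 0 1)"
  have bd: "bounded (Z 0 1)"
  proof -
    have "norm z \<le> (\<Sum>b\<in>(Basis :: 'a set). 1 :: real)" if z: "z \<in> Z 0 1" for z
    proof -
      have "\<bar>z \<bullet> b\<bar> \<le> 1" if b: "b \<in> Basis" for b
      proof (cases "b \<in> B")
        case True
        then show ?thesis using Basis_le_norm[OF b, of "Q z"] z True by (simp add: Z_def Qi[OF b])
      qed (use z b in \<open>simp add: Z_def U_def\<close>)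
      then show ?thesis using norm_le_l1[of z] sum_mono[of Basis "\<lambda>b. \<bar>z \<bullet> b\<bar>" "\<lambda>_. 1"] by simp
    qed
    then show ?thesis unfolding bounded_iff by blast
  qed
  have m1: "emeasure lborel (Z 0 1) = ennreal m"
    unfolding m_def using emeasure_bounded_finite[OF bd] by (simp add: emeasure_eq_ennreal_measure)
  have m0: "0 < m"
  proof -
    have "cball 0 1 \<subseteq> Z 0 1"
    proof
      fix z :: 'a assume z: "z \<in> cball 0 1"
      then have nz: "norm z \<le> 1" by simp
      have "norm (Q z) \<le> norm z" by (rule norm_le_componentwise) (simp add: Qi)
      moreover have "\<bar>z \<bullet> b\<bar> \<le> 1" if "b \<in> Basis" for b
        using Basis_le_norm[OF that, of z] nz by simp
      ultimately show "z \<in> Z 0 1" using nz by (simp add: Z_def U_def)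
    qed
    then have "emeasure lborel (cball (0::'a) 1) \<le> ennreal m"
      unfolding m1[symmetric] using Z_closed by (intro emeasure_mono) simp_all
    moreover have "0 < emeasure lborel (cball (0::'a) 1)"
    proof -
      have "0 < measure lborel (cball (0::'a) 1)" by (rule content_cball_pos) simp
      then show ?thesis
        using emeasure_lborel_cball_finite[of "0::'a" 1] by (simp add: emeasure_eq_ennreal_measure)
    qed
    ultimately show ?thesis by (metis ennreal_less_zero_iff less_le_trans)
  qed
  \<comment> \<open>Dividing by the mass of the unit cylinder makes the value of the volume of the
    unit ball irrelevant.\<close>
  define \<nu> where "\<nu> = scale_measure (ennreal (1 / m)) (distr (density lborel (indicator U)) borel h)"
  show ?thesis
  proof
    show "sets \<nu> = sets borel" by (simp add: \<nu>_def)
    fix v s assume v: "v \<in> V" and s: "(0::real) < s"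
    then obtain w where w: "w \<in> W" "v = f w" using f(2) by blast
    have nrm: "norm (h z - v) = norm (Q z - w)" for z
    proof -
      have "Q z - w \<in> W" using QW w subspace_diff[OF subspace_span] unfolding W_def by blast
      then show ?thesis using f(3) linear_diff[OF f(1)] by (metis h_def w(2))
    qed
    have UZ: "U \<inter> h -` cball v s = Z w s"
      by (auto simp: Z_def dist_norm norm_minus_commute[of v] nrm)
    have Um: "U \<in> sets borel" using U_closed by (rule borel_closed)
    have hm: "h -` cball v s \<in> sets borel"
      using measurable_sets[OF hmeas, of "cball v s"] by simp
    have "emeasure \<nu> (cball v s) = ennreal (1 / m) * emeasure (density lborel (indicator U)) (h -` cball v s)"
      using hmeas by (simp add: \<nu>_def emeasure_distr)
    also have "emeasure (density lborel (indicator U)) (h -` cball v s) = emeasure lborel (U \<inter> h -` cball v s)"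
      using Um hm by (intro emeasure_restricted) simp_all
    also have "\<dots> = ennreal (s ^ k) * ennreal m" by (simp add: UZ scale[OF w(1) s] m1)
    also have "ennreal (1 / m) * (ennreal (s ^ k) * ennreal m) = ennreal (s ^ k)"
      using m0 s by (simp add: ennreal_mult[symmetric])
    finally show "emeasure \<nu> (cball v s) = ennreal (s ^ k)" .
  qed
qed

text \<open>The mass distribution principle: a covering set of diameter s that meets
  \<open>S\<close> is contained in a ball of radius s centred at a point of \<open>S\<close>, hence
  on \<open>V\<close>, and this ball has mass s^k. The cost of a cover therefore bounds the outer
  measure.\<close>

lemma outer_measure_le_hausdorff:
  fixes V :: "'a::euclidean_space set"
  assumes k: "0 < k" and sets: "sets \<nu> = sets borel"
    and ball: "\<And>w s. w \<in> V \<Longrightarrow> 0 < s \<Longrightarrow> emeasure \<nu> (cball w s) = ennreal (s ^ k)"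
    and S: "S \<subseteq> V"
  shows "outer_measure_of \<nu> S \<le> hausdorff k S"
proof (rule ccontr)
  assume "\<not> outer_measure_of \<nu> S \<le> hausdorff k S"
  then have lt: "hausdorff k S < outer_measure_of \<nu> S" by simp
  \<comment> \<open>The bound 1 on the diameters is arbitrary, because the mass of a disc is known
    at every scale.\<close>
  obtain A where A: "S \<subseteq> (\<Union>i. A i)" "\<And>i. bounded (A i)" "\<And>i. diameter (A i) \<le> 1"
      "(\<Sum>i. ennreal (diameter (A i) ^ k)) < outer_measure_of \<nu> S"
    using hausdorff_less_cover[OF lt, of 1] by (metis zero_less_one)
  define D where "D i = (if S \<inter> A i = {} then {} else cball (SOME w. w \<in> S \<inter> A i) (diameter (A i)))" for i
  have sub: "S \<inter> A i \<subseteq> D i" and em: "emeasure \<nu> (D i) \<le> ennreal (diameter (A i) ^ k)" for i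
  proof -
    have d0: "0 \<le> diameter (A i)" by (rule diameter_ge_0[OF A(2)])
    have "S \<inter> A i \<subseteq> D i \<and> emeasure \<nu> (D i) \<le> ennreal (diameter (A i) ^ k)"
    proof (cases "S \<inter> A i = {}")
      case False
      define w where "w = (SOME w. w \<in> S \<inter> A i)"
      have w: "w \<in> S \<inter> A i" unfolding w_def by (rule someI_ex) (use False in blast)
      then have wV: "w \<in> V" using S by blast
      have D: "D i = cball w (diameter (A i))" using False by (simp add: D_def w_def)
      have "S \<inter> A i \<subseteq> cball w (diameter (A i))"
        using diameter_bounded_bound[OF A(2)] w by auto
      moreover have "emeasure \<nu> (cball w (diameter (A i))) \<le> ennreal (diameter (A i) ^ k)"
      \<comment> \<open>The formula for the mass is given for positive radii; a single point is null
        because it lies in all small discs around it.\<close>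
      proof (cases "diameter (A i) = 0")
        case True
        have "emeasure \<nu> (cball w 0) \<le> 0"
        proof (rule ennreal_le_epsilon)
          fix e :: real assume e: "0 < e"
          define s where "s = min 1 e"
          have s: "0 < s" "s \<le> 1" "s \<le> e" using e by (auto simp: s_def)
          have "emeasure \<nu> (cball w 0) \<le> emeasure \<nu> (cball w s)"
            using s sets by (intro emeasure_mono) auto
          also have "\<dots> = ennreal (s ^ k)" by (rule ball[OF wV s(1)])
          also have "\<dots> \<le> ennreal e"
          proof (rule ennreal_leI)
            have "s ^ k \<le> s ^ 1" using s k by (intro power_decreasing) auto
            then show "s ^ k \<le> e" using s by simp
          qed
          finally show "emeasure \<nu> (cball w 0) \<le> 0 + ennreal e" by simp
        qed
        then show ?thesis using True by simp
      next
        case False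
        then show ?thesis using ball[OF wV, of "diameter (A i)"] d0 by simp
      qed
      ultimately show ?thesis by (simp add: D)
    qed (simp add: D_def)
    then show "S \<inter> A i \<subseteq> D i" "emeasure \<nu> (D i) \<le> ennreal (diameter (A i) ^ k)" by auto
  qed
  have Dm: "D i \<in> sets \<nu>" for i unfolding D_def sets by simp
  have "outer_measure_of \<nu> S \<le> outer_measure_of \<nu> (\<Union>i. D i)"
    by (rule outer_measure_of_mono) (use A(1) sub in blast)
  also have "\<dots> = emeasure \<nu> (\<Union>i. D i)" using Dm by (intro outer_measure_of_eq) auto
  also have "\<dots> \<le> (\<Sum>i. emeasure \<nu> (D i))" using Dm by (intro emeasure_subadditive_countably) auto
  also have "\<dots> \<le> (\<Sum>i. ennreal (diameter (A i) ^ k))" by (intro suminf_le em) simp_all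
  finally show False using A(4) by simp
qed

subsection \<open>Whitney extension with Hoelder continuous derivative\<close>

lemma powr_midpoint_concave:
  fixes a b q :: real
  assumes "0 \<le> a" "0 \<le> b" "0 \<le> q" "q \<le> 1"
  shows "a powr q + b powr q \<le> 2 * ((a + b) / 2) powr q"
proof (cases "a = 0 \<and> b = 0")
  case False
  define m where "m = (a + b) / 2"
  have m: "0 < m" using False assms by (auto simp: m_def)
  \<comment> \<open>The right-hand side is the tangent of the power function at the midpoint; by
    Young's inequality it lies above the function. Summed over \<open>a\<close> and
    \<open>b\<close>, its values give twice the value at the midpoint.\<close>
  have tangent: "x powr q \<le> m powr q * (q * (x / m) + (1 - q))" if x: "0 \<le> x" for x
  proof (cases "x = 0")
    case False
    then have "(x / m) powr q * 1 powr (1 - q) \<le> q * (x / m) + (1 - q) * 1"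
      using x m assms by (intro Youngs_inequality_0) auto
    then have "(x / m) powr q \<le> q * (x / m) + (1 - q)" by simp
    moreover have "x powr q = m powr q * (x / m) powr q"
      using m x by (simp add: powr_mult[symmetric])
    ultimately show ?thesis by (simp add: mult_left_mono)
  qed (use assms m in simp)
  have "a powr q + b powr q \<le> m powr q * (q * (a / m) + (1 - q)) + m powr q * (q * (b / m) + (1 - q))"
    using tangent assms by (intro add_mono) auto
  also have "\<dots> = m powr q * (q * ((a + b) / m) + 2 * (1 - q))" by (simp add: algebra_simps add_divide_distrib)
  also have "(a + b) / m = 2" using m by (simp add: m_def field_simps)
  finally show ?thesis by (simp add: m_def[symmetric])
qed simp

text \<open>After division by the sum both terms lie in [0,1], where an exponent of at most 1 can
  only increase the value.\<close>

lemma powr_subadditive: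
  fixes a b q :: real
  assumes "0 \<le> a" "0 \<le> b" "0 \<le> q" "q \<le> 1"
  shows "(a + b) powr q \<le> a powr q + b powr q"
proof (cases "a + b = 0")
  case False
  then have pos: "0 < a + b" using assms by simp
  have ge: "s \<le> s powr q" if "0 \<le> s" "s \<le> 1" for s :: real
    using powr_mono'[of q 1 s] that assms by simp
  have "1 = a / (a + b) + b / (a + b)" using pos by (simp add: add_divide_distrib[symmetric])
  also have "\<dots> \<le> (a / (a + b)) powr q + (b / (a + b)) powr q"
    using assms pos by (intro add_mono ge) (auto simp: field_simps)
  finally have "(a + b) powr q * 1 \<le> (a + b) powr q * ((a / (a + b)) powr q + (b / (a + b)) powr q)"
    by (intro mult_left_mono) auto
  also have "\<dots> = a powr q + b powr q"
    using pos assms by (simp add: distrib_left powr_mult[symmetric])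
  finally show ?thesis by simp
next
  case True
  then show ?thesis by simp
qed

text \<open>With the exponent (1 + \<alpha>) / 2, at most 1, applied to squared norms, concavity
  reduces the left side to the parallelogram identity, and subadditivity separates the two squares.
  The factor 2 on the term in \<open>x\<close> is sharp: averaging two translates of a barrier must
  not enlarge its coefficient.\<close>

lemma norm_powr_second_difference:
  fixes x u :: "'a::real_inner"
  assumes "0 < \<alpha>" "\<alpha> \<le> 1"
  shows "norm (x + u) powr (1 + \<alpha>) + norm (x - u) powr (1 + \<alpha>)
    \<le> 2 * norm x powr (1 + \<alpha>) + 2 * norm u powr (1 + \<alpha>)"
proof -
  define q where "q = (1 + \<alpha>) / 2"
  have q: "0 \<le> q" "q \<le> 1" "1 + \<alpha> = 2 * q" using assms by (auto simp: q_def)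
  have sq: "norm z powr (1 + \<alpha>) = ((norm z)\<^sup>2) powr q" for z :: 'a
  proof -
    have "(norm z)\<^sup>2 = norm z powr 2" by (cases "z = 0") (simp_all add: powr_numeral)
    then show ?thesis by (simp only: q(3) powr_powr)
  qed
  have "((norm (x + u))\<^sup>2) powr q + ((norm (x - u))\<^sup>2) powr q
      \<le> 2 * (((norm (x + u))\<^sup>2 + (norm (x - u))\<^sup>2) / 2) powr q"
    using q by (intro powr_midpoint_concave) auto
  also have "((norm (x + u))\<^sup>2 + (norm (x - u))\<^sup>2) / 2 = (norm x)\<^sup>2 + (norm u)\<^sup>2"
    by (simp add: power2_norm_eq_inner inner_add inner_diff inner_commute)
  also have "2 * ((norm x)\<^sup>2 + (norm u)\<^sup>2) powr q \<le> 2 * (((norm x)\<^sup>2) powr q + ((norm u)\<^sup>2) powr q)"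
    using q by (intro mult_left_mono powr_subadditive) auto
  finally show ?thesis by (simp add: sq)
qed

section \<open>From second differences to a Hoelder continuous derivative\<close>

lemma additive_bounded_imp_linear:
  fixes D :: "'a::real_normed_vector \<Rightarrow> real"
  assumes add: "\<And>h k. D (h + k) = D h + D k"
    and bd: "\<And>R. \<exists>B. \<forall>h. norm h \<le> R \<longrightarrow> \<bar>D h\<bar> \<le> B"
  shows "linear D"
proof (rule linearI)
  fix r :: real and h
  \<comment> \<open>The defect from homogeneity is additive and vanishes at 1, hence at all
    integers. So it is 1-periodic and, being bounded on the unit interval, bounded everywhere; a
    bounded additive function is 0.\<close>
  define \<psi> where "\<psi> t = D (t *\<^sub>R h) - t * D h" for t
  have \<psi>_add: "\<psi> (s + t) = \<psi> s + \<psi> t" for s t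
    by (simp add: \<psi>_def scaleR_add_left add algebra_simps)
  have \<psi>_0: "\<psi> 0 = 0" using \<psi>_add[of 0 0] by simp
  have \<psi>_nat: "\<psi> (real n * t) = real n * \<psi> t" for n t
    by (induction n) (simp_all add: \<psi>_0 \<psi>_add distrib_right)
  have \<psi>_neg: "\<psi> (- t) = - \<psi> t" for t using \<psi>_add[of t "- t"] \<psi>_0 by simp
  have \<psi>_int: "\<psi> (of_int n) = 0" for n :: int
  proof -
    have "\<psi> (real m) = 0" for m using \<psi>_nat[of m 1] by (simp add: \<psi>_def)
    then show ?thesis by (cases n) (simp_all add: \<psi>_neg del: of_nat_Suc)
  qed
  obtain B where B: "\<And>h'. norm h' \<le> norm h \<Longrightarrow> \<bar>D h'\<bar> \<le> B" using bd by blast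
  have b01: "\<bar>\<psi> t\<bar> \<le> 2 * B" if "0 \<le> t" "t \<le> 1" for t
  proof -
    have "\<bar>D (t *\<^sub>R h)\<bar> \<le> B" using that by (intro B) (simp add: mult_left_le_one_le)
    moreover have "\<bar>t * D h\<bar> \<le> B"
      using that B[of h] mult_left_le_one_le[of "\<bar>D h\<bar>" t] by (simp add: abs_mult)
    ultimately show ?thesis by (simp add: \<psi>_def)
  qed
  have ball: "\<bar>\<psi> t\<bar> \<le> 2 * B" for t
  proof -
    have "\<psi> t = \<psi> (frac t)" using \<psi>_add[of "of_int \<lfloor>t\<rfloor>" "frac t"] \<psi>_int by (simp add: frac_def)
    then show ?thesis using b01[of "frac t"] by (simp add: frac_lt_1 less_imp_le)
  qed
  have "\<psi> r = 0"
  proof (rule ccontr)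
    assume "\<psi> r \<noteq> 0"
    then obtain n :: nat where "2 * B < real n * \<bar>\<psi> r\<bar>" using reals_Archimedean3[of "\<bar>\<psi> r\<bar>"] by auto
    then show False using ball[of "real n * r"] by (simp add: \<psi>_nat abs_mult)
  qed
  then show "D (r *\<^sub>R h) = r *\<^sub>R D h" by (simp add: \<psi>_def)
qed (rule add)

text \<open>Halving the step changes a difference quotient by a second difference, and the exponent
  above 1 makes these changes decay geometrically. The limits are the directional derivatives; local
  boundedness of \<open>F\<close> serves to exclude pathological additive limits.\<close>

lemma C1_alpha_of_second_difference:
  fixes F :: "'a::euclidean_space \<Rightarrow> real"
  assumes \<alpha>: "0 < \<alpha>" "\<alpha> \<le> 1" and M: "0 \<le> M"
    and sd: "\<And>x u. \<bar>F (x + u) + F (x - u) - 2 * F x\<bar> \<le> 2 * M * norm u powr (1 + \<alpha>)"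
    and bd: "\<And>R. \<exists>B. \<forall>x. norm x \<le> R \<longrightarrow> \<bar>F x\<bar> \<le> B"
  shows "\<exists>D :: 'a \<Rightarrow> 'a \<Rightarrow>\<^sub>L real. (\<forall>x. (F has_derivative blinfun_apply (D x)) (at x)) \<and>
    (\<exists>C\<ge>0. \<forall>x y. norm (D x - D y) \<le> C * norm (x - y) powr \<alpha>)"
proof -
  define \<rho> where "\<rho> = 2 powr (- \<alpha>)"
  have \<rho>: "0 < \<rho>" "\<rho> < 1" using \<alpha> powr_less_mono[of "-\<alpha>" 0 2] by (auto simp: \<rho>_def)
  have \<rho>n: "\<rho> ^ n = 2 powr (- \<alpha> * real n)" for n
    unfolding \<rho>_def by (simp add: powr_powr powr_realpow[symmetric])
  \<comment> \<open>The sum of the geometric series with ratio 2^(-\<alpha>).\<close>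
  define c where "c = M / (1 - \<rho>)"
  have c: "0 \<le> c" using \<rho> M by (simp add: c_def)
  have scaled: "2 ^ n * norm (v /\<^sub>R 2 ^ n) powr (1 + \<alpha>) = \<rho> ^ n * norm v powr (1 + \<alpha>)" for n and v :: 'a
  proof -
    have "norm (v /\<^sub>R 2 ^ n) powr (1 + \<alpha>) = (2 powr - real n) powr (1 + \<alpha>) * norm v powr (1 + \<alpha>)"
      by (simp add: powr_mult[symmetric] powr_minus powr_realpow)
    moreover have "2 ^ n * (2 powr - real n) powr (1 + \<alpha>) = \<rho> ^ n"
      by (simp add: \<rho>n powr_powr powr_realpow[symmetric] powr_add[symmetric] algebra_simps)
    ultimately show ?thesis by (metis mult.assoc)
  qed
  have par: "\<bar>F x + F (x + a + b) - F (x + a) - F (x + b)\<bar> \<le> 4 * M * (norm a + norm b) powr (1 + \<alpha>)" for x a b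
  proof -
    \<comment> \<open>Both diagonals of the parallelogram have the midpoint \<open>m\<close>, so the
      mixed difference is the difference of two second differences at \<open>m\<close>.\<close>
    define m where "m = x + (a + b) /\<^sub>R 2"
    have half: "z /\<^sub>R 2 + z /\<^sub>R 2 = z" for z :: 'a by (simp add: scaleR_add_left[symmetric])
    have e: "m + (a + b) /\<^sub>R 2 = x + a + b" "m - (a + b) /\<^sub>R 2 = x"
        "m + (a - b) /\<^sub>R 2 = x + a" "m - (a - b) /\<^sub>R 2 = x + b"
      using half[of a] half[of b] by (simp_all add: m_def algebra_simps)
    have "\<bar>F (x + a + b) + F x - 2 * F m\<bar> \<le> 2 * M * norm ((a + b) /\<^sub>R 2) powr (1 + \<alpha>)"
      using sd[of m "(a + b) /\<^sub>R 2"] unfolding e .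
    also have "\<dots> \<le> 2 * M * (norm a + norm b) powr (1 + \<alpha>)"
    proof (intro mult_left_mono powr_mono2)
      show "norm ((a + b) /\<^sub>R 2) \<le> norm a + norm b"
        using norm_triangle_ineq[of a b] norm_ge_zero[of a] norm_ge_zero[of b]
        unfolding norm_scaleR by (simp del: norm_ge_zero)
    qed (use M \<alpha> in simp_all)
    finally have 1: "\<bar>F (x + a + b) + F x - 2 * F m\<bar> \<le> 2 * M * (norm a + norm b) powr (1 + \<alpha>)" .
    have "\<bar>F (x + a) + F (x + b) - 2 * F m\<bar> \<le> 2 * M * norm ((a - b) /\<^sub>R 2) powr (1 + \<alpha>)"
      using sd[of m "(a - b) /\<^sub>R 2"] unfolding e .
    also have "\<dots> \<le> 2 * M * (norm a + norm b) powr (1 + \<alpha>)"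
    proof (intro mult_left_mono powr_mono2)
      show "norm ((a - b) /\<^sub>R 2) \<le> norm a + norm b"
        using norm_triangle_ineq4[of a b] norm_ge_zero[of a] norm_ge_zero[of b]
        unfolding norm_scaleR by (simp del: norm_ge_zero)
    qed (use M \<alpha> in simp_all)
    finally show ?thesis using 1 by linarith
  qed
  define a where "a x h n = 2 ^ n * (F (x + h /\<^sub>R 2 ^ n) - F x)" for x h and n :: nat
  have step: "\<bar>a x h (Suc n) - a x h n\<bar> \<le> M * norm h powr (1 + \<alpha>) * \<rho> ^ n" for x h n
  proof -
    \<comment> \<open>The finer quotient minus the coarser one is, up to sign and scaling, the
      second difference at \<open>x + v\<close> with step \<open>v\<close>.\<close>
    define v where "v = h /\<^sub>R 2 ^ Suc n"
    have v2: "h /\<^sub>R 2 ^ n = v + v" by (simp add: v_def scaleR_add_left[symmetric])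
    have "a x h (Suc n) - a x h n = - (2 ^ n * (F (x + v + v) + F (x + v - v) - 2 * F (x + v)))"
    proof -
      have "a x h (Suc n) = 2 * 2 ^ n * (F (x + v) - F x)" by (simp only: a_def v_def power_Suc)
      moreover have "a x h n = 2 ^ n * (F (x + v + v) - F x)" unfolding a_def v2 add.assoc ..
      ultimately show ?thesis by (simp add: algebra_simps)
    qed
    also have "\<bar>\<dots>\<bar> = 2 ^ n * \<bar>F (x + v + v) + F (x + v - v) - 2 * F (x + v)\<bar>"
      by (simp add: abs_mult)
    also have "\<dots> \<le> 2 ^ n * (2 * M * norm v powr (1 + \<alpha>))"
      by (intro mult_left_mono sd) simp
    also have "\<dots> = M * (2 ^ Suc n * norm v powr (1 + \<alpha>))" by simp
    also have "\<dots> = M * (\<rho> ^ Suc n * norm h powr (1 + \<alpha>))" unfolding v_def scaled ..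
    also have "\<dots> \<le> M * (\<rho> ^ n * norm h powr (1 + \<alpha>))"
      using M \<rho> by (intro mult_left_mono mult_right_mono) (auto intro!: mult_left_le_one_le)
    finally show ?thesis by (simp add: mult_ac)
  qed
  have geo: "summable (\<lambda>n. M * norm h powr (1 + \<alpha>) * \<rho> ^ n)" for h :: 'a
    using \<rho> by (intro summable_mult summable_geometric) simp
  have summ: "summable (\<lambda>n. a x h (Suc n) - a x h n)" for x h
    by (rule summable_comparison_test'[OF geo[of h], of 0]) (use step in simp)
  \<comment> \<open>The term \<open>a x h 0\<close> is the full increment of \<open>F\<close>, so
    the telescoping series is, up to sign, the Taylor error.\<close>
  define D where "D x h = a x h 0 + (\<Sum>n. a x h (Suc n) - a x h n)" for x h
  have lim: "a x h \<longlonglongrightarrow> D x h" for x h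
  proof -
    have "(\<lambda>n. a x h n - a x h 0) \<longlonglongrightarrow> (\<Sum>n. a x h (Suc n) - a x h n)"
      using summable_LIMSEQ[OF summ[of x h]] by (simp add: sum_lessThan_telescope)
    from tendsto_add[OF this tendsto_const[of "a x h 0"]] show ?thesis by (simp add: D_def add.commute)
  qed
  have near: "\<bar>F (x + h) - F x - D x h\<bar> \<le> c * norm h powr (1 + \<alpha>)" for x h
  proof -
    have "\<bar>\<Sum>n. a x h (Suc n) - a x h n\<bar> \<le> (\<Sum>n. M * norm h powr (1 + \<alpha>) * \<rho> ^ n)"
    proof -
      have sn: "summable (\<lambda>n. \<bar>a x h (Suc n) - a x h n\<bar>)"
        by (rule summable_comparison_test'[OF geo[of h], of 0]) (use step in simp)
      have "\<bar>\<Sum>n. a x h (Suc n) - a x h n\<bar> \<le> (\<Sum>n. \<bar>a x h (Suc n) - a x h n\<bar>)"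
        by (rule summable_rabs[OF sn])
      also have "\<dots> \<le> (\<Sum>n. M * norm h powr (1 + \<alpha>) * \<rho> ^ n)"
        by (rule suminf_le[OF step sn geo])
      finally show ?thesis .
    qed
    also have "\<dots> = c * norm h powr (1 + \<alpha>)"
      using \<rho> by (subst suminf_mult) (auto simp: summable_geometric suminf_geometric c_def)
    finally show ?thesis by (simp add: D_def a_def)
  qed
  have Dadd: "D x (h + k) = D x h + D x k" for x h k
  proof -
    have "(\<lambda>n. a x (h + k) n - a x h n - a x k n) \<longlonglongrightarrow> 0"
    proof (rule Lim_null_comparison)
      show "(\<lambda>n. 4 * M * (norm h + norm k) powr (1 + \<alpha>) * \<rho> ^ n) \<longlonglongrightarrow> 0"
        using \<rho> by (intro tendsto_mult_right_zero LIMSEQ_power_zero) simp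
      show "\<forall>\<^sub>F n in sequentially. norm (a x (h + k) n - a x h n - a x k n)
          \<le> 4 * M * (norm h + norm k) powr (1 + \<alpha>) * \<rho> ^ n"
      proof (rule always_eventually, rule allI)
        fix n :: nat
        have e: "x + (h + k) /\<^sub>R 2 ^ n = x + h /\<^sub>R 2 ^ n + k /\<^sub>R 2 ^ n" by (simp add: scaleR_add_right)
        have "a x (h + k) n - a x h n - a x k n =
            2 ^ n * (F x + F (x + h /\<^sub>R 2 ^ n + k /\<^sub>R 2 ^ n) - F (x + h /\<^sub>R 2 ^ n) - F (x + k /\<^sub>R 2 ^ n))"
          unfolding a_def e by (simp add: algebra_simps)
        then have "norm (a x (h + k) n - a x h n - a x k n) =
            2 ^ n * \<bar>F x + F (x + h /\<^sub>R 2 ^ n + k /\<^sub>R 2 ^ n) - F (x + h /\<^sub>R 2 ^ n) - F (x + k /\<^sub>R 2 ^ n)\<bar>"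
          by (simp add: abs_mult)
        also have "\<dots> \<le> 2 ^ n * (4 * M * (norm (h /\<^sub>R 2 ^ n) + norm (k /\<^sub>R 2 ^ n)) powr (1 + \<alpha>))"
          by (intro mult_left_mono par) simp
        also have "norm (h /\<^sub>R 2 ^ n) + norm (k /\<^sub>R 2 ^ n) = (norm h + norm k) / 2 ^ n"
          by (simp add: field_simps)
        also have "((norm h + norm k) / 2 ^ n) powr (1 + \<alpha>)
            = (norm h + norm k) powr (1 + \<alpha>) * (1 / 2 ^ n) powr (1 + \<alpha>)"
          by (simp add: powr_mult[symmetric])
        also have "(1 / 2 ^ n :: real) powr (1 + \<alpha>) = \<rho> ^ n / 2 ^ n"
        proof -
          have "(1 / 2 ^ n :: real) = 2 powr - real n" by (simp add: powr_minus powr_realpow divide_inverse)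
          then have "(1 / 2 ^ n :: real) powr (1 + \<alpha>) = 2 powr (- real n * (1 + \<alpha>))" by (simp add: powr_powr)
          also have "\<dots> = 2 powr (- \<alpha> * real n) * 2 powr (- real n)"
            by (simp add: powr_add[symmetric] algebra_simps)
          finally show ?thesis unfolding \<rho>n by (simp add: powr_minus powr_realpow divide_inverse)
        qed
        finally show "norm (a x (h + k) n - a x h n - a x k n)
            \<le> 4 * M * (norm h + norm k) powr (1 + \<alpha>) * \<rho> ^ n" by simp
      qed
    qed
    moreover have "(\<lambda>n. a x (h + k) n - a x h n - a x k n) \<longlonglongrightarrow> D x (h + k) - D x h - D x k"
      by (intro tendsto_diff lim)
    ultimately have "D x (h + k) - D x h - D x k = 0" by (rule LIMSEQ_unique[rotated])
    then show ?thesis by simp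
  qed
  have Dlin: "linear (D x)" for x
  proof (rule additive_bounded_imp_linear[OF Dadd])
    fix R :: real
    obtain B where B: "\<And>z. norm z \<le> norm x + R \<Longrightarrow> \<bar>F z\<bar> \<le> B" using bd by blast
    have "\<bar>D x h\<bar> \<le> 2 * B + c * R powr (1 + \<alpha>)" if h: "norm h \<le> R" for h
    proof -
      have "0 \<le> R" using h norm_ge_zero order_trans by blast
      then have "\<bar>F x\<bar> \<le> B" "\<bar>F (x + h)\<bar> \<le> B"
        using h norm_triangle_ineq[of x h] by (auto intro!: B)
      moreover have "c * norm h powr (1 + \<alpha>) \<le> c * R powr (1 + \<alpha>)"
        using c h \<alpha> by (intro mult_left_mono powr_mono2) auto
      ultimately show ?thesis using near[of x h] by linarith
    qed
    then show "\<exists>B. \<forall>h. norm h \<le> R \<longrightarrow> \<bar>D x h\<bar> \<le> B" by blast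
  qed
  have Dbl: "bounded_linear (D x)" for x using Dlin by (simp add: linear_conv_bounded_linear)
  have ap: "blinfun_apply (Blinfun (D x)) = D x" for x by (rule bounded_linear_Blinfun_apply[OF Dbl])
  have deriv: "(F has_derivative D x) (at x)" for x
    unfolding has_derivative_at
  proof (intro conjI Dbl)
    have "((\<lambda>h. c * norm h powr \<alpha>) \<longlongrightarrow> c * 0 powr \<alpha>) (at (0::'a))"
      using \<alpha> by (intro tendsto_intros tendsto_powr' tendsto_norm_zero tendsto_ident_at) auto
    then have z: "((\<lambda>h. c * norm h powr \<alpha>) \<longlongrightarrow> 0) (at (0::'a))" by simp
    show "(\<lambda>h. norm (F (x + h) - F x - D x h) / norm h) \<midarrow>0\<rightarrow> 0"
    proof (rule Lim_null_comparison[OF _ z], rule always_eventually, rule allI)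
      fix h :: 'a
      show "norm (norm (F (x + h) - F x - D x h) / norm h) \<le> c * norm h powr \<alpha>"
        using near[of x h] c by (cases "h = 0") (auto simp: divide_le_eq powr_add mult_ac)
    qed
  qed
  \<comment> \<open>Two Taylor errors with constant \<open>c\<close>, plus a mixed difference of two
    steps of length d, which costs 4 * M * (2 * d)^(1 + \<alpha>).\<close>
  define C where "C = 2 * c + 4 * M * 2 powr (1 + \<alpha>)"
  have C: "0 \<le> C" using c M by (simp add: C_def)
  have hold: "norm (Blinfun (D x) - Blinfun (D y)) \<le> C * norm (x - y) powr \<alpha>" for x y
  proof (cases "x = y")
    case False
    define d where "d = norm (x - y)"
    have d: "0 < d" using False by (simp add: d_def)
    have tri: "\<bar>p + q - r\<bar> \<le> \<bar>p\<bar> + \<bar>q\<bar> + \<bar>r\<bar>" for p q r :: real by linarith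
    \<comment> \<open>For increments as long as the distance of the two base points all errors have
      the same order; homogeneity then gives the operator norm.\<close>
    have at_d: "\<bar>D x h - D y h\<bar> \<le> C * d powr (1 + \<alpha>)" if h: "norm h = d" for h
    proof -
      have 1: "\<bar>F (x + h) - F x - D x h\<bar> \<le> c * d powr (1 + \<alpha>)" "\<bar>F (y + h) - F y - D y h\<bar> \<le> c * d powr (1 + \<alpha>)"
        using near[of x h] near[of y h] h by auto
      have e: "y + (x - y) + h = x + h" "y + (x - y) = x" by simp_all
      have "\<bar>F y + F (x + h) - F x - F (y + h)\<bar> \<le> 4 * M * (d + d) powr (1 + \<alpha>)"
        using par[of y "x - y" h] unfolding e h d_def[symmetric] .
      also have "(d + d) powr (1 + \<alpha>) = 2 powr (1 + \<alpha>) * d powr (1 + \<alpha>)"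
        using d powr_mult[of 2 d "1 + \<alpha>"] by (simp only: mult_2)
      finally have 2: "\<bar>F y + F (x + h) - F x - F (y + h)\<bar> \<le> 4 * M * (2 powr (1 + \<alpha>) * d powr (1 + \<alpha>))" .
      have "D x h - D y h = (F y + F (x + h) - F x - F (y + h)) + (F (y + h) - F y - D y h)
          - (F (x + h) - F x - D x h)" by simp
      then have "\<bar>D x h - D y h\<bar> \<le> \<bar>F y + F (x + h) - F x - F (y + h)\<bar> + \<bar>F (y + h) - F y - D y h\<bar>
          + \<bar>F (x + h) - F x - D x h\<bar>"
        by (simp only: tri)
      also note add_mono[OF add_mono[OF 2 1(2)] 1(1)]
      also have "4 * M * (2 powr (1 + \<alpha>) * d powr (1 + \<alpha>)) + c * d powr (1 + \<alpha>) + c * d powr (1 + \<alpha>)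
          = C * d powr (1 + \<alpha>)"
        by (simp add: C_def distrib_right)
      finally show ?thesis .
    qed
    have "norm (Blinfun (D x) - Blinfun (D y)) \<le> C * d powr \<alpha>"
    proof (rule norm_blinfun_bound)
      fix h :: 'a
      show "norm ((Blinfun (D x) - Blinfun (D y)) h) \<le> C * d powr \<alpha> * norm h"
      proof (cases "h = 0")
        case False
        define h' where "h' = (d / norm h) *\<^sub>R h"
        have nh': "norm h' = d" using False d by (simp add: h'_def)
        have "D x h' - D y h' = (d / norm h) * (D x h - D y h)"
          unfolding h'_def linear_scale[OF Dlin] by (simp add: right_diff_distrib)
        then have "\<bar>D x h' - D y h'\<bar> = (d / norm h) * \<bar>D x h - D y h\<bar>"
          using d by (simp only: abs_mult) simp
        then have "(d / norm h) * \<bar>D x h - D y h\<bar> \<le> C * d powr (1 + \<alpha>)"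
          using at_d[OF nh'] by linarith
        then have "(norm h / d) * ((d / norm h) * \<bar>D x h - D y h\<bar>) \<le> (norm h / d) * (C * d powr (1 + \<alpha>))"
          using d by (intro mult_left_mono) simp_all
        moreover have "(norm h / d) * ((d / norm h) * \<bar>D x h - D y h\<bar>) = \<bar>D x h - D y h\<bar>"
          using d False by simp
        moreover have "(norm h / d) * (C * d powr (1 + \<alpha>)) = C * d powr \<alpha> * norm h"
          using d by (simp add: powr_add)
        ultimately have "\<bar>D x h - D y h\<bar> \<le> C * d powr \<alpha> * norm h" by (simp only:)
        then show ?thesis by (simp add: blinfun.diff_left ap)
      qed (simp add: blinfun.zero_right)
    qed (rule mult_nonneg_nonneg[OF C powr_ge_zero])
    then show ?thesis unfolding d_def .
  next
    case True
    show ?thesis unfolding True diff_self norm_zero by (rule mult_nonneg_nonneg[OF C powr_ge_zero])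
  qed
  show ?thesis
  proof (intro exI conjI allI)
    show "(F has_derivative blinfun_apply (Blinfun (D x))) (at x)" for x
      unfolding ap by (rule deriv)
    show "norm (Blinfun (D x) - Blinfun (D y)) \<le> C * norm (x - y) powr \<alpha>" for x y
      by (rule hold)
  qed (rule C)
qed

section \<open>Extension of first order jets\<close>

text \<open>The extension is the upper envelope of the functions lying below all upper barriers
  \<open>f y + L y (x - y) + M * norm (x - y) powr (1 + \<alpha>)\<close> whose second differences are bounded below.
  Maximality forces the upper bound on its second differences: otherwise the average of two translates
  of the envelope, lowered by the admissible error, would be a larger competitor.\<close>

lemma Whitney_extension_scalar:
  fixes f :: "'a::euclidean_space \<Rightarrow> real" and L :: "'a \<Rightarrow> 'a \<Rightarrow>\<^sub>L real"
  assumes \<alpha>: "0 < \<alpha>" "\<alpha> \<le> 1" and C: "0 \<le> C" and ne: "K \<noteq> {}"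
    and jet: "\<And>y z. y \<in> K \<Longrightarrow> z \<in> K \<Longrightarrow> \<bar>f z - f y - L y (z - y)\<bar> \<le> C * norm (z - y) powr (1 + \<alpha>)"
    and hold: "\<And>y z. y \<in> K \<Longrightarrow> z \<in> K \<Longrightarrow> norm (L z - L y) \<le> C * norm (z - y) powr \<alpha>"
  shows "\<exists>F D. (\<forall>y\<in>K. F y = f y) \<and> (\<forall>x. (F has_derivative blinfun_apply (D x)) (at x)) \<and>
    (\<exists>C\<ge>0. \<forall>x y. norm ((D :: 'a \<Rightarrow> 'a \<Rightarrow>\<^sub>L real) x - D y) \<le> C * norm (x - y) powr \<alpha>)"
proof -
  \<comment> \<open>With s the larger distance of \<open>x\<close> from the two base points, these
    are at most 2 * s apart. The jet error contributes 4 * C and the change of \<open>L\<close>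
    another 2 * C, both times s^(1 + \<alpha>).\<close>
  define M where "M = 6 * C"
  define w where "w u = norm u powr (1 + \<alpha>)" for u :: 'a
  define l where "l y x = f y + L y (x - y)" for y x
  have M: "0 \<le> M" using C by (simp add: M_def)
  have wsd: "w (x + u) + w (x - u) \<le> 2 * w x + 2 * w u" for x u
    unfolding w_def by (rule norm_powr_second_difference[OF \<alpha>])
  have Mwsd: "M * w (x + u) + M * w (x - u) \<le> 2 * (M * w x) + 2 * (M * w u)" for x u
    using mult_left_mono[OF wsd M, of x u] by (simp add: distrib_left mult_ac)
  have lsd: "l y (x + u) + l y (x - u) = 2 * l y x" for x y u
    by (simp add: l_def blinfun.add_right blinfun.diff_right)
  \<comment> \<open>Every lower barrier lies below every upper barrier. This makes the lower
    barriers competitors, so the family is nonempty and the envelope is squeezed to \<open>f\<close>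
    on \<open>K\<close>.\<close>
  have cross: "l z x - M * w (x - z) \<le> l y x + M * w (x - y)" if yz: "y \<in> K" "z \<in> K" for y z x
  proof -
    define s where "s = max (norm (x - y)) (norm (x - z))"
    have s: "norm (x - y) \<le> s" "norm (x - z) \<le> s" "0 \<le> s" by (auto simp: s_def le_max_iff_disj)
    have zy: "norm (z - y) \<le> 2 * s"
      using norm_triangle_ineq4[of "x - y" "x - z"] s by simp
    have p2: "2 powr (1 + \<alpha>) \<le> (4::real)" "2 powr \<alpha> \<le> (2::real)"
      using powr_mono[of "1 + \<alpha>" 2 "2::real"] powr_mono[of \<alpha> 1 "2::real"] \<alpha> by auto
    have "norm (z - y) powr (1 + \<alpha>) \<le> (2 * s) powr (1 + \<alpha>)" using zy \<alpha> by (intro powr_mono2) auto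
    also have "\<dots> = 2 powr (1 + \<alpha>) * s powr (1 + \<alpha>)" using s by (simp add: powr_mult)
    also have "\<dots> \<le> 4 * s powr (1 + \<alpha>)" using p2 by (intro mult_right_mono) auto
    finally have 1: "C * norm (z - y) powr (1 + \<alpha>) \<le> C * (4 * s powr (1 + \<alpha>))"
      using C by (intro mult_left_mono)
    have "norm (z - y) powr \<alpha> \<le> (2 * s) powr \<alpha>" using zy \<alpha> by (intro powr_mono2) auto
    also have "\<dots> = 2 powr \<alpha> * s powr \<alpha>" using s by (simp add: powr_mult)
    also have "\<dots> \<le> 2 * s powr \<alpha>" using p2 by (intro mult_right_mono) auto
    finally have "norm (z - y) powr \<alpha> * norm (x - z) \<le> (2 * s powr \<alpha>) * s"
      using s by (intro mult_mono) auto
    then have "C * norm (z - y) powr \<alpha> * norm (x - z) \<le> C * (2 * (s powr \<alpha> * s))"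
      using C by (simp add: mult_left_mono mult.assoc)
    moreover have "\<bar>(L z - L y) (x - z)\<bar> \<le> C * norm (z - y) powr \<alpha> * norm (x - z)"
      using norm_blinfun[of "L z - L y" "x - z"] hold[OF yz] mult_right_mono[OF hold[OF yz], of "norm (x - z)"]
      by simp
    moreover have "s powr \<alpha> * s = s powr (1 + \<alpha>)" using s by (cases "s = 0") (auto simp: powr_add)
    ultimately have 2: "\<bar>(L z - L y) (x - z)\<bar> \<le> C * (2 * s powr (1 + \<alpha>))" by simp
    have "l z x - l y x = (f z - f y - L y (z - y)) + (L z - L y) (x - z)"
      by (simp add: l_def blinfun.diff_left blinfun.diff_right)
    then have "l z x - l y x \<le> M * s powr (1 + \<alpha>)"
      using jet[OF yz] 1 2 unfolding M_def by linarith
    also have "M * s powr (1 + \<alpha>) \<le> M * (w (x - y) + w (x - z))"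
      unfolding s_def w_def using M by (intro mult_left_mono) (auto simp: max_def)
    finally show ?thesis by (simp add: distrib_left)
  qed
  obtain y0 where y0: "y0 \<in> K" using ne by blast
  \<comment> \<open>Both conditions survive pointwise suprema, so the envelope inherits
    them.\<close>
  define Fam where "Fam = {h. (\<forall>y\<in>K. \<forall>x. h x \<le> l y x + M * w (x - y)) \<and>
      (\<forall>x u. 2 * h x \<le> h (x + u) + h (x - u) + 2 * (M * w u))}"
  have low: "(\<lambda>x. l z x - M * w (x - z)) \<in> Fam" if z: "z \<in> K" for z
    unfolding Fam_def
  proof (intro CollectI conjI ballI allI)
    fix x u
    have e: "x + u - z = x - z + u" "x - u - z = x - z - u" by (simp_all add: algebra_simps)
    show "2 * (l z x - M * w (x - z))
        \<le> l z (x + u) - M * w (x + u - z) + (l z (x - u) - M * w (x - u - z)) + 2 * (M * w u)"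
      unfolding e using lsd[of z x u] Mwsd[of "x - z" u] by (simp add: algebra_simps)
  qed (use cross z in blast)
  define F where "F x = (SUP h\<in>Fam. h x)" for x
  have Fam_ne: "Fam \<noteq> {}" using low[OF y0] by blast
  have bdd: "bdd_above ((\<lambda>h. h x) ` Fam)" for x
    using y0 by (intro bdd_aboveI[of _ "l y0 x + M * w (x - y0)"]) (auto simp: Fam_def)
  have F_ge: "h x \<le> F x" if "h \<in> Fam" for h x
    unfolding F_def by (rule cSUP_upper[OF that bdd])
  have F_leI: "F x \<le> b" if "\<And>h. h \<in> Fam \<Longrightarrow> h x \<le> b" for x b
    unfolding F_def by (rule cSUP_least[OF Fam_ne that])
  have F_le: "F x \<le> l y x + M * w (x - y)" if "y \<in> K" for x y
    by (rule F_leI) (use that in \<open>simp add: Fam_def\<close>)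
  have F_lower: "2 * F x \<le> F (x + u) + F (x - u) + 2 * (M * w u)" for x u
  proof -
    have "F x \<le> (F (x + u) + F (x - u) + 2 * (M * w u)) / 2"
    proof (rule F_leI)
      fix h assume h: "h \<in> Fam"
      then have "2 * h x \<le> h (x + u) + h (x - u) + 2 * (M * w u)" by (simp add: Fam_def)
      then show "h x \<le> (F (x + u) + F (x - u) + 2 * (M * w u)) / 2"
        using F_ge[OF h, of "x + u"] F_ge[OF h, of "x - u"] by simp
    qed
    then show ?thesis by simp
  qed
  have F_upper: "F (x + u) + F (x - u) \<le> 2 * F x + 2 * (M * w u)" for x u
  proof -
    define h where "h x = (F (x + u) + F (x - u)) / 2 - M * w u" for x
    have "h \<in> Fam"
      unfolding Fam_def
    proof (intro CollectI conjI ballI allI)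
      fix y x assume y: "y \<in> K"
      have e: "x + u - y = x - y + u" "x - u - y = x - y - u" by (simp_all add: algebra_simps)
      show "h x \<le> l y x + M * w (x - y)"
        using F_le[OF y, of "x + u"] F_le[OF y, of "x - u"] lsd[of y x u] Mwsd[of "x - y" u]
        unfolding h_def e by (simp add: field_simps)
    next
      fix x v
      have e: "x + v + u = x + u + v" "x - v + u = x + u - v" "x + v - u = x - u + v" "x - v - u = x - u - v"
        by (simp_all add: algebra_simps)
      show "2 * h x \<le> h (x + v) + h (x - v) + 2 * (M * w v)"
        using F_lower[of "x + u" v] F_lower[of "x - u" v] unfolding h_def e by (simp add: field_simps)
    qed
    from F_ge[OF this, of x] show ?thesis unfolding h_def by (simp add: field_simps)
  qed
  have eq: "F y = f y" if y: "y \<in> K" for y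
    using F_le[OF y, of y] F_ge[OF low[OF y], of y] \<alpha> by (simp add: l_def w_def blinfun.zero_right)
  have sd: "\<bar>F (x + u) + F (x - u) - 2 * F x\<bar> \<le> 2 * M * norm u powr (1 + \<alpha>)" for x u
    using F_lower[of x u] F_upper[of x u] unfolding w_def[symmetric] mult.assoc by linarith
  \<comment> \<open>One base point suffices: its two barriers enclose \<open>F\<close>
    everywhere.\<close>
  have bd: "\<exists>B. \<forall>x. norm x \<le> R \<longrightarrow> \<bar>F x\<bar> \<le> B" for R
  proof -
    define S where "S = R + norm y0"
    have "\<bar>F x\<bar> \<le> \<bar>f y0\<bar> + norm (L y0) * S + M * S powr (1 + \<alpha>)" if "norm x \<le> R" for x
    proof -
      have n: "norm (x - y0) \<le> S" using that norm_triangle_ineq4[of x y0] by (simp add: S_def)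
      have "\<bar>L y0 (x - y0)\<bar> \<le> norm (L y0) * S"
        using norm_blinfun[of "L y0" "x - y0"] mult_left_mono[OF n norm_ge_zero[of "L y0"]] by simp
      moreover have "M * w (x - y0) \<le> M * S powr (1 + \<alpha>)"
        unfolding w_def using M n \<alpha> by (intro mult_left_mono powr_mono2) auto
      ultimately show ?thesis
        using F_le[OF y0, of x] F_ge[OF low[OF y0], of x] unfolding l_def by linarith
    qed
    then have "\<forall>x. norm x \<le> R \<longrightarrow> \<bar>F x\<bar> \<le> \<bar>f y0\<bar> + norm (L y0) * S + M * S powr (1 + \<alpha>)" by simp
    then show ?thesis by (rule exI)
  qed
  from C1_alpha_of_second_difference[OF \<alpha> M sd bd] show ?thesis
  proof (elim exE conjE)
    fix D :: "'a \<Rightarrow> 'a \<Rightarrow>\<^sub>L real" and C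
    assume D: "\<forall>x. (F has_derivative blinfun_apply (D x)) (at x)" "0 \<le> C"
      "\<forall>x y. norm (D x - D y) \<le> C * norm (x - y) powr \<alpha>"
    show ?thesis
      by (rule exI[of _ F], rule exI[of _ D], intro conjI D(1) ballI eq exI[of _ C] D(2,3))
  qed
qed

text \<open>The scalar extension is applied to each component and the constants are added. The empty
  set is split off, since without barriers the envelope has no upper bound.\<close>

lemma Whitney_extension:
  fixes f :: "'a::euclidean_space \<Rightarrow> 'b::euclidean_space" and L :: "'a \<Rightarrow> 'a \<Rightarrow>\<^sub>L 'b"
  assumes \<alpha>: "0 < \<alpha>" "\<alpha> \<le> 1" and C: "0 \<le> C"
    and jet: "\<And>y z. y \<in> K \<Longrightarrow> z \<in> K \<Longrightarrow> norm (f z - f y - L y (z - y)) \<le> C * norm (z - y) powr (1 + \<alpha>)"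
    and hold: "\<And>y z. y \<in> K \<Longrightarrow> z \<in> K \<Longrightarrow> norm (L z - L y) \<le> C * norm (z - y) powr \<alpha>"
  obtains F and D :: "'a \<Rightarrow> 'a \<Rightarrow>\<^sub>L 'b" and C' where "\<And>y. y \<in> K \<Longrightarrow> F y = f y"
    "\<And>x. (F has_derivative blinfun_apply (D x)) (at x)"
    "\<And>x y. norm (D x - D y) \<le> C' * norm (x - y) powr \<alpha>"
proof (cases "K = {}")
  case True
  show ?thesis
    by (rule that[of "\<lambda>_. 0" "\<lambda>_. 0" 0]) (use True in \<open>simp_all add: zero_blinfun.rep_eq\<close>)
next
  case False
  define Lb where "Lb b y = blinfun_compose (blinfun_inner_left b) (L y)" for b y
  have Lb: "Lb b y v = L y v \<bullet> b" for b y v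
    by (simp add: Lb_def blinfun_inner_left.rep_eq)
  have "\<exists>F D. (\<forall>y\<in>K. F y = f y \<bullet> b) \<and> (\<forall>x. (F has_derivative blinfun_apply (D x)) (at x)) \<and>
    (\<exists>C\<ge>0. \<forall>x y. norm ((D :: 'a \<Rightarrow> 'a \<Rightarrow>\<^sub>L real) x - D y) \<le> C * norm (x - y) powr \<alpha>)"
    if b: "b \<in> Basis" for b
  proof (rule Whitney_extension_scalar[OF \<alpha> C False])
    fix y z assume yz: "y \<in> K" "z \<in> K"
    have "\<bar>(f z - f y - L y (z - y)) \<bullet> b\<bar> \<le> norm (f z - f y - L y (z - y))"
      by (rule Basis_le_norm[OF b])
    then show "\<bar>f z \<bullet> b - f y \<bullet> b - Lb b y (z - y)\<bar> \<le> C * norm (z - y) powr (1 + \<alpha>)"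
      using jet[OF yz] by (simp add: Lb inner_diff_left)
    have "norm (Lb b z - Lb b y) \<le> norm (L z - L y)"
    proof (rule norm_blinfun_bound)
      fix v
      have "\<bar>(L z - L y) v \<bullet> b\<bar> \<le> norm ((L z - L y) v)" by (rule Basis_le_norm[OF b])
      also have "\<dots> \<le> norm (L z - L y) * norm v" by (rule norm_blinfun)
      finally show "norm ((Lb b z - Lb b y) v) \<le> norm (L z - L y) * norm v"
        by (simp add: blinfun.diff_left Lb inner_diff_left)
    qed simp
    then show "norm (Lb b z - Lb b y) \<le> C * norm (z - y) powr \<alpha>" using hold[OF yz] by simp
  qed
  then obtain Fb Db Cb where F: "\<And>b y. b \<in> Basis \<Longrightarrow> y \<in> K \<Longrightarrow> Fb b y = f y \<bullet> b"
      "\<And>b x. b \<in> Basis \<Longrightarrow> (Fb b has_derivative blinfun_apply (Db b x)) (at x)"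
      "\<And>b x y. b \<in> Basis \<Longrightarrow> norm ((Db b :: 'a \<Rightarrow> 'a \<Rightarrow>\<^sub>L real) x - Db b y) \<le> Cb b * norm (x - y) powr \<alpha>"
      "\<And>b. b \<in> Basis \<Longrightarrow> 0 \<le> Cb b"
    by metis
  define D where "D x = (\<Sum>b\<in>Basis. blinfun_compose (blinfun_scaleR_left b) (Db b x))" for x
  have D: "D x v = (\<Sum>b\<in>Basis. Db b x v *\<^sub>R b)" for x v
    by (simp add: D_def blinfun.sum_left)
  show ?thesis
  proof (rule that[of "\<lambda>x. \<Sum>b\<in>Basis. Fb b x *\<^sub>R b" D "\<Sum>b\<in>Basis. Cb b"])
    show "(\<Sum>b\<in>Basis. Fb b y *\<^sub>R b) = f y" if "y \<in> K" for y
      using F(1) that by (simp add: euclidean_representation)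
    show "((\<lambda>x. \<Sum>b\<in>Basis. Fb b x *\<^sub>R b) has_derivative blinfun_apply (D x)) (at x)" for x
      unfolding D by (intro has_derivative_sum has_derivative_scaleR_left F(2))
    show "norm (D x - D y) \<le> (\<Sum>b\<in>Basis. Cb b) * norm (x - y) powr \<alpha>" for x y
    proof (rule norm_blinfun_bound)
      fix v
      have "norm ((D x - D y) v) = norm (\<Sum>b\<in>Basis. (Db b x - Db b y) v *\<^sub>R b)"
        by (simp add: blinfun.diff_left D sum_subtractf scaleR_diff_left)
      also have "\<dots> \<le> (\<Sum>b\<in>(Basis :: 'b set). Cb b * norm (x - y) powr \<alpha> * norm v)"
      proof (rule sum_norm_le)
        fix b :: 'b assume b: "b \<in> Basis"
        have "norm ((Db b x - Db b y) v) \<le> norm (Db b x - Db b y) * norm v" by (rule norm_blinfun)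
        also have "\<dots> \<le> Cb b * norm (x - y) powr \<alpha> * norm v"
          by (intro mult_right_mono F(3)[OF b]) simp
        finally show "norm ((Db b x - Db b y) v *\<^sub>R b) \<le> Cb b * norm (x - y) powr \<alpha> * norm v"
          using b by simp
      qed
      finally show "norm ((D x - D y) v) \<le> (\<Sum>b\<in>Basis. Cb b) * norm (x - y) powr \<alpha> * norm v"
        by (simp add: sum_distrib_right)
    qed (simp add: F(4) sum_nonneg)
  qed
qed

subsection \<open>Orthogonal projections\<close>

lemma orth_proj_add_scaleR:
  assumes V: "subspace V"
  shows "orth_proj V (x + y) = orth_proj V x + orth_proj V y"
    and "orth_proj V (c *\<^sub>R x) = c *\<^sub>R orth_proj V x"
proof -
  show "orth_proj V (x + y) = orth_proj V x + orth_proj V y"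
  proof (rule orth_proj_unique[OF V])
    show "orth_proj V x + orth_proj V y \<in> V" using V orth_proj(1)[OF V] by (simp add: subspace_add)
    have "(x - orth_proj V x) + (y - orth_proj V y) \<in> V\<^sup>\<bottom>"
      by (intro subspace_add[OF subspace_orthogonal_comp] orth_proj(2)[OF V])
    then show "x + y - (orth_proj V x + orth_proj V y) \<in> V\<^sup>\<bottom>" by (simp add: algebra_simps)
  qed
  show "orth_proj V (c *\<^sub>R x) = c *\<^sub>R orth_proj V x"
  proof (rule orth_proj_unique[OF V])
    show "c *\<^sub>R orth_proj V x \<in> V" using V orth_proj(1)[OF V] by (simp add: subspace_scale)
    have "c *\<^sub>R (x - orth_proj V x) \<in> V\<^sup>\<bottom>"
      by (intro subspace_scale[OF subspace_orthogonal_comp] orth_proj(2)[OF V])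
    then show "c *\<^sub>R x - c *\<^sub>R orth_proj V x \<in> V\<^sup>\<bottom>" by (simp add: scaleR_diff_right)
  qed
qed

lemma linear_orth_proj: "subspace V \<Longrightarrow> linear (orth_proj V)"
  by (intro linearI orth_proj_add_scaleR)

lemma orth_proj_diff: "subspace V \<Longrightarrow> orth_proj V (x - y) = orth_proj V x - orth_proj V y"
  by (rule linear_diff[OF linear_orth_proj])

lemma orth_proj_ident: "subspace V \<Longrightarrow> x \<in> V \<Longrightarrow> orth_proj V x = x"
  by (rule orth_proj_unique) (simp_all add: subspace_0[OF subspace_orthogonal_comp])

lemma orth_proj_orthogonal_comp:
  assumes V: "subspace V"
  shows "orth_proj (V\<^sup>\<bottom>) x = x - orth_proj V x"
  by (rule orth_proj_unique[OF subspace_orthogonal_comp])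
    (use orth_proj[OF V] orthogonal_comp_self[OF V] in simp_all)

lemma norm_orth_proj_le:
  assumes V: "subspace V"
  shows "norm (orth_proj V x) \<le> norm x" "norm (x - orth_proj V x) \<le> norm x"
proof -
  have "orthogonal (orth_proj V x) (x - orth_proj V x)"
    using orth_proj[OF V, of x] by (auto simp: orthogonal_comp_def orthogonal_commute)
  then have "(norm (orth_proj V x + (x - orth_proj V x)))\<^sup>2
      = (norm (orth_proj V x))\<^sup>2 + (norm (x - orth_proj V x))\<^sup>2"
    by (rule norm_add_Pythagorean)
  then have "(norm x)\<^sup>2 = (norm (orth_proj V x))\<^sup>2 + (norm (x - orth_proj V x))\<^sup>2" by simp
  then show "norm (orth_proj V x) \<le> norm x" "norm (x - orth_proj V x) \<le> norm x"
    by (auto intro: power2_le_imp_le)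
qed

subsection \<open>Sets satisfying an approximate cone condition\<close>

text \<open>The classical two-point argument: if \<open>y\<close> is a nearly farthest point seen from \<open>x\<close> at a steep
  angle, then no point over a small disc around the projection of \<open>x\<close> can be seen at a flat angle both
  from \<open>x\<close> and from \<open>y\<close>. Hence steep points sit in tubes carrying little measure.\<close>

lemma steep_points_null:
  fixes A :: "'a::euclidean_space set"
  assumes k: "0 < k" and V: "linear_plane k V" and fin: "hausdorff k A < top"
    and r0: "0 < r0" and \<epsilon>: "0 < \<epsilon>" "2 * \<epsilon> * 44 ^ k < 1"
    and cone: "\<And>x r. x \<in> A \<Longrightarrow> 0 < r \<Longrightarrow> r < r0 \<Longrightarrow>
      hausdorff k {z \<in> A. dist x z \<le> r \<and> norm (orth_proj V (z - x)) < 9/10 * norm (z - x)} \<le> ennreal (\<epsilon> * r ^ k)"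
  shows "hausdorff k {x \<in> A. \<forall>\<delta>>0. \<exists>y\<in>A. dist x y < \<delta> \<and> norm (orth_proj V (y - x)) < norm (y - x) / 4} = 0"
    (is "hausdorff k ?N = 0")
proof -
  let ?P = "orth_proj V"
  have subV: "subspace V" using V by (simp add: linear_plane_def)
  obtain \<nu> :: "'a measure" where \<nu>: "sets \<nu> = sets borel"
      "\<And>w s. w \<in> V \<Longrightarrow> 0 < s \<Longrightarrow> emeasure \<nu> (cball w s) = ennreal (s ^ k)"
    using plane_measure[OF V] by metis
  show ?thesis
  proof (rule hausdorff_eq_0_of_small_density[OF k])
    have "hausdorff k ?N \<le> hausdorff k A" by (rule hausdorff_mono) blast
    then show "hausdorff k ?N < top" using fin by (rule le_less_trans)
    \<comment> \<open>The cone condition will be applied with radii up to twice the height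
      \<open>h\<close>, hence up to 4 * r.\<close>
    show "0 < r0 / 4" "0 < 2 * \<epsilon> * 44 ^ k" "2 * \<epsilon> * 44 ^ k < 1" using r0 \<epsilon> by simp_all
    fix a r assume a: "a \<in> ?N" and r: "0 < r" "r < r0 / 4"
    define N' where "N' = ?N \<inter> cball a r"
    \<comment> \<open>The radius 2 * r is large enough to contain all of \<open>N'\<close> as seen
      from any of its points; \<open>h x\<close> is the greatest distance at which a steep point is
      seen from \<open>x\<close>.\<close>
    define Y where "Y x = {y \<in> A. dist x y \<le> 2 * r \<and> norm (?P (y - x)) < norm (y - x) / 4}" for x
    define h where "h x = (SUP y\<in>Y x. norm (y - x))" for x
    have bddY: "bdd_above ((\<lambda>y. norm (y - x)) ` Y x)" for x
      by (rule bdd_aboveI[of _ "2 * r"]) (auto simp: Y_def dist_norm norm_minus_commute)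
    have Yne: "Y x \<noteq> {}" if "x \<in> N'" for x
    proof -
      have "0 < 2 * r" using r by simp
      then obtain y where "y \<in> A" "dist x y < 2 * r" "norm (?P (y - x)) < norm (y - x) / 4"
        using \<open>x \<in> N'\<close> unfolding N'_def by blast
      then have "y \<in> Y x" by (simp add: Y_def)
      then show ?thesis by blast
    qed
    have le_h: "norm (y - x) \<le> h x" if "y \<in> Y x" for x y
      unfolding h_def by (rule cSUP_upper[OF that bddY])
    have h0: "0 < h x" if x: "x \<in> N'" for x
    proof -
      obtain y where y: "y \<in> Y x" using Yne[OF x] by blast
      then have "norm (?P (y - x)) < norm (y - x) / 4" by (simp add: Y_def)
      then have "0 < norm (y - x)" using norm_ge_zero[of "?P (y - x)"] by linarith
      with le_h[OF y] show ?thesis by linarith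
    qed
    have h_le: "h x \<le> 2 * r" if x: "x \<in> N'" for x
      unfolding h_def by (rule cSUP_least[OF Yne[OF x]]) (simp add: Y_def dist_norm norm_minus_commute)
    define cyl where "cyl x = {z \<in> N'. norm (?P z - ?P x) \<le> h x / 4}" for x
    have tube: "hausdorff k (cyl x) \<le> ennreal (2 * \<epsilon> * 40 ^ k) * ennreal ((h x / 20) ^ k)" if x: "x \<in> N'" for x
    proof -
      have "9/10 * h x < h x" using h0[OF x] by simp
      then obtain y where y: "y \<in> Y x" "9/10 * h x < norm (y - x)"
        unfolding h_def using less_cSUP_iff[OF Yne[OF x] bddY] by blast
      have xA: "x \<in> A" "dist a x \<le> r" and yA: "y \<in> A" using x y by (auto simp: N'_def Y_def)
      have yh: "norm (y - x) \<le> h x" "norm (?P (y - x)) < norm (y - x) / 4"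
        using le_h[OF y(1)] y(1) by (auto simp: Y_def)
      let ?bad = "\<lambda>x r. {z \<in> A. dist x z \<le> r \<and> norm (?P (z - x)) < 9/10 * norm (z - x)}"
      have "cyl x \<subseteq> ?bad x (h x) \<union> ?bad y (2 * h x)"
      proof
        fix z assume z: "z \<in> cyl x"
        then have zA: "z \<in> A" "dist a z \<le> r" and zP: "norm (?P (z - x)) \<le> h x / 4"
          by (auto simp: cyl_def N'_def orth_proj_diff[OF subV])
        have xz: "dist x z \<le> 2 * r" using dist_triangle2[of x z a] xA zA by (simp add: dist_commute)
        \<comment> \<open>A point of the tube farther away than \<open>h x\<close> would itself be
          steep, against the choice of \<open>h x\<close>.\<close>
        have zx: "norm (z - x) \<le> h x"
        proof (rule ccontr)
          assume "\<not> norm (z - x) \<le> h x"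
          then have "norm (?P (z - x)) < norm (z - x) / 4" using zP by simp
          then have "z \<in> Y x" using zA xz by (simp add: Y_def)
          from le_h[OF this] show False using \<open>\<not> norm (z - x) \<le> h x\<close> by simp
        qed
        have zy: "norm (z - y) \<le> 2 * h x"
          using norm_triangle_ineq4[of "z - x" "y - x"] zx yh(1) by simp
        \<comment> \<open>If both views were flat, the distances from \<open>z\<close> to
          \<open>x\<close> and \<open>y\<close> would be at most 10/9 of h/4 and of h/4 + h/4. Their
          sum 5/6 * h is less than 9/10 * h, the lower bound for the distance of \<open>x\<close>
          and \<open>y\<close>.\<close>
        have "norm (?P (z - x)) < 9/10 * norm (z - x) \<or> norm (?P (z - y)) < 9/10 * norm (z - y)"
        proof (rule ccontr)
          assume "\<not> ?thesis"
          then have 1: "9/10 * norm (z - x) \<le> norm (?P (z - x))" "9/10 * norm (z - y) \<le> norm (?P (z - y))"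
            by simp_all
          have "?P (z - y) = ?P (z - x) - ?P (y - x)" by (simp add: orth_proj_diff[OF subV])
          then have "norm (?P (z - y)) \<le> norm (?P (z - x)) + norm (?P (y - x))"
            by (simp add: norm_triangle_ineq4)
          moreover have "norm (y - x) \<le> norm (z - x) + norm (z - y)"
            using norm_triangle_ineq4[of "z - x" "z - y"] by simp
          ultimately show False using 1 zP yh y(2) h0[OF x] by linarith
        qed
        then show "z \<in> ?bad x (h x) \<union> ?bad y (2 * h x)"
          using zA zx zy by (auto simp: dist_norm norm_minus_commute)
      qed
      then have "hausdorff k (cyl x) \<le> hausdorff k (?bad x (h x) \<union> ?bad y (2 * h x))" by (rule hausdorff_mono)
      also have "\<dots> \<le> hausdorff k (?bad x (h x)) + hausdorff k (?bad y (2 * h x))" by (rule hausdorff_Un_le[OF k])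
      also have "\<dots> \<le> ennreal (\<epsilon> * h x ^ k) + ennreal (\<epsilon> * (2 * h x) ^ k)"
        using h0[OF x] h_le[OF x] r xA yA by (intro add_mono cone) simp_all
      also have "\<dots> = ennreal (\<epsilon> * h x ^ k + \<epsilon> * (2 * h x) ^ k)"
        using \<epsilon> h0[OF x] by (intro ennreal_plus[symmetric]) simp_all
      also have "\<dots> \<le> ennreal (2 * \<epsilon> * (2 * h x) ^ k)"
      proof (rule ennreal_leI)
        have "h x ^ k \<le> (2 * h x) ^ k" using h0[OF x] by (intro power_mono) simp_all
        then have "\<epsilon> * h x ^ k \<le> \<epsilon> * (2 * h x) ^ k" using \<epsilon> by (intro mult_left_mono) simp_all
        then show "\<epsilon> * h x ^ k + \<epsilon> * (2 * h x) ^ k \<le> 2 * \<epsilon> * (2 * h x) ^ k" by linarith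
      qed
      \<comment> \<open>The packed discs have radius h/20, so that their five-fold dilations have
        exactly the tube radius h/4; the ratio of 2 * h to h/20 is 40.\<close>
      also have "2 * \<epsilon> * (2 * h x) ^ k = (2 * \<epsilon> * 40 ^ k) * (h x / 20) ^ k"
      proof -
        have "40 ^ k * (h x / 20) ^ k = (2 * h x) ^ k" by (subst power_mult_distrib[symmetric]) simp
        then show ?thesis by (simp only: mult.assoc)
      qed
      also have "ennreal \<dots> = ennreal (2 * \<epsilon> * 40 ^ k) * ennreal ((h x / 20) ^ k)"
        using \<epsilon> h0[OF x] by (intro ennreal_mult) simp_all
      finally show ?thesis .
    qed
    have cov: "?P ` N' \<subseteq> (\<Union>x\<in>N'. cball (?P x) (h x / 20))"
    proof (rule image_subsetI)
      fix x assume x: "x \<in> N'"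
      then have "?P x \<in> cball (?P x) (h x / 20)" using h0[OF x] by simp
      then show "?P x \<in> (\<Union>x\<in>N'. cball (?P x) (h x / 20))" using x by blast
    qed
    have rb: "\<And>x. x \<in> N' \<Longrightarrow> 0 < h x / 20 \<and> h x / 20 \<le> r / 10" 
    proof
      fix x assume x: "x \<in> N'"
      show "0 < h x / 20" using h0[OF x] by simp
      show "h x / 20 \<le> r / 10" using h_le[OF x] by simp
    qed
    obtain C where C: "countable C" "C \<subseteq> N'"
        "pairwise (\<lambda>i j. disjnt (cball (?P i) (h i / 20)) (cball (?P j) (h j / 20))) C"
        "?P ` N' \<subseteq> (\<Union>i\<in>C. cball (?P i) (5 * (h i / 20)))"
      by (rule Vitali_covering_lemma_cballs[OF cov rb])
    obtain J :: "nat set" and e where e: "bij_betw e J C" using countable_enum[OF C(1)] .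
    have eC: "e n \<in> N'" if "n \<in> J" for n using e C(2) that by (auto simp: bij_betw_def)
    define T where "T n = (if n \<in> J then cyl (e n) else {})" for n
    have "N' \<subseteq> (\<Union>n. T n)"
    proof
      fix z assume z: "z \<in> N'"
      then obtain i where i: "i \<in> C" "?P z \<in> cball (?P i) (5 * (h i / 20))" using C(4) by blast
      then obtain n where n: "n \<in> J" "e n = i" using e by (auto simp: bij_betw_def)
      have "z \<in> T n" using n i z by (simp add: T_def cyl_def dist_norm norm_minus_commute)
      then show "z \<in> (\<Union>n. T n)" by blast
    qed
    then have "hausdorff k N' \<le> hausdorff k (\<Union>n. T n)" by (rule hausdorff_mono)
    also have "\<dots> \<le> (\<Sum>n. hausdorff k (T n))" by (rule hausdorff_UN_le)
    also have "\<dots> \<le> (\<Sum>n. ennreal (2 * \<epsilon> * 40 ^ k) * (if n \<in> J then ennreal ((h (e n) / 20) ^ k) else 0))"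
      by (rule suminf_le) (simp_all add: T_def tube eC hausdorff_empty[OF k])
    also have "\<dots> = ennreal (2 * \<epsilon> * 40 ^ k) * (\<Sum>n. if n \<in> J then ennreal ((h (e n) / 20) ^ k) else 0)"
      by simp
    \<comment> \<open>The centres project into the disc of radius \<open>r\<close>, and the discs
      themselves have radius at most r/10.\<close>
    also have "\<dots> \<le> ennreal (2 * \<epsilon> * 40 ^ k) * emeasure \<nu> (cball (?P a) (11/10 * r))"
    proof (intro mult_left_mono disjoint_sum_le_emeasure[OF e C(3)])
      fix i assume "i \<in> C"
      then have i: "i \<in> N'" using C(2) by blast
      show "ennreal ((h i / 20) ^ k) \<le> emeasure \<nu> (cball (?P i) (h i / 20))"
        using \<nu>(2)[OF orth_proj(1)[OF subV], of "h i / 20" i] h0[OF i] by simp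
      show "cball (?P i) (h i / 20) \<subseteq> cball (?P a) (11/10 * r)"
      proof
        fix w assume w: "w \<in> cball (?P i) (h i / 20)"
        have "dist (?P a) (?P i) \<le> dist a i"
          using norm_orth_proj_le(1)[OF subV, of "a - i"] by (simp add: dist_norm orth_proj_diff[OF subV])
        then show "w \<in> cball (?P a) (11/10 * r)"
          using w h_le[OF i] i dist_triangle[of "?P a" w "?P i"] by (simp add: N'_def)
      qed
    qed (simp_all add: \<nu>(1))
    also have "\<dots> = ennreal (2 * \<epsilon> * 40 ^ k) * ennreal ((11/10 * r) ^ k)"
      using \<nu>(2)[OF orth_proj(1)[OF subV], of "11/10 * r" a] r by simp
    also have "\<dots> = ennreal (2 * \<epsilon> * 40 ^ k * (11/10 * r) ^ k)"
      using \<epsilon> r by (intro ennreal_mult[symmetric]) simp_all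
    also have "2 * \<epsilon> * 40 ^ k * (11/10 * r) ^ k = 2 * \<epsilon> * 44 ^ k * r ^ k"
    proof -
      have "40 ^ k * (11/10 * r) ^ k = 44 ^ k * r ^ k"
        by (subst (1 2) power_mult_distrib[symmetric]) simp
      then show ?thesis by (simp only: mult.assoc)
    qed
    finally show "hausdorff k (?N \<inter> cball a r) \<le> ennreal (2 * \<epsilon> * 44 ^ k * r ^ k)" unfolding N'_def .
  qed
qed

subsection \<open>Covering a Lipschitz piece by graphs\<close>

text \<open>The set \<open>K\<close> need not be measurable, so its density is expressed through a measurable envelope.\<close>

lemma density_points_exhaust:
  fixes K :: "'a::euclidean_space set"
  assumes k: "0 < k" and bd: "bounded K" and sets: "sets \<nu> = sets borel"
    and fin: "\<And>R. emeasure \<nu> (cball 0 R) < \<infinity>"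
    and env: "measurable_envelope \<nu> K U"
  shows "hausdorff k {v \<in> K. \<forall>\<delta>>0. \<exists>d e. 0 < d \<and> d < \<delta> \<and> norm e \<le> 1 \<and>
    ennreal ((d / 4) ^ k / 2) \<le> emeasure \<nu> (cball (v + d *\<^sub>R e) (d / 4) - U)} = 0"
    (is "hausdorff k ?S = 0")
proof -
  obtain R where R: "\<And>v. v \<in> K \<Longrightarrow> norm v \<le> R" using bd unfolding bounded_iff by blast
  have KU: "K \<subseteq> U" and U: "U \<in> sets borel" using measurable_envelopeD[OF env] sets by auto
  \<comment> \<open>Restricted to the complement of \<open>U\<close>, the measure gives
    \<open>U\<close> mass 0, while at every exceptional point small balls keep a fixed share of
    mass. This plays the role of the density theorem.\<close>
  define M where "M = density \<nu> (indicator (cball 0 (R + 2) - U))"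
  have Um: "U \<in> sets \<nu>" "cball 0 (R + 2) - U \<in> sets \<nu>" using U sets by auto
  have M: "emeasure M B = emeasure \<nu> ((cball 0 (R + 2) - U) \<inter> B)" if "B \<in> sets borel" for B
    unfolding M_def using that Um(2) sets by (intro emeasure_restricted) simp_all
  have spaceM: "space M = UNIV" unfolding M_def using sets_eq_imp_space_eq[OF sets] by simp
  show ?thesis
  proof (rule hausdorff_eq_0_of_dominating_measure[OF k, of M U])
    show "sets M = sets borel" by (simp add: M_def sets)
    have "emeasure M (space M) = emeasure \<nu> (cball 0 (R + 2) - U)"
      unfolding spaceM by (subst M) simp_all
    also have "\<dots> \<le> emeasure \<nu> (cball 0 (R + 2))"
      using sets by (intro emeasure_mono) auto
    finally have "emeasure M (space M) \<le> emeasure \<nu> (cball 0 (R + 2))" .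
    then show "emeasure M (space M) \<noteq> \<infinity>" using fin[of "R + 2"] by auto
    show "U \<in> sets borel" by (rule U)
    have "(cball 0 (R + 2) - U) \<inter> U = {}" by blast
    then show "emeasure M U = 0" by (simp only: M[OF U] emeasure_empty)
    show "?S \<subseteq> U" using KU by blast
    \<comment> \<open>Half of a disc of radius d/4 is compared with a ball of radius 2 * d, eight
      times as large.\<close>
    show "0 < 1 / (2 * 8 ^ k :: real)" by simp
    fix v \<delta> assume v: "v \<in> ?S" and \<delta>: "(0::real) < \<delta>"
    then have "0 < min (\<delta> / 2) 1" by simp
    then obtain d e where de: "0 < d" "d < min (\<delta> / 2) 1" "norm e \<le> 1"
        "ennreal ((d / 4) ^ k / 2) \<le> emeasure \<nu> (cball (v + d *\<^sub>R e) (d / 4) - U)"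
      using v by blast
    \<comment> \<open>The disc reaches at most d + d/4 from \<open>v\<close>, and d < 1 keeps it
      inside the ball of radius R + 2.\<close>
    have sub: "cball (v + d *\<^sub>R e) (d / 4) - U \<subseteq> (cball 0 (R + 2) - U) \<inter> cball v (2 * d)"
    proof
      fix z assume z: "z \<in> cball (v + d *\<^sub>R e) (d / 4) - U"
      have "norm (d *\<^sub>R e) \<le> d" using de mult_left_mono[of "norm e" 1 d] by simp
      moreover have "norm (z - v - d *\<^sub>R e) \<le> d / 4"
        using z by (simp add: dist_norm norm_minus_commute diff_diff_eq)
      ultimately have zv: "norm (z - v) \<le> 2 * d"
        using norm_triangle_ineq[of "z - v - d *\<^sub>R e" "d *\<^sub>R e"] de(1)
        unfolding diff_add_cancel by linarith
      moreover have "norm z \<le> R + 2"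
        using norm_triangle_ineq[of "z - v" v] zv R[of v] v de(2) by simp
      ultimately show "z \<in> (cball 0 (R + 2) - U) \<inter> cball v (2 * d)"
        using z by (simp add: dist_norm norm_minus_commute)
    qed
    have "1 / (2 * 8 ^ k) * (2 * d) ^ k = (d / 4) ^ k / 2"
    proof -
      have "8 ^ k * (d / 4) ^ k = (2 * d) ^ k" by (subst power_mult_distrib[symmetric]) simp
      then have "1 / (2 * 8 ^ k) * (2 * d) ^ k = 1 / (2 * 8 ^ k) * (8 ^ k * (d / 4) ^ k)" by (simp only:)
      also have "\<dots> = (d / 4) ^ k / 2" by (simp del: power_divide)
      finally show ?thesis .
    qed
    then have "ennreal (1 / (2 * 8 ^ k) * (2 * d) ^ k) \<le> emeasure \<nu> (cball (v + d *\<^sub>R e) (d / 4) - U)"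
      using de(4) by (simp only:)
    also have "\<dots> \<le> emeasure \<nu> ((cball 0 (R + 2) - U) \<inter> cball v (2 * d))"
      using Um sets by (intro emeasure_mono[OF sub]) auto
    also have "\<dots> = emeasure M (cball v (2 * d))" by (rule M[symmetric]) simp
    finally show "\<exists>r. 0 < r \<and> r < \<delta> \<and> ennreal (1 / (2 * 8 ^ k) * r ^ k) \<le> emeasure M (cball v r)"
      using de by (intro exI[of _ "2 * d"]) simp
  qed
qed

text \<open>The inverse of the projection, with the maps \<open>L\<close> as derivatives, is a
  Whitney jet on the projection of \<open>T\<close>. Its extension takes values in the whole space;
  the component orthogonal to \<open>V\<close> gives the graph map, and at projections of points of
  \<open>T\<close> the other component is already correct.\<close>

lemma C1_alpha_graph_of_jets:
  fixes T :: "'a::euclidean_space set" and L :: "'a \<Rightarrow> 'a \<Rightarrow>\<^sub>L 'a"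
  assumes V: "linear_plane k V" and \<alpha>: "0 < \<alpha>" "\<alpha> \<le> 1" and C: "0 \<le> C"
    and inj: "inj_on (orth_proj V) T"
    and jet: "\<And>x y. x \<in> T \<Longrightarrow> y \<in> T \<Longrightarrow> norm (y - x - L x (orth_proj V (y - x)))
      \<le> C * norm (orth_proj V (y - x)) powr (1 + \<alpha>)"
    and hold: "\<And>x y h. x \<in> T \<Longrightarrow> y \<in> T \<Longrightarrow> norm ((L y - L x) (orth_proj V h))
      \<le> C * norm (orth_proj V (y - x)) powr \<alpha> * norm h"
  shows "\<exists>\<Gamma>. C1_alpha_graph k \<alpha> \<Gamma> \<and> T \<subseteq> \<Gamma>"
proof -
  let ?P = "orth_proj V"
  have subV: "subspace V" using V by (simp add: linear_plane_def)
  have Pbl: "bounded_linear ?P" using linear_orth_proj[OF subV] by (simp add: linear_conv_bounded_linear)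
  define g where "g = inv_into T ?P"
  have gT: "g (?P x) = x" if "x \<in> T" for x unfolding g_def using inj that by (rule inv_into_f_f)
  \<comment> \<open>The maps are controlled only on \<open>V\<close>; composing with the projection
    gives an operator norm bound on the whole space.\<close>
  define L' where "L' v = blinfun_compose (L (g v)) (Blinfun ?P)" for v
  have L': "L' v h = L (g v) (?P h)" for v h
    by (simp add: L'_def bounded_linear_Blinfun_apply[OF Pbl])
  have jets: "norm (g w - g v - L' v (w - v)) \<le> C * norm (w - v) powr (1 + \<alpha>)"
      "norm (L' w - L' v) \<le> C * norm (w - v) powr \<alpha>"
    if vw: "v \<in> ?P ` T" "w \<in> ?P ` T" for v w
  proof -
    obtain x y where xy: "x \<in> T" "y \<in> T" "v = ?P x" "w = ?P y" using vw by blast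
    have e: "w - v = ?P (y - x)" by (simp add: xy orth_proj_diff[OF subV])
    have g: "g v = x" "g w = y" using xy gT by simp_all
    have PP: "?P (?P (y - x)) = ?P (y - x)" by (rule orth_proj_ident[OF subV orth_proj(1)[OF subV]])
    show "norm (g w - g v - L' v (w - v)) \<le> C * norm (w - v) powr (1 + \<alpha>)"
      unfolding L' g e PP by (rule jet[OF xy(1,2)])
    show "norm (L' w - L' v) \<le> C * norm (w - v) powr \<alpha>"
    proof (rule norm_blinfun_bound)
      fix h show "norm ((L' w - L' v) h) \<le> C * norm (w - v) powr \<alpha> * norm h"
        using hold[OF xy(1,2), of h] by (simp add: blinfun.diff_left L' g e)
    qed (rule mult_nonneg_nonneg[OF C powr_ge_zero])
  qed
  define Q where "Q x = x - ?P x" for x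
  have Qbl: "bounded_linear Q" unfolding Q_def by (intro bounded_linear_sub bounded_linear_ident Pbl)
  have QV: "Q x \<in> V\<^sup>\<bottom>" for x unfolding Q_def by (rule orth_proj(2)[OF subV])
  show ?thesis
  proof (rule Whitney_extension[OF \<alpha> C jets])
    fix F and D :: "'a \<Rightarrow> 'a \<Rightarrow>\<^sub>L 'a" and C'
    assume F: "\<And>v. v \<in> ?P ` T \<Longrightarrow> F v = g v"
      "\<And>v. (F has_derivative blinfun_apply (D v)) (at v)"
      "\<And>v w. norm (D v - D w) \<le> C' * norm (v - w) powr \<alpha>"
    define D' where "D' v = blinfun_compose (Blinfun Q) (D v)" for v
    have D'app: "D' v h = Q (D v h)" for v h by (simp add: D'_def bounded_linear_Blinfun_apply[OF Qbl])
    have D'hold: "norm (D' v - D' w) \<le> C' * norm (v - w) powr \<alpha>" for v w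
    proof -
      have "norm (D' v - D' w) \<le> norm (D v - D w)"
      proof (rule norm_blinfun_bound)
        fix h
        have "(D' v - D' w) h = Q ((D v - D w) h)"
          by (simp add: blinfun.diff_left D'app bounded_linear.linear[OF Qbl] linear_diff)
        then have "norm ((D' v - D' w) h) \<le> norm ((D v - D w) h)"
          using norm_orth_proj_le(2)[OF subV] by (simp add: Q_def)
        also have "\<dots> \<le> norm (D v - D w) * norm h" by (rule norm_blinfun)
        finally show "norm ((D' v - D' w) h) \<le> norm (D v - D w) * norm h" .
      qed simp
      from this F(3)[of v w] show ?thesis by (rule order_trans)
    qed
    have cont: "continuous_on V D'"
      unfolding continuous_on_def
    proof
      fix v
      have "((\<lambda>w. C' * norm (w - v) powr \<alpha>) \<longlongrightarrow> C' * norm (v - v) powr \<alpha>) (at v within V)"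
        using \<alpha> by (intro tendsto_intros tendsto_powr') auto
      then have "((\<lambda>w. C' * norm (w - v) powr \<alpha>) \<longlongrightarrow> 0) (at v within V)" by simp
      then have "((\<lambda>w. D' w - D' v) \<longlongrightarrow> 0) (at v within V)"
        by (rule Lim_null_comparison[rotated]) (intro always_eventually allI D'hold)
      then show "(D' \<longlongrightarrow> D' v) (at v within V)" by (rule Lim_null[THEN iffD2])
    qed
    define \<Gamma> where "\<Gamma> = {v + Q (F v) |v. v \<in> V}"
    have "C1_alpha_on \<alpha> V (\<lambda>v. Q (F v))"
      unfolding C1_alpha_on_def
    proof (intro exI[of _ D'] conjI ballI exI[of _ C'])
      fix v
      have "((\<lambda>v. Q (F v)) has_derivative (\<lambda>h. Q (D v h))) (at v)"
        by (rule bounded_linear.has_derivative[OF Qbl F(2)])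
      then show "((\<lambda>v. Q (F v)) has_derivative blinfun_apply (D' v)) (at v within V)"
        unfolding D'app by (rule has_derivative_at_withinI)
    qed (rule cont, rule D'hold)
    then have "C1_alpha_graph k \<alpha> \<Gamma>"
      unfolding C1_alpha_graph_def \<Gamma>_def using V QV
      by (intro exI[of _ V] exI[of _ "\<lambda>v. Q (F v)"]) simp
    moreover have "T \<subseteq> \<Gamma>"
    proof
      fix x assume x: "x \<in> T"
      have "x = ?P x + Q (F (?P x))" using x gT F(1) by (simp add: Q_def)
      then show "x \<in> \<Gamma>" unfolding \<Gamma>_def using orth_proj(1)[OF subV, of x] by blast
    qed
    ultimately show ?thesis by blast
  qed
qed

text \<open>Two points of the piece are compared through third points seen well from both: by density these
  occur over every disc of radius \<open>d / 4\<close> near the projections, and testing with discs centred at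
  \<open>v\<^sub>1 \<plusminus> d *\<^sub>R e\<close> controls the difference of the two approximate tangent maps.\<close>

lemma jet_comparison:
  fixes A :: "'a::euclidean_space set" and L :: "'a \<Rightarrow> 'a \<Rightarrow>\<^sub>L 'a"
  assumes subV: "subspace V" and \<alpha>: "0 < \<alpha>" "\<alpha> \<le> 1" and C: "0 \<le> C"
    and d: "d = norm (orth_proj V (x\<^sub>1 - x\<^sub>0))" "0 < d"
    and good: "\<And>e. e \<in> V \<Longrightarrow> norm e \<le> 1 \<Longrightarrow> \<exists>z. norm (orth_proj V (z - x\<^sub>1) - d *\<^sub>R e) \<le> d / 4 \<and>
      norm (z - x\<^sub>0 - L x\<^sub>0 (orth_proj V (z - x\<^sub>0))) \<le> C * norm (orth_proj V (z - x\<^sub>0)) powr (1 + \<alpha>) \<and>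
      norm (z - x\<^sub>1 - L x\<^sub>1 (orth_proj V (z - x\<^sub>1))) \<le> C * norm (orth_proj V (z - x\<^sub>1)) powr (1 + \<alpha>)"
  shows "norm (x\<^sub>1 - x\<^sub>0 - L x\<^sub>0 (orth_proj V (x\<^sub>1 - x\<^sub>0))) \<le> 16 * C * d powr (1 + \<alpha>)"
    and "norm ((L x\<^sub>1 - L x\<^sub>0) (orth_proj V h)) \<le> 16 * C * d powr \<alpha> * norm h"
proof -
  let ?P = "orth_proj V"
  have Pbl: "bounded_linear ?P" using linear_orth_proj[OF subV] by (simp add: linear_conv_bounded_linear)
  have PV: "?P x \<in> V" for x by (rule orth_proj(1)[OF subV])
  define X where "X = d powr \<alpha>"
  have X0: "0 \<le> X" by (simp add: X_def)
  have dX: "d powr (1 + \<alpha>) = d * X" using d(2) by (simp add: X_def powr_add)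
  \<comment> \<open>Composition with the projection makes the operator norm measure the difference
    on \<open>V\<close> only.\<close>
  define \<Delta> where "\<Delta> = blinfun_compose (L x\<^sub>1 - L x\<^sub>0) (Blinfun ?P)"
  have \<Delta>: "\<Delta> h = (L x\<^sub>1 - L x\<^sub>0) (?P h)" for h
    by (simp add: \<Delta>_def bounded_linear_Blinfun_apply[OF Pbl])
  define q where "q = x\<^sub>1 - x\<^sub>0 - L x\<^sub>0 (?P (x\<^sub>1 - x\<^sub>0))"
  have test: "\<exists>u. norm (u - d *\<^sub>R e) \<le> d / 4 \<and> u \<in> V \<and> norm (q + \<Delta> u) \<le> 12 * C * (d * X)"
    if e: "e \<in> V" "norm e \<le> 1" for e
  proof -
    obtain z where z: "norm (?P (z - x\<^sub>1) - d *\<^sub>R e) \<le> d / 4"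
        "norm (z - x\<^sub>0 - L x\<^sub>0 (?P (z - x\<^sub>0))) \<le> C * norm (?P (z - x\<^sub>0)) powr (1 + \<alpha>)"
        "norm (z - x\<^sub>1 - L x\<^sub>1 (?P (z - x\<^sub>1))) \<le> C * norm (?P (z - x\<^sub>1)) powr (1 + \<alpha>)"
      using good[OF e] by blast
    have de: "norm (d *\<^sub>R e) \<le> d" using e d(2) mult_left_mono[of "norm e" 1 d] by simp
    have n1: "norm (?P (z - x\<^sub>1)) \<le> 9/4 * d"
      using norm_triangle_ineq[of "?P (z - x\<^sub>1) - d *\<^sub>R e" "d *\<^sub>R e"] z(1) de d(2)
      unfolding diff_add_cancel by linarith
    have split: "?P (z - x\<^sub>0) = ?P (z - x\<^sub>1) + ?P (x\<^sub>1 - x\<^sub>0)" by (simp add: orth_proj_diff[OF subV])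
    have n0: "norm (?P (z - x\<^sub>0)) \<le> 9/4 * d"
      using norm_triangle_ineq[of "?P (z - x\<^sub>1)" "?P (x\<^sub>1 - x\<^sub>0)"] d(1) de z(1)
        norm_triangle_ineq[of "?P (z - x\<^sub>1) - d *\<^sub>R e" "d *\<^sub>R e"]
      unfolding split diff_add_cancel by linarith
    \<comment> \<open>Third points are seen at projected distance at most 9/4 * d from either base
      point, and (9/4)^2 < 6; the two errors then add up to 12.\<close>
    have pw: "C * n powr (1 + \<alpha>) \<le> 6 * C * (d * X)" if "0 \<le> n" "n \<le> 9/4 * d" for n
    proof -
      have "n powr (1 + \<alpha>) \<le> (9/4 * d) powr (1 + \<alpha>)" using that \<alpha> by (intro powr_mono2) auto
      also have "\<dots> = (9/4) powr (1 + \<alpha>) * (d * X)" unfolding dX[symmetric] by (rule powr_mult)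
      also have "\<dots> \<le> 6 * (d * X)"
      proof (rule mult_right_mono)
        have "(9/4 :: real) powr (1 + \<alpha>) \<le> (9/4) powr 2" using \<alpha> by (intro powr_mono) auto
        also have "\<dots> \<le> 6" by (simp add: power2_eq_square)
        finally show "(9/4 :: real) powr (1 + \<alpha>) \<le> 6" .
      qed (use d(2) X0 in simp)
      finally show ?thesis using mult_left_mono[OF _ C] by (metis mult.left_commute mult.assoc)
    qed
    define a where "a = z - x\<^sub>0 - L x\<^sub>0 (?P (z - x\<^sub>0))"
    define b where "b = z - x\<^sub>1 - L x\<^sub>1 (?P (z - x\<^sub>1))"
    \<comment> \<open>The third point cancels: comparing its two descriptions leaves only the jet
      error \<open>q\<close> and the difference of the maps.\<close>
    have "q + \<Delta> (?P (z - x\<^sub>1)) = a - b"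
      unfolding q_def a_def b_def \<Delta> orth_proj_ident[OF subV PV] split
      by (simp add: blinfun.diff_left blinfun.add_right)
    then have "norm (q + \<Delta> (?P (z - x\<^sub>1))) \<le> norm a + norm b" by (simp add: norm_triangle_ineq4)
    moreover have "norm a \<le> 6 * C * (d * X)" unfolding a_def
      by (rule order_trans[OF z(2) pw[OF norm_ge_zero n0]])
    moreover have "norm b \<le> 6 * C * (d * X)" unfolding b_def
      by (rule order_trans[OF z(3) pw[OF norm_ge_zero n1]])
    ultimately show ?thesis using z(1) PV by (intro exI[of _ "?P (z - x\<^sub>1)"]) auto
  qed
  define m where "m = norm \<Delta>"
  have m_le: "norm (\<Delta> h) \<le> m * norm h" for h unfolding m_def by (rule norm_blinfun)
  have small: "norm (\<Delta> h) \<le> 12 * C * X + m / 4" if h: "norm h \<le> 1" for h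
  proof -
    define e where "e = ?P h"
    have e: "e \<in> V" "norm e \<le> 1" "- e \<in> V" "norm (- e) \<le> 1"
      using PV norm_orth_proj_le(1)[OF subV, of h] h subspace_neg[OF subV] by (auto simp: e_def)
    obtain u where u: "norm (u - d *\<^sub>R e) \<le> d / 4" "norm (q + \<Delta> u) \<le> 12 * C * (d * X)"
      using test[OF e(1,2)] by blast
    obtain v where v: "norm (v - d *\<^sub>R (- e)) \<le> d / 4" "norm (q + \<Delta> v) \<le> 12 * C * (d * X)"
      using test[OF e(3,4)] by blast
    \<comment> \<open>Subtracting the tests for opposite directions eliminates \<open>q\<close>. The
      two placement errors of d/4 add up to \<open>r\<close>, and after division by 2 * d they cost
      m/4, which can be absorbed.\<close>
    define r where "r = (u - d *\<^sub>R e) - (v - d *\<^sub>R (- e))"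
    have "norm r \<le> d / 2" unfolding r_def using norm_triangle_ineq4[of "u - d *\<^sub>R e" "v - d *\<^sub>R (- e)"] u v by simp
    then have "norm (\<Delta> r) \<le> m * (d / 2)"
      using m_le[of r] mult_left_mono[of "norm r" "d / 2" m] by (simp add: m_def)
    moreover have "(2 * d) *\<^sub>R \<Delta> e = (q + \<Delta> u) - (q + \<Delta> v) - \<Delta> r"
    proof -
      have "(2 * d) *\<^sub>R e = d *\<^sub>R e + d *\<^sub>R e" by (simp add: scaleR_add_left[symmetric])
      then have "r = u - v - (2 * d) *\<^sub>R e" by (simp add: r_def)
      then show ?thesis by (simp add: blinfun.diff_right blinfun.scaleR_right)
    qed
    then have "2 * d * norm (\<Delta> e) = norm ((q + \<Delta> u) - (q + \<Delta> v) - \<Delta> r)"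
      using d(2) by (metis abs_of_pos mult_pos_pos norm_scaleR zero_less_numeral)
    then have "2 * d * norm (\<Delta> e) \<le> norm (q + \<Delta> u) + norm (q + \<Delta> v) + norm (\<Delta> r)"
      using norm_triangle_ineq4[of "(q + \<Delta> u) - (q + \<Delta> v)" "\<Delta> r"]
        norm_triangle_ineq4[of "q + \<Delta> u" "q + \<Delta> v"] by linarith
    ultimately have "2 * d * norm (\<Delta> e) \<le> 2 * d * (12 * C * X + m / 4)"
      using u v by (simp add: algebra_simps)
    then have "norm (\<Delta> e) \<le> 12 * C * X + m / 4" using d(2) by simp
    then show ?thesis unfolding e_def \<Delta> orth_proj_ident[OF subV PV] .
  qed
  have "m \<le> 12 * C * X + m / 4"
    unfolding m_def
  proof (rule norm_blinfun_bound)
    show nn: "0 \<le> 12 * C * X + norm \<Delta> / 4" using C X0 by simp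
    fix h :: 'a
    show "norm (\<Delta> h) \<le> (12 * C * X + norm \<Delta> / 4) * norm h"
    proof (cases "h = 0")
      case False
      have "norm (\<Delta> (h /\<^sub>R norm h)) \<le> 12 * C * X + m / 4"
        by (rule small) (use False in simp)
      then show ?thesis using False by (simp add: blinfun.scaleR_right m_def field_simps)
    qed (simp add: blinfun.zero_right)
  qed
  then have m: "m \<le> 16 * C * X" by simp
  \<comment> \<open>The direction 0 now isolates \<open>q\<close>: 12 from the test and 16/4 from
    the displacement make 16.\<close>
  obtain u where u: "norm u \<le> d / 4" "norm (q + \<Delta> u) \<le> 12 * C * (d * X)"
    using test[OF subspace_0[OF subV]] by auto
  have "norm (\<Delta> u) \<le> (16 * C * X) * (d / 4)"
    using m_le[of u] mult_mono[OF m u(1)] C X0 by simp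
  moreover have "norm q \<le> norm (q + \<Delta> u) + norm (\<Delta> u)"
    using norm_triangle_ineq4[of "q + \<Delta> u" "\<Delta> u"] by simp
  ultimately have "norm q \<le> 16 * C * (d * X)" using u(2) by (simp add: algebra_simps)
  then show "norm (x\<^sub>1 - x\<^sub>0 - L x\<^sub>0 (?P (x\<^sub>1 - x\<^sub>0))) \<le> 16 * C * d powr (1 + \<alpha>)"
    unfolding dX q_def .
  show "norm ((L x\<^sub>1 - L x\<^sub>0) (?P h)) \<le> 16 * C * d powr \<alpha> * norm h"
    using m_le[of h] mult_right_mono[OF m norm_ge_zero[of h]] unfolding \<Delta> X_def by linarith
qed

subsection \<open>Countable covers by graphs\<close>

text \<open>This is rectifiability without the Borel condition, which cannot be verified for pieces
  obtained by choice.\<close>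

definition graph_coverable :: "nat \<Rightarrow> real \<Rightarrow> 'a::euclidean_space set \<Rightarrow> bool" where
  "graph_coverable k \<alpha> S \<longleftrightarrow>
     (\<exists>G. countable G \<and> (\<forall>\<Gamma>\<in>G. C1_alpha_graph k \<alpha> \<Gamma>) \<and> hausdorff k (S - \<Union>G) = 0)"

lemma graph_coverable_subset:
  assumes "graph_coverable k \<alpha> T" "S \<subseteq> T"
  shows "graph_coverable k \<alpha> S"
proof -
  obtain G where G: "countable G" "\<forall>\<Gamma>\<in>G. C1_alpha_graph k \<alpha> \<Gamma>" "hausdorff k (T - \<Union>G) = 0"
    using assms(1) unfolding graph_coverable_def by blast
  have "hausdorff k (S - \<Union>G) \<le> hausdorff k (T - \<Union>G)"
    by (rule hausdorff_mono) (use assms(2) in blast)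
  then have "hausdorff k (S - \<Union>G) = 0" using G(3) by simp
  then show ?thesis unfolding graph_coverable_def using G by blast
qed

lemma graph_coverable_UN:
  assumes "\<And>i::nat. graph_coverable k \<alpha> (S i)"
  shows "graph_coverable k \<alpha> (\<Union>i. S i)"
proof -
  obtain G where G: "\<And>i. countable (G i)" "\<And>i \<Gamma>. \<Gamma> \<in> G i \<Longrightarrow> C1_alpha_graph k \<alpha> \<Gamma>"
      "\<And>i. hausdorff k (S i - \<Union>(G i)) = 0"
    using assms unfolding graph_coverable_def by metis
  have "hausdorff k ((\<Union>i. S i) - \<Union>(\<Union>i. G i)) \<le> hausdorff k (\<Union>i. S i - \<Union>(G i))"
    by (rule hausdorff_mono) blast
  then have "hausdorff k ((\<Union>i. S i) - \<Union>(\<Union>i. G i)) = 0"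
    using hausdorff_UN_null[of k "\<lambda>i. S i - \<Union>(G i)"] G(3) by simp
  moreover have "countable (\<Union>i. G i)" using G(1) by simp
  moreover have "\<forall>\<Gamma>\<in>(\<Union>i. G i). C1_alpha_graph k \<alpha> \<Gamma>" using G(2) by blast
  ultimately show ?thesis unfolding graph_coverable_def by blast
qed

lemma graph_coverable_null: "hausdorff k S = 0 \<Longrightarrow> graph_coverable k \<alpha> S"
  unfolding graph_coverable_def by (rule exI[of _ "{}"]) simp

lemma graph_coverable_graph:
  assumes "0 < k" "C1_alpha_graph k \<alpha> \<Gamma>" "S \<subseteq> \<Gamma>"
  shows "graph_coverable k \<alpha> S"
  unfolding graph_coverable_def
proof (intro exI[of _ "{\<Gamma>}"] conjI)
  have "S - \<Union>{\<Gamma>} = {}" using assms(3) by blast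
  then show "hausdorff k (S - \<Union>{\<Gamma>}) = 0" by (simp only: hausdorff_empty[OF assms(1)])
qed (use assms in simp_all)

lemma graph_coverable_UN_null:
  assumes "\<And>i::nat. graph_coverable k \<alpha> (S i)" "hausdorff k (T - (\<Union>i. S i)) = 0"
  shows "graph_coverable k \<alpha> T"
proof -
  define S' where "S' i = (case i of 0 \<Rightarrow> T - (\<Union>i. S i) | Suc j \<Rightarrow> S j)" for i
  have "graph_coverable k \<alpha> (\<Union>i. S' i)"
    by (rule graph_coverable_UN)
      (simp add: S'_def assms graph_coverable_null split: nat.split)
  moreover have "T \<subseteq> (\<Union>i. S' i)"
  proof
    fix x assume x: "x \<in> T"
    show "x \<in> (\<Union>i. S' i)"
    proof (cases "x \<in> (\<Union>i. S i)")
      case True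
      then obtain i where "x \<in> S' (Suc i)" by (auto simp: S'_def)
      then show ?thesis by blast
    next
      case False
      then have "x \<in> S' 0" using x by (simp add: S'_def)
      then show ?thesis by blast
    qed
  qed
  ultimately show ?thesis by (rule graph_coverable_subset)
qed

text \<open>Balls about a countable dense set cover the space, so estimates for points at distance
  less than 2 * \<eta> are enough.\<close>

lemma graph_coverable_locally:
  fixes T :: "'a::euclidean_space set"
  assumes \<eta>: "0 < \<eta>" and loc: "\<And>p. graph_coverable k \<alpha> (T \<inter> ball p \<eta>)"
  shows "graph_coverable k \<alpha> T"
proof -
  obtain D :: "'a set" where D: "countable D" "\<And>X. open X \<Longrightarrow> X \<noteq> {} \<Longrightarrow> \<exists>d\<in>D. d \<in> X"
    using countable_dense_setE by metis
  have "D \<noteq> {}" using D(2)[of UNIV] by auto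
  have "T \<subseteq> (\<Union>i. T \<inter> ball (from_nat_into D i) \<eta>)"
  proof
    fix x assume x: "x \<in> T"
    obtain p where p: "p \<in> D" "p \<in> ball x \<eta>" using D(2)[of "ball x \<eta>"] \<eta> by auto
    then have "x \<in> T \<inter> ball (from_nat_into D (to_nat_on D p)) \<eta>"
      using x D(1) by (simp add: dist_commute)
    then show "x \<in> (\<Union>i. T \<inter> ball (from_nat_into D i) \<eta>)" by blast
  qed
  then show ?thesis by (rule graph_coverable_subset[OF graph_coverable_UN[OF loc]])
qed

text \<open>The projections of the two bad sets are too small to fill the part of a disc occupied by
  the envelope of \<open>K\<close>. Hence some point of \<open>A\<close> over the disc is good for
  both base points, which is what \<open>jet_comparison\<close> asks for.\<close>

lemma graph_coverable_Lipschitz_piece: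
  fixes A :: "'a::euclidean_space set" and L :: "'a \<Rightarrow> 'a \<Rightarrow>\<^sub>L 'a"
  assumes k: "0 < k" and V: "linear_plane k V" and \<alpha>: "0 < \<alpha>" "\<alpha> \<le> 1" and C: "0 \<le> C"
    and bd: "bounded A" and r0: "0 < r0" and \<epsilon>: "0 \<le> \<epsilon>" "4 * \<epsilon> * 36 ^ k < 1"
    and lip: "\<And>x y. x \<in> A \<Longrightarrow> y \<in> A \<Longrightarrow> norm (y - x) \<le> 4 * norm (orth_proj V (y - x))"
    and bad: "\<And>x r. x \<in> A \<Longrightarrow> 0 < r \<Longrightarrow> r < r0 \<Longrightarrow>
      hausdorff k {z \<in> A. dist x z \<le> r \<and>
        C * norm (orth_proj V (z - x)) powr (1 + \<alpha>) < norm (z - x - L x (orth_proj V (z - x)))} \<le> ennreal (\<epsilon> * r ^ k)"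
  shows "graph_coverable k \<alpha> A"
proof -
  let ?P = "orth_proj V"
  have subV: "subspace V" using V by (simp add: linear_plane_def)
  have PV: "?P x \<in> V" for x by (rule orth_proj(1)[OF subV])
  have P1: "norm (?P x) \<le> norm x" for x by (rule norm_orth_proj_le(1)[OF subV])
  obtain \<nu> :: "'a measure" where \<nu>: "sets \<nu> = sets borel"
      "\<And>w s. w \<in> V \<Longrightarrow> 0 < s \<Longrightarrow> emeasure \<nu> (cball w s) = ennreal (s ^ k)"
    using plane_measure[OF V] by metis
  have \<nu>fin: "emeasure \<nu> (cball 0 R) < \<infinity>" for R
  proof -
    have "emeasure \<nu> (cball 0 R) \<le> emeasure \<nu> (cball 0 (\<bar>R\<bar> + 1))"
      using \<nu>(1) by (intro emeasure_mono subset_cball) auto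
    also have "\<dots> = ennreal ((\<bar>R\<bar> + 1) ^ k)" by (rule \<nu>(2)[OF subspace_0[OF subV]]) simp
    finally show ?thesis by (rule le_less_trans) simp
  qed
  define K where "K = ?P ` A"
  have injP: "inj_on ?P A"
  proof (rule inj_onI)
    fix x y assume xy: "x \<in> A" "y \<in> A" "?P x = ?P y"
    then show "x = y" using lip[of x y] by (simp add: orth_proj_diff[OF subV])
  qed
  have Kbd: "bounded K"
  proof -
    obtain R where R: "\<And>x. x \<in> A \<Longrightarrow> norm x \<le> R" using bd unfolding bounded_iff by blast
    have "norm v \<le> R" if "v \<in> K" for v
      using that R P1 unfolding K_def by (auto intro: order_trans)
    then show ?thesis unfolding bounded_iff by blast
  qed
  obtain U where U: "measurable_envelope \<nu> K U"
  proof -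
    have "K \<subseteq> (\<Union>n. cball 0 (real n))"
    proof
      fix v
      obtain n where "norm v \<le> real n" using real_arch_simple by blast
      then have "v \<in> cball 0 (real n)" by simp
      then show "v \<in> (\<Union>n. cball 0 (real n))" by blast
    qed
    then have "\<exists>U\<subseteq>(\<Union>n. cball 0 (real n)). measurable_envelope \<nu> K U"
      by (rule measurable_envelopeI_countable_cover) (simp add: \<nu>(1), rule \<nu>fin)
    then show ?thesis using that by blast
  qed
  have Um: "U \<in> sets \<nu>" using measurable_envelopeD[OF U] by blast
  \<comment> \<open>The displacement \<open>e\<close> is included because the test discs are centred
    up to distance d away from the density point; less than half of each may lie outside
    \<open>U\<close>.\<close>
  define B where "B j = {x \<in> A. \<forall>d e. 0 < d \<and> d < 1 / real (Suc j) \<and> norm e \<le> 1 \<longrightarrow>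
      \<not> ennreal ((d / 4) ^ k / 2) \<le> emeasure \<nu> (cball (?P x + d *\<^sub>R e) (d / 4) - U)}" for j
  have null: "hausdorff k (A - (\<Union>j. B j)) = 0"
  proof -
    define S where "S = {v \<in> K. \<forall>\<delta>>0. \<exists>d e. 0 < d \<and> d < \<delta> \<and> norm e \<le> 1 \<and>
        ennreal ((d / 4) ^ k / 2) \<le> emeasure \<nu> (cball (v + d *\<^sub>R e) (d / 4) - U)}"
    have S0: "hausdorff k S = 0"
      unfolding S_def by (rule density_points_exhaust[OF k Kbd \<nu>(1) \<nu>fin U])
    \<comment> \<open>The exceptional set is null in the projection; the 4-Lipschitz inverse carries
      this back to \<open>A\<close>.\<close>
    define g where "g = inv_into A ?P"
    have g: "g (?P x) = x" if "x \<in> A" for x unfolding g_def using injP that by (rule inv_into_f_f)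
    have "A - (\<Union>j. B j) \<subseteq> g ` S"
    proof
      fix x assume x: "x \<in> A - (\<Union>j. B j)"
      have "?P x \<in> S"
        unfolding S_def
      proof (intro CollectI conjI allI impI)
        show "?P x \<in> K" using x by (simp add: K_def)
        fix \<delta> :: real assume "0 < \<delta>"
        then obtain j where j: "1 / real (Suc j) < \<delta>" using nat_approx_posE by blast
        have "x \<notin> B j" "x \<in> A" using x by auto
        then obtain d e where de: "0 < d" "d < 1 / real (Suc j)" "norm e \<le> 1"
          "ennreal ((d / 4) ^ k / 2) \<le> emeasure \<nu> (cball (?P x + d *\<^sub>R e) (d / 4) - U)"
          unfolding B_def by blast
        then show "\<exists>d e. 0 < d \<and> d < \<delta> \<and> norm e \<le> 1 \<and>
            ennreal ((d / 4) ^ k / 2) \<le> emeasure \<nu> (cball (?P x + d *\<^sub>R e) (d / 4) - U)"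
          using j by (intro exI[of _ d] exI[of _ e]) simp
      qed
      then show "x \<in> g ` S" using g[of x] x by (metis DiffD1 image_eqI)
    qed
    then have "hausdorff k (A - (\<Union>j. B j)) \<le> hausdorff k (g ` S)" by (rule hausdorff_mono)
    also have "\<dots> \<le> ennreal (4 ^ k) * hausdorff k S"
    proof (rule hausdorff_Lipschitz_image_le)
      fix v w assume "v \<in> S" "w \<in> S"
      then have "v \<in> K" "w \<in> K" by (simp_all add: S_def)
      then obtain x y where xy: "x \<in> A" "y \<in> A" "v = ?P x" "w = ?P y" unfolding K_def by blast
      then show "dist (g v) (g w) \<le> 4 * dist v w"
        using lip[of y x] by (simp add: g dist_norm orth_proj_diff[OF subV])
    qed simp
    finally show ?thesis using S0 by simp
  qed
  show ?thesis
  proof (rule graph_coverable_UN_null[OF _ null])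
    fix j
    \<comment> \<open>Points of one ball of radius \<eta> then satisfy d < 1 / (j + 1), the range of
      the density condition, and 9 * d < r0, the range of \<open>bad\<close>.\<close>
    define \<eta> where "\<eta> = min (1 / real (Suc j)) (r0 / 9) / 2"
    have \<eta>: "0 < \<eta>" using r0 by (simp add: \<eta>_def)
    show "graph_coverable k \<alpha> (B j)"
    proof (rule graph_coverable_locally[OF \<eta>])
      fix p
      define T where "T = B j \<inter> ball p \<eta>"
      have TA: "x \<in> A" if "x \<in> T" for x using that by (simp add: T_def B_def)
      have pair: "norm (x\<^sub>1 - x\<^sub>0 - L x\<^sub>0 (?P (x\<^sub>1 - x\<^sub>0))) \<le> 16 * C * norm (?P (x\<^sub>1 - x\<^sub>0)) powr (1 + \<alpha>)
          \<and> (\<forall>h. norm ((L x\<^sub>1 - L x\<^sub>0) (?P h)) \<le> 16 * C * norm (?P (x\<^sub>1 - x\<^sub>0)) powr \<alpha> * norm h)"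
        if x: "x\<^sub>0 \<in> T" "x\<^sub>1 \<in> T" for x\<^sub>0 x\<^sub>1
      proof (cases "x\<^sub>1 = x\<^sub>0")
        case True
        then show ?thesis by (simp add: orth_proj_ident[OF subV subspace_0[OF subV]] blinfun.zero_right)
      next
        case False
        define d where "d = norm (?P (x\<^sub>1 - x\<^sub>0))"
        have xA: "x\<^sub>0 \<in> A" "x\<^sub>1 \<in> A" using x TA by auto
        have d0: "0 < d" using lip[OF xA] False unfolding d_def by (cases "?P (x\<^sub>1 - x\<^sub>0) = 0") auto
        have "dist x\<^sub>1 x\<^sub>0 < 2 * \<eta>"
          using x dist_triangle_half_l[of x\<^sub>1 p "2 * \<eta>" x\<^sub>0] by (simp add: T_def dist_commute)
        then have "d < 2 * \<eta>" using P1[of "x\<^sub>1 - x\<^sub>0"] by (simp add: d_def dist_norm)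
        then have d1: "d < 1 / real (Suc j)" "9 * d < r0" unfolding \<eta>_def by simp_all
        \<comment> \<open>A point over a test disc projects to within 9/4 * d of either base point,
          and the Lipschitz factor 4 turns this into 9 * d.\<close>
        let ?bad = "\<lambda>x. {z \<in> A. dist x z \<le> 9 * d \<and>
            C * norm (?P (z - x)) powr (1 + \<alpha>) < norm (z - x - L x (?P (z - x)))}"
        have Pbad: "outer_measure_of \<nu> (?P ` ?bad x) \<le> ennreal (\<epsilon> * (9 * d) ^ k)" if "x \<in> A" for x
        proof -
          have "outer_measure_of \<nu> (?P ` ?bad x) \<le> hausdorff k (?P ` ?bad x)"
            by (rule outer_measure_le_hausdorff[OF k \<nu>]) (auto simp: PV)
          also have "\<dots> \<le> ennreal (1 ^ k) * hausdorff k (?bad x)"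
            using P1 by (intro hausdorff_Lipschitz_image_le) (simp_all add: dist_norm orth_proj_diff[OF subV, symmetric])
          also have "\<dots> \<le> ennreal (\<epsilon> * (9 * d) ^ k)"
            using bad[OF that, of "9 * d"] d0 d1 by simp
          finally show ?thesis .
        qed
        have good: "\<exists>z. norm (?P (z - x\<^sub>1) - d *\<^sub>R e) \<le> d / 4 \<and>
            norm (z - x\<^sub>0 - L x\<^sub>0 (?P (z - x\<^sub>0))) \<le> C * norm (?P (z - x\<^sub>0)) powr (1 + \<alpha>) \<and>
            norm (z - x\<^sub>1 - L x\<^sub>1 (?P (z - x\<^sub>1))) \<le> C * norm (?P (z - x\<^sub>1)) powr (1 + \<alpha>)"
          if e: "e \<in> V" "norm e \<le> 1" for e
        proof (rule ccontr)
          assume no: "\<not> ?thesis"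
          define b where "b = cball (?P x\<^sub>1 + d *\<^sub>R e) (d / 4)"
          have bm: "b \<in> sets \<nu>" by (simp add: b_def \<nu>(1))
          have "b \<inter> K \<subseteq> ?P ` ?bad x\<^sub>0 \<union> ?P ` ?bad x\<^sub>1"
          proof
            fix v assume v: "v \<in> b \<inter> K"
            then obtain z where z: "z \<in> A" "v = ?P z" unfolding K_def by blast
            have c: "norm (?P (z - x\<^sub>1) - d *\<^sub>R e) \<le> d / 4"
            proof -
              have "?P (z - x\<^sub>1) - d *\<^sub>R e = v - (?P x\<^sub>1 + d *\<^sub>R e)" by (simp add: z orth_proj_diff[OF subV])
              moreover have "norm (v - (?P x\<^sub>1 + d *\<^sub>R e)) \<le> d / 4"
                using v unfolding b_def by (simp only: Int_iff mem_cball dist_commute) (simp only: dist_norm)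
              ultimately show ?thesis by (simp only:)
            qed
            have de: "norm (d *\<^sub>R e) \<le> d" using e d0 mult_left_mono[of "norm e" 1 d] by simp
            have n1: "norm (?P (z - x\<^sub>1)) \<le> 5/4 * d"
              using norm_triangle_ineq[of "?P (z - x\<^sub>1) - d *\<^sub>R e" "d *\<^sub>R e"] c de
              unfolding diff_add_cancel by linarith
            have "?P (z - x\<^sub>0) = ?P (z - x\<^sub>1) + ?P (x\<^sub>1 - x\<^sub>0)" by (simp add: orth_proj_diff[OF subV])
            then have n0: "norm (?P (z - x\<^sub>0)) \<le> 9/4 * d"
              using norm_triangle_ineq[of "?P (z - x\<^sub>1)" "?P (x\<^sub>1 - x\<^sub>0)"] n1 unfolding d_def by simp
            have "dist x\<^sub>0 z \<le> 9 * d" "dist x\<^sub>1 z \<le> 9 * d"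
              using lip[OF xA(1) z(1)] lip[OF xA(2) z(1)] n0 n1 d0
              by (simp_all add: dist_norm norm_minus_commute)
            moreover have "\<not> norm (z - x\<^sub>0 - L x\<^sub>0 (?P (z - x\<^sub>0))) \<le> C * norm (?P (z - x\<^sub>0)) powr (1 + \<alpha>) \<or>
                \<not> norm (z - x\<^sub>1 - L x\<^sub>1 (?P (z - x\<^sub>1))) \<le> C * norm (?P (z - x\<^sub>1)) powr (1 + \<alpha>)"
              using no c by blast
            ultimately have "z \<in> ?bad x\<^sub>0 \<or> z \<in> ?bad x\<^sub>1" using z(1) by (simp add: not_le)
            then show "v \<in> ?P ` ?bad x\<^sub>0 \<union> ?P ` ?bad x\<^sub>1" unfolding z(2) by blast
          qed
          then have sub: "b \<inter> K \<subseteq> ?P ` ?bad x\<^sub>0 \<union> ?P ` ?bad x\<^sub>1" .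
          \<comment> \<open>The envelope property lets an estimate for the outer measure of
            \<open>K\<close> bound the measure of \<open>U\<close> on the disc.\<close>
          have "emeasure \<nu> (b \<inter> U) = outer_measure_of \<nu> (b \<inter> K)"
            by (rule measurable_envelopeD(3)[OF U bm])
          also have "\<dots> \<le> ennreal (2 * \<epsilon> * (9 * d) ^ k)"
          \<comment> \<open>Measurable hulls of the two projected bad sets turn the union bound into
            one for measures.\<close>
          proof -
            obtain E\<^sub>0 where E0: "E\<^sub>0 \<in> sets \<nu>" "?P ` ?bad x\<^sub>0 \<subseteq> E\<^sub>0" "outer_measure_of \<nu> (?P ` ?bad x\<^sub>0) = emeasure \<nu> E\<^sub>0"
              using outer_measure_of_attain[of "?P ` ?bad x\<^sub>0" \<nu>] sets_eq_imp_space_eq[OF \<nu>(1)] by auto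
            obtain E\<^sub>1 where E1: "E\<^sub>1 \<in> sets \<nu>" "?P ` ?bad x\<^sub>1 \<subseteq> E\<^sub>1" "outer_measure_of \<nu> (?P ` ?bad x\<^sub>1) = emeasure \<nu> E\<^sub>1"
              using outer_measure_of_attain[of "?P ` ?bad x\<^sub>1" \<nu>] sets_eq_imp_space_eq[OF \<nu>(1)] by auto
            have "b \<inter> K \<subseteq> E\<^sub>0 \<union> E\<^sub>1" using sub E0(2) E1(2) by blast
            then have "outer_measure_of \<nu> (b \<inter> K) \<le> outer_measure_of \<nu> (E\<^sub>0 \<union> E\<^sub>1)" by (rule outer_measure_of_mono)
            also have "\<dots> = emeasure \<nu> (E\<^sub>0 \<union> E\<^sub>1)" using E0(1) E1(1) by (intro outer_measure_of_eq) simp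
            also have "\<dots> \<le> emeasure \<nu> E\<^sub>0 + emeasure \<nu> E\<^sub>1" by (rule emeasure_subadditive[OF E0(1) E1(1)])
            also have "\<dots> \<le> ennreal (\<epsilon> * (9 * d) ^ k) + ennreal (\<epsilon> * (9 * d) ^ k)"
              unfolding E0(3)[symmetric] E1(3)[symmetric] by (intro add_mono Pbad xA)
            also have "\<dots> = ennreal (\<epsilon> * (9 * d) ^ k + \<epsilon> * (9 * d) ^ k)"
              using \<epsilon>(1) d0 by (intro ennreal_plus[symmetric]) simp_all
            also have "\<epsilon> * (9 * d) ^ k + \<epsilon> * (9 * d) ^ k = 2 * \<epsilon> * (9 * d) ^ k" by simp
            finally show ?thesis .
          qed
          finally have in_U: "emeasure \<nu> (b \<inter> U) \<le> ennreal (2 * \<epsilon> * (9 * d) ^ k)" .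
          have out_U: "emeasure \<nu> (b - U) \<le> ennreal ((d / 4) ^ k / 2)"
            using x(2) d0 d1(1) e(2) unfolding T_def B_def b_def by (simp add: not_le less_imp_le)
          have "?P x\<^sub>1 + d *\<^sub>R e \<in> V" using PV e subV by (simp add: subspace_add subspace_scale)
          then have "ennreal ((d / 4) ^ k) = emeasure \<nu> b" unfolding b_def using d0 by (simp add: \<nu>(2))
          also have "\<dots> = emeasure \<nu> ((b \<inter> U) \<union> (b - U))" by (rule arg_cong[where f="emeasure \<nu>"]) blast
          also have "\<dots> \<le> emeasure \<nu> (b \<inter> U) + emeasure \<nu> (b - U)"
            using bm Um by (intro emeasure_subadditive) auto
          also have "\<dots> \<le> ennreal (2 * \<epsilon> * (9 * d) ^ k) + ennreal ((d / 4) ^ k / 2)"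
            by (rule add_mono[OF in_U out_U])
          also have "\<dots> = ennreal (2 * \<epsilon> * (9 * d) ^ k + (d / 4) ^ k / 2)"
            using \<epsilon>(1) d0 by (intro ennreal_plus[symmetric]) simp_all
          finally have "(d / 4) ^ k \<le> 2 * \<epsilon> * (9 * d) ^ k + (d / 4) ^ k / 2"
            by (rule ennreal_le_iff[THEN iffD1, rotated]) (use \<epsilon>(1) d0 in simp)
          moreover have "(9 * d) ^ k = 36 ^ k * (d / 4) ^ k" by (subst power_mult_distrib[symmetric]) simp
          ultimately have "(d / 4) ^ k \<le> 2 * \<epsilon> * (36 ^ k * (d / 4) ^ k) + (d / 4) ^ k / 2" by (simp only:)
          \<comment> \<open>Here 36 is the ratio of 9 * d to d/4; two bad sets have to fill at least
            half of the disc, which gives the factor 4.\<close>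
          then have "1 * (d / 4) ^ k \<le> (4 * \<epsilon> * 36 ^ k) * (d / 4) ^ k" by linarith
          then have "1 \<le> 4 * \<epsilon> * 36 ^ k"
            by (rule mult_right_le_imp_le) (use d0 in simp)
          then show False using \<epsilon>(2) by simp
        qed
        show ?thesis
          using jet_comparison[OF subV \<alpha> C d_def d0 good] unfolding d_def by blast
      qed
      have "\<exists>\<Gamma>. C1_alpha_graph k \<alpha> \<Gamma> \<and> T \<subseteq> \<Gamma>"
      proof (rule C1_alpha_graph_of_jets[OF V \<alpha>, of "16 * C"])
        show "0 \<le> 16 * C" using C by simp
        show "inj_on ?P T" using injP TA by (meson inj_on_subset subsetI)
      qed (use pair in blast)+
      then show "graph_coverable k \<alpha> (B j \<inter> ball p \<eta>)"
        unfolding T_def using graph_coverable_graph[OF k] by blast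
    qed
  qed
qed

section \<open>Comparison of nearby planes\<close>

lemma approx_inverse_on_plane:
  fixes W V :: "'a::euclidean_space set"
  assumes W: "subspace W" and V: "subspace V"
    and close: "\<And>w. norm (orth_proj W w - orth_proj V w) \<le> norm w / 2"
  obtains L :: "'a \<Rightarrow>\<^sub>L 'a" where "\<And>w. norm (w - L (orth_proj V w)) \<le> 3 * norm (w - orth_proj W w)"
proof -
  let ?P = "orth_proj V" and ?Q = "orth_proj W"
  \<comment> \<open>On \<open>W\<close> this perturbation of the identity coincides with the
    projection onto \<open>V\<close>, and it is invertible on the whole space with inverse of norm
    at most 2. The inverse therefore lifts the projection of a point of \<open>W\<close> back to
    that point, and in general errs by the distance to \<open>W\<close> and twice that
    distance.\<close>
  define S where "S w = w - (?Q w - ?P w)" for w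
  have Slin: "linear S"
    unfolding S_def by (intro linear_compose_sub linear_ident linear_orth_proj V W)
  have S_ge: "norm w / 2 \<le> norm (S w)" for w
    using norm_triangle_ineq2[of w "?Q w - ?P w"] close[of w] unfolding S_def by linarith
  have "inj S"
    unfolding linear_injective_0[OF Slin]
  proof (intro allI impI)
    fix w assume "S w = 0"
    then show "w = 0" using S_ge[of w] by simp
  qed
  then obtain R where R: "linear R" "R \<circ> S = id"
    using linear_injective_left_inverse[OF Slin] by blast
  have RS: "R (S w) = w" for w using R(2) by (metis comp_apply id_apply)
  have "surj S" by (rule linear_inj_imp_surj[OF Slin \<open>inj S\<close>])
  then have R_le: "norm (R u) \<le> 2 * norm u" for u
  proof -
    obtain w where "u = S w" using \<open>surj S\<close> by (metis surjD)
    then show ?thesis using S_ge[of w] RS by simp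
  qed
  have Rbl: "bounded_linear R" using R(1) by (simp add: linear_conv_bounded_linear)
  show ?thesis
  proof (rule that[of "Blinfun R"])
    fix w
    have QQ: "?Q (?Q w) = ?Q w" by (rule orth_proj_ident[OF W orth_proj(1)[OF W]])
    have "S (?Q w) = ?P (?Q w)" unfolding S_def QQ by simp
    then have "R (?P (?Q w)) = ?Q w" using RS[of "?Q w"] by simp
    moreover have "?P w = ?P (?Q w) + ?P (w - ?Q w)" by (simp add: orth_proj_diff[OF V])
    ultimately have "R (?P w) = ?Q w + R (?P (w - ?Q w))" by (simp add: linear_add[OF R(1)])
    then have "norm (w - R (?P w)) \<le> norm (w - ?Q w) + norm (R (?P (w - ?Q w)))"
      using norm_triangle_ineq4[of "w - ?Q w" "R (?P (w - ?Q w))"] by (simp add: diff_diff_eq)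
    also have "norm (R (?P (w - ?Q w))) \<le> 2 * norm (w - ?Q w)"
      using R_le[of "?P (w - ?Q w)"] norm_orth_proj_le(1)[OF V, of "w - ?Q w"] by linarith
    finally show "norm (w - Blinfun R (?P w)) \<le> 3 * norm (w - ?Q w)"
      by (simp add: bounded_linear_Blinfun_apply[OF Rbl])
  qed
qed

text \<open>Orthogonal projections embed the planes into the unit ball of a finite-dimensional
  operator space, which is totally bounded. Cells are preimages of balls of radius d/2, so members
  of one cell differ by less than d.\<close>

lemma finite_cover_of_planes:
  fixes d :: real
  assumes d: "0 < d"
  shows "\<exists>\<C> :: 'a::euclidean_space set set set. finite \<C> \<and> (\<forall>V. subspace V \<longrightarrow> (\<exists>c\<in>\<C>. V \<in> c)) \<and>
    (\<forall>c\<in>\<C>. \<forall>V\<in>c. \<forall>W\<in>c. subspace V \<longrightarrow> subspace W \<longrightarrow>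
      (\<forall>w. norm (orth_proj V w - orth_proj W w) \<le> d * norm w))"
proof -
  define p where "p V = Blinfun (orth_proj V)" for V :: "'a set"
  have p: "p V w = orth_proj V w" if "subspace V" for V w
    unfolding p_def using linear_orth_proj[OF that]
    by (simp add: bounded_linear_Blinfun_apply linear_conv_bounded_linear)
  obtain F where F: "finite F" "cball (0 :: 'a \<Rightarrow>\<^sub>L 'a) 1 \<subseteq> (\<Union>q\<in>F. ball q (d / 2))"
    using compact_cball[of "0 :: 'a \<Rightarrow>\<^sub>L 'a" 1] half_gt_zero[OF d] unfolding compact_eq_totally_bounded by blast
  define \<C> where "\<C> = (\<lambda>q. {V. p V \<in> ball q (d / 2)}) ` F"
  show ?thesis
  proof (intro exI[of _ \<C>] conjI allI ballI impI)
    show "finite \<C>" using F(1) by (simp add: \<C>_def)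
    fix V :: "'a set" assume V: "subspace V"
    have "norm (p V) \<le> 1"
      by (rule norm_blinfun_bound) (use norm_orth_proj_le(1)[OF V] in \<open>simp_all add: p[OF V]\<close>)
    then have "p V \<in> cball 0 1" by simp
    then obtain q where q: "q \<in> F" "p V \<in> ball q (d / 2)" using F(2) by (elim subsetD[THEN UN_E])
    show "\<exists>c\<in>\<C>. V \<in> c"
    proof (rule bexI)
      show "V \<in> {V. p V \<in> ball q (d / 2)}" using q(2) by (rule CollectI)
      show "{V. p V \<in> ball q (d / 2)} \<in> \<C>" unfolding \<C>_def using q(1) by (rule imageI)
    qed
  next
    fix c V W and w :: 'a
    assume c: "c \<in> \<C>" "V \<in> c" "W \<in> c" and V: "subspace V" "subspace W"
    obtain q where q: "c = {V. p V \<in> ball q (d / 2)}" using c(1) unfolding \<C>_def by (rule imageE)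
    have "dist (p V) (p W) < d"
      by (rule dist_triangle_half_r[of q]) (use c(2,3) in \<open>simp_all only: q mem_Collect_eq mem_ball\<close>)
    then have "norm (p V - p W) * norm w \<le> d * norm w" by (simp add: dist_norm mult_right_mono)
    moreover have "norm ((p V - p W) w) \<le> norm (p V - p W) * norm w" by (rule norm_blinfun)
    ultimately show "norm (orth_proj V w - orth_proj W w) \<le> d * norm w"
      by (simp add: blinfun.diff_left p[OF V(1)] p[OF V(2)])
  qed
qed

text \<open>The paraboloid bound is used twice: weakened to a cone around \<open>V\<close>, it
  discards the steep points and yields Lipschitz pieces; on these, distances and projected distances
  are comparable, so it becomes a jet bound of order 1 + \<alpha>.\<close>

lemma graph_coverable_of_close_planes:
  fixes E A V :: "'a::euclidean_space set" and W :: "'a \<Rightarrow> 'a set"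
  assumes k: "0 < k" and V: "linear_plane k V" and \<alpha>: "0 < \<alpha>" "\<alpha> \<le> 1" and lam: "0 < lam"
    and AE: "A \<subseteq> E" and fin: "hausdorff k E < top" and r0: "0 < r0" and \<epsilon>: "0 < \<epsilon>" "4 * \<epsilon> * 44 ^ k < 1"
    and W: "\<And>x. x \<in> A \<Longrightarrow> subspace (W x)"
    and close: "\<And>x w. x \<in> A \<Longrightarrow> norm (orth_proj (W x) w - orth_proj V w) \<le> 1/20 * norm w"
    and approx: "\<And>x r. x \<in> A \<Longrightarrow> 0 < r \<Longrightarrow> r < r0 \<Longrightarrow>
      hausdorff k ((E \<inter> cball x r) - paraboloid \<alpha> x (W x) lam) \<le> ennreal (\<epsilon> * r ^ k)"
  shows "graph_coverable k \<alpha> A"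
proof -
  let ?P = "orth_proj V"
  have subV: "subspace V" using V by (simp add: linear_plane_def)
  define N where "N = {x \<in> A. \<forall>\<delta>>0. \<exists>y\<in>A. dist x y < \<delta> \<and> norm (?P (y - x)) < norm (y - x) / 4}"
  have para: "norm (z - x - orth_proj (W x) (z - x)) \<le> lam * norm (z - x) powr (1 + \<alpha>)"
    if x: "x \<in> A" and z: "z \<in> paraboloid \<alpha> x (W x) lam" for x z
  proof -
    have "norm (z - x - orth_proj (W x) (z - x)) \<le> lam * norm (orth_proj (W x) (z - x)) powr (1 + \<alpha>)"
      using z by (simp add: paraboloid_def orth_proj_orthogonal_comp[OF W[OF x]])
    also have "\<dots> \<le> lam * norm (z - x) powr (1 + \<alpha>)"
      using lam \<alpha> norm_orth_proj_le(1)[OF W[OF x]] by (intro mult_left_mono powr_mono2) auto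
    finally show ?thesis .
  qed
  \<comment> \<open>Below this radius the paraboloid deviates from its plane by at most 1/20 of the
    distance; the tilt between the planes adds 1/20, which leaves the slope 9/10 of the cone
    condition.\<close>
  define r\<^sub>1 where "r\<^sub>1 = min r0 ((1 / (20 * lam)) powr (1 / \<alpha>))"
  have r1: "0 < r\<^sub>1" "r\<^sub>1 \<le> r0" using r0 lam by (simp_all add: r\<^sub>1_def)
  have "hausdorff k N = 0"
    unfolding N_def
  proof (rule steep_points_null[OF k V _ r1(1) \<epsilon>(1)])
    show "hausdorff k A < top" using hausdorff_mono[OF AE] fin by (rule le_less_trans)
    have "0 \<le> \<epsilon> * 44 ^ k" using \<epsilon>(1) by simp
    then show "2 * \<epsilon> * 44 ^ k < 1" using \<epsilon>(2) by linarith
    fix x r assume x: "x \<in> A" and r: "0 < r" "r < r\<^sub>1"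
    have "{z \<in> A. dist x z \<le> r \<and> norm (?P (z - x)) < 9/10 * norm (z - x)}
        \<subseteq> (E \<inter> cball x r) - paraboloid \<alpha> x (W x) lam"
    proof
      fix z assume z: "z \<in> {z \<in> A. dist x z \<le> r \<and> norm (?P (z - x)) < 9/10 * norm (z - x)}"
      define n where "n = norm (z - x)"
      have n: "0 \<le> n" "n \<le> r" using z by (simp_all add: n_def dist_norm norm_minus_commute)
      have "z \<notin> paraboloid \<alpha> x (W x) lam"
      proof
        assume "z \<in> paraboloid \<alpha> x (W x) lam"
        from para[OF x this] have 1: "norm (z - x - orth_proj (W x) (z - x)) \<le> lam * (n * n powr \<alpha>)"
          using n by (cases "n = 0") (simp_all add: n_def powr_add)
        have "n powr \<alpha> \<le> ((1 / (20 * lam)) powr (1 / \<alpha>)) powr \<alpha>"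
          using n r \<alpha> by (intro powr_mono2) (simp_all add: r\<^sub>1_def)
        also have "\<dots> = 1 / (20 * lam)" using \<alpha> lam by (simp add: powr_powr)
        finally have "lam * (n * n powr \<alpha>) \<le> lam * (n * (1 / (20 * lam)))"
          using lam n by (intro mult_left_mono) simp_all
        also have "\<dots> = n / 20" using lam by simp
        finally have "norm (z - x - orth_proj (W x) (z - x)) \<le> n / 20" using 1 by simp
        moreover have "norm (orth_proj (W x) (z - x) - ?P (z - x)) \<le> n / 20"
          using close[OF x, of "z - x"] by (simp add: n_def)
        moreover have "norm (z - x) \<le> norm (z - x - orth_proj (W x) (z - x))
            + norm (orth_proj (W x) (z - x) - ?P (z - x)) + norm (?P (z - x))"
          using norm_triangle_ineq[of "z - x - orth_proj (W x) (z - x)" "orth_proj (W x) (z - x)"]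
            norm_triangle_ineq[of "orth_proj (W x) (z - x) - ?P (z - x)" "?P (z - x)"]
          unfolding diff_add_cancel by linarith
        ultimately show False using z unfolding n_def by simp
      qed
      then show "z \<in> (E \<inter> cball x r) - paraboloid \<alpha> x (W x) lam" using z AE by auto
    qed
    from order_trans[OF hausdorff_mono[OF this] approx[OF x r(1) less_le_trans[OF r(2) r1(2)]]]
    show "hausdorff k {z \<in> A. dist x z \<le> r \<and> norm (?P (z - x)) < 9/10 * norm (z - x)} \<le> ennreal (\<epsilon> * r ^ k)" .
  qed
  \<comment> \<open>A point that is not steep at all small scales has a scale below which no point
    of \<open>A\<close> is seen steeply; \<open>j\<close> fixes that scale.\<close>
  define B where "B j = {x \<in> A. \<forall>y\<in>A. dist x y < 1 / real (Suc j) \<longrightarrow>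
      \<not> norm (?P (y - x)) < norm (y - x) / 4}" for j
  have "A - (\<Union>j. B j) \<subseteq> N"
  proof
    fix x assume x: "x \<in> A - (\<Union>j. B j)"
    show "x \<in> N"
      unfolding N_def
    proof (intro CollectI conjI allI impI)
      fix \<delta> :: real assume "0 < \<delta>"
      then obtain j where j: "1 / real (Suc j) < \<delta>" using nat_approx_posE by blast
      have "x \<in> A" "x \<notin> B j" using x by auto
      then obtain y where "y \<in> A" "dist x y < 1 / real (Suc j)" "norm (?P (y - x)) < norm (y - x) / 4"
        unfolding B_def by blast
      then show "\<exists>y\<in>A. dist x y < \<delta> \<and> norm (?P (y - x)) < norm (y - x) / 4"
        using j by (intro bexI[of _ y]) auto
    qed (use x in blast)
  qed
  from hausdorff_mono[OF this, of k] have null: "hausdorff k (A - (\<Union>j. B j)) = 0"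
    using \<open>hausdorff k N = 0\<close> by simp
  have "\<exists>L :: 'a \<Rightarrow>\<^sub>L 'a. \<forall>w. norm (w - L (?P w)) \<le> 3 * norm (w - orth_proj (W x) w)" if x: "x \<in> A" for x
  proof (rule approx_inverse_on_plane[OF W[OF x] subV])
    show "norm (orth_proj (W x) w - ?P w) \<le> norm w / 2" for w
      using close[OF x, of w] norm_ge_zero[of w] by linarith
  qed blast
  then have "\<forall>x\<in>A. \<exists>L :: 'a \<Rightarrow>\<^sub>L 'a. \<forall>w. norm (w - L (?P w)) \<le> 3 * norm (w - orth_proj (W x) w)"
    by (rule ballI)
  from bchoice[OF this] obtain L :: "'a \<Rightarrow> 'a \<Rightarrow>\<^sub>L 'a" where
    Lx: "\<forall>x\<in>A. \<forall>w. norm (w - L x (?P w)) \<le> 3 * norm (w - orth_proj (W x) w)" ..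
  have L: "norm (w - L x (?P w)) \<le> 3 * norm (w - orth_proj (W x) w)" if "x \<in> A" for x w
    using bspec[OF Lx that] by (rule spec)
  show ?thesis
  proof (rule graph_coverable_UN_null[OF _ null])
    fix j
    define \<eta> where "\<eta> = 1 / real (Suc j) / 2"
    have \<eta>: "0 < \<eta>" by (simp add: \<eta>_def)
    show "graph_coverable k \<alpha> (B j)"
    proof (rule graph_coverable_locally[OF \<eta>])
      fix p
      define T where "T = B j \<inter> ball p \<eta>"
      have TA: "x \<in> A" if "x \<in> T" for x using that by (simp add: T_def B_def)
      have lip: "norm (y - x) \<le> 4 * norm (?P (y - x))" if xy: "x \<in> T" "y \<in> T" for x y
      proof -
        have "dist x y < 2 * \<eta>"
          using xy dist_triangle_half_l[of x p "2 * \<eta>" y] by (simp add: T_def dist_commute)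
        then have "dist x y < 1 / real (Suc j)" by (simp add: \<eta>_def del: of_nat_Suc)
        then show ?thesis using xy TA[OF xy(2)] unfolding T_def B_def by auto
      qed
      have "graph_coverable k \<alpha> T"
      \<comment> \<open>The constant 48 is 3 * 16: the factor 3 comes from lifting \<open>V\<close>
        to the plane at \<open>x\<close>, and 16 bounds 4^(1 + \<alpha>), the cost of replacing a
        distance by four times its projection.\<close>
      proof (rule graph_coverable_Lipschitz_piece[OF k V \<alpha> _ _ r0, of "48 * lam" _ \<epsilon> L])
        show "0 \<le> 48 * lam" using lam by simp
        show "bounded T" unfolding T_def using bounded_ball by (rule bounded_subset) blast
        show "0 \<le> \<epsilon>" using \<epsilon>(1) by simp
        have "(36::real) ^ k \<le> 44 ^ k" by (intro power_mono) simp_all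
        then have "4 * \<epsilon> * 36 ^ k \<le> 4 * \<epsilon> * 44 ^ k" using \<epsilon>(1) by (intro mult_left_mono) simp_all
        then show "4 * \<epsilon> * 36 ^ k < 1" using \<epsilon>(2) by simp
        show "\<And>x y. x \<in> T \<Longrightarrow> y \<in> T \<Longrightarrow> norm (y - x) \<le> 4 * norm (?P (y - x))" by (rule lip)
        fix x r assume x: "x \<in> T" and r: "0 < r" "r < r0"
        have "{z \<in> T. dist x z \<le> r \<and> 48 * lam * norm (?P (z - x)) powr (1 + \<alpha>) < norm (z - x - L x (?P (z - x)))}
            \<subseteq> (E \<inter> cball x r) - paraboloid \<alpha> x (W x) lam"
        proof
          fix z assume z: "z \<in> {z \<in> T. dist x z \<le> r \<and>
              48 * lam * norm (?P (z - x)) powr (1 + \<alpha>) < norm (z - x - L x (?P (z - x)))}"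
          have "z \<notin> paraboloid \<alpha> x (W x) lam"
          proof
            assume q: "z \<in> paraboloid \<alpha> x (W x) lam"
            have "norm (z - x - L x (?P (z - x))) \<le> 3 * (lam * norm (z - x) powr (1 + \<alpha>))"
              using L[OF TA[OF x], of "z - x"] para[OF TA[OF x] q] by linarith
            also have "\<dots> \<le> 3 * (lam * (16 * norm (?P (z - x)) powr (1 + \<alpha>)))"
            proof (intro mult_left_mono)
              have "norm (z - x) powr (1 + \<alpha>) \<le> (4 * norm (?P (z - x))) powr (1 + \<alpha>)"
                using lip[OF x, of z] z \<alpha> by (intro powr_mono2) auto
              also have "\<dots> = 4 powr (1 + \<alpha>) * norm (?P (z - x)) powr (1 + \<alpha>)" by (rule powr_mult)
              also have "\<dots> \<le> 16 * norm (?P (z - x)) powr (1 + \<alpha>)"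
                using powr_mono[of "1 + \<alpha>" 2 "4::real"] \<alpha> by (intro mult_right_mono) auto
              finally show "norm (z - x) powr (1 + \<alpha>) \<le> 16 * norm (?P (z - x)) powr (1 + \<alpha>)" .
            qed (use lam in simp_all)
            finally show False using z by simp
          qed
          then show "z \<in> (E \<inter> cball x r) - paraboloid \<alpha> x (W x) lam" using z TA AE by auto
        qed
        from order_trans[OF hausdorff_mono[OF this] approx[OF TA[OF x] r]]
        show "hausdorff k {z \<in> T. dist x z \<le> r \<and>
            48 * lam * norm (?P (z - x)) powr (1 + \<alpha>) < norm (z - x - L x (?P (z - x)))} \<le> ennreal (\<epsilon> * r ^ k)" .
      qed
      then show "graph_coverable k \<alpha> (B j \<inter> ball p \<eta>)" unfolding T_def .
    qed
  qed
qed

text \<open>As \<open>eps0 k\<close> equals 120^(-k) / 240, the product is (44/120)^k / 60.\<close>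

lemma eps0_bound: "4 * eps0 k * 44 ^ k < 1"
proof -
  have "eps0 k = (1 / 120) ^ k / 240"
  proof -
    have "eps0 k = 2 ^ k * (1 / 240 ^ Suc k)"
    proof -
      have "- int k - 1 = - int (Suc k)" by simp
      then show ?thesis by (simp only: eps0_def power_int_minus power_int_of_nat inverse_eq_divide)
    qed
    also have "\<dots> = (2 / 240) ^ k / 240" by (simp only: power_divide power_Suc) simp
    finally show ?thesis by simp
  qed
  then have "4 * eps0 k * 44 ^ k = (44 / 120) ^ k / 60" by (simp only: power_divide power_one) simp
  moreover have "(44 / 120 :: real) ^ k \<le> 1" by (intro power_le_one) simp_all
  ultimately show ?thesis by simp
qed

section \<open>Countable decomposition into pieces with uniform data\<close>

theorem theorem1p1:
  fixes E :: "(real ^ 'n) set" and k :: nat and \<alpha> :: real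
  assumes "k \<in> {1..CARD('n) - 1}"
    and "0 < \<alpha>" and "\<alpha> \<le> 1"
    and "E \<in> sets borel"
    and "hausdorff k E < \<infinity>"
    and "hausdorff k {x \<in> E. \<not> (\<exists>V lam. linear_plane k V \<and> lam > 0 \<and>
           Limsup (at_right 0)
             (\<lambda>r. hausdorff k ((E \<inter> cball x r) - paraboloid \<alpha> x V lam) / ennreal (r ^ k))
           < ennreal (eps0 k))} = 0"
  shows "C1_alpha_rectifiable k \<alpha> E"
proof -
  have k: "0 < k" using assms(1) by simp
  have eps0_pos: "0 < eps0 k" by (simp add: eps0_def)
  define bad where "bad = {x \<in> E. \<not> (\<exists>V lam. linear_plane k V \<and> lam > 0 \<and>
           Limsup (at_right 0)
             (\<lambda>r. hausdorff k ((E \<inter> cball x r) - paraboloid \<alpha> x V lam) / ennreal (r ^ k))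
           < ennreal (eps0 k))}"
  \<comment> \<open>The strict inequality for the upper limit holds on a whole interval of radii,
    whose length becomes a datum of the point like the plane and the aperture.\<close>
  define admissible where "admissible x W lam r0 \<longleftrightarrow> linear_plane k W \<and> 0 < lam \<and> 0 < r0 \<and>
      (\<forall>r. 0 < r \<longrightarrow> r < r0 \<longrightarrow>
        hausdorff k ((E \<inter> cball x r) - paraboloid \<alpha> x W lam) \<le> ennreal (eps0 k * r ^ k))"
    for x W lam r0
  have "\<exists>W lam r0. admissible x W lam r0"
    if x: "x \<in> E - bad" for x
  proof -
    obtain V lam where V: "linear_plane k V" "lam > 0" and lim: "Limsup (at_right 0)
        (\<lambda>r. hausdorff k ((E \<inter> cball x r) - paraboloid \<alpha> x V lam) / ennreal (r ^ k)) < ennreal (eps0 k)"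
      using x unfolding bad_def by blast
    obtain b where b: "0 < b" "\<And>r. 0 < r \<Longrightarrow> r < b \<Longrightarrow>
        hausdorff k ((E \<inter> cball x r) - paraboloid \<alpha> x V lam) / ennreal (r ^ k) < ennreal (eps0 k)"
      using Limsup_lessD[OF lim] unfolding eventually_at_right_field by auto
    have "hausdorff k ((E \<inter> cball x r) - paraboloid \<alpha> x V lam) \<le> ennreal (eps0 k * r ^ k)"
      if r: "0 < r" "r < b" for r
    proof -
      have "hausdorff k ((E \<inter> cball x r) - paraboloid \<alpha> x V lam) < ennreal (eps0 k) * ennreal (r ^ k)"
        using b(2)[OF r] r(1) by (subst (asm) divide_less_ennreal) simp_all
      then show ?thesis using eps0_pos r(1) by (simp add: ennreal_mult[symmetric] less_imp_le)
    qed
    then have "admissible x V lam b" unfolding admissible_def using V b(1) by (intro conjI allI impI)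
    then show ?thesis by blast
  qed
  then obtain W lam r0 where adm: "\<And>x. x \<in> E - bad \<Longrightarrow> admissible x (W x) (lam x) (r0 x)"
    by metis
  have data: "\<And>x. x \<in> E - bad \<Longrightarrow> linear_plane k (W x)"
      "\<And>x. x \<in> E - bad \<Longrightarrow> 0 < lam x" "\<And>x. x \<in> E - bad \<Longrightarrow> 0 < r0 x"
      "\<And>x r. x \<in> E - bad \<Longrightarrow> 0 < r \<Longrightarrow> r < r0 x \<Longrightarrow>
        hausdorff k ((E \<inter> cball x r) - paraboloid \<alpha> x (W x) (lam x)) \<le> ennreal (eps0 k * r ^ k)"
    using adm unfolding admissible_def by simp_all
  obtain \<C> :: "(real ^ 'n) set set set" where \<C>: "finite \<C>"
      "\<forall>V. subspace V \<longrightarrow> (\<exists>c\<in>\<C>. V \<in> c)"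
      "\<forall>c\<in>\<C>. \<forall>V\<in>c. \<forall>W\<in>c. subspace V \<longrightarrow> subspace W \<longrightarrow>
        (\<forall>w. norm (orth_proj V w - orth_proj W w) \<le> 1/20 * norm w)"
    using finite_cover_of_planes[where 'a="real ^ 'n" and d="1/20"] by (elim exE conjE meta_impE) simp_all
  have \<C>ne: "\<C> \<noteq> {}" using \<C>(2)[rule_format, OF subspace_UNIV] by auto
  \<comment> \<open>One index bounds both the aperture from above and the scale from below, since
    both conditions relax as \<open>m\<close> grows.\<close>
  define A where "A m c = {x \<in> E - bad. lam x \<le> real (Suc m) \<and> 1 / real (Suc m) \<le> r0 x \<and> W x \<in> c}" for m c
  have piece: "graph_coverable k \<alpha> (A m c)" if c: "c \<in> \<C>" for m c
  proof (cases "A m c = {}")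
    case True
    then show ?thesis by (simp add: graph_coverable_null hausdorff_empty[OF k])
  next
    case False
    \<comment> \<open>The plane of any one point of the piece serves as reference plane, because all
      planes of a cell are within 1/20 of each other.\<close>
    then obtain x\<^sub>0 where x0: "x\<^sub>0 \<in> A m c" by blast
    have good: "x \<in> E - bad" "W x \<in> c" "lam x \<le> real (Suc m)" "1 / real (Suc m) \<le> r0 x"
      if "x \<in> A m c" for x using that by (simp_all add: A_def)
    have sub: "subspace (W x)" if "x \<in> A m c" for x
      using data(1)[OF good(1)[OF that]] by (simp add: linear_plane_def)
    show ?thesis
    proof (rule graph_coverable_of_close_planes[OF k data(1)[OF good(1)[OF x0]] assms(2,3),
          of "real (Suc m)" _ E "1 / real (Suc m)" "eps0 k" W])
      show "A m c \<subseteq> E" by (auto simp: A_def)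
      show "hausdorff k E < top" using assms(5) by simp
      fix x assume x: "x \<in> A m c"
      show "norm (orth_proj (W x) w - orth_proj (W x\<^sub>0) w) \<le> 1/20 * norm w" for w
        by (rule \<C>(3)[rule_format, OF c good(2)[OF x] good(2)[OF x0] sub[OF x] sub[OF x0]])
      fix r :: real assume r: "0 < r" "r < 1 / real (Suc m)"
      \<comment> \<open>Enlarging the aperture enlarges the paraboloid, so the mass outside it can
        only decrease.\<close>
      have "paraboloid \<alpha> x (W x) (lam x) \<subseteq> paraboloid \<alpha> x (W x) (real (Suc m))"
        unfolding paraboloid_def
        by (intro subsetI CollectI, elim CollectE) (rule order_trans[OF _ mult_right_mono[OF good(3)[OF x] powr_ge_zero]])
      then have "hausdorff k ((E \<inter> cball x r) - paraboloid \<alpha> x (W x) (real (Suc m)))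
          \<le> hausdorff k ((E \<inter> cball x r) - paraboloid \<alpha> x (W x) (lam x))"
        by (intro hausdorff_mono) blast
      also have "\<dots> \<le> ennreal (eps0 k * r ^ k)"
        using r good(4)[OF x] by (intro data(4)[OF good(1)[OF x]]) simp_all
      finally show "hausdorff k ((E \<inter> cball x r) - paraboloid \<alpha> x (W x) (real (Suc m))) \<le> ennreal (eps0 k * r ^ k)" .
    qed (simp_all add: eps0_pos eps0_bound sub)
  qed
  define S where "S i = (case prod_decode i of (m, n) \<Rightarrow> A m (from_nat_into \<C> n))" for i
  have "graph_coverable k \<alpha> (S i)" for i
    unfolding S_def split_beta by (rule piece[OF from_nat_into[OF \<C>ne]])
  moreover have "hausdorff k (E - (\<Union>i. S i)) = 0"
  proof -
    have "E - (\<Union>i. S i) \<subseteq> bad"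
    proof
      fix x assume x: "x \<in> E - (\<Union>i. S i)"
      show "x \<in> bad"
      proof (rule ccontr)
        assume "x \<notin> bad"
        then have good: "x \<in> E - bad" using x by blast
        obtain m1 where m1: "1 / real (Suc m1) < r0 x" by (rule nat_approx_posE[OF data(3)[OF good]])
        obtain m2 where m2: "lam x \<le> real m2" using real_arch_simple by blast
        define m where "m = max m1 m2"
        have "1 / real (Suc m) \<le> 1 / real (Suc m1)" by (intro divide_left_mono) (simp_all add: m_def)
        then have r: "1 / real (Suc m) \<le> r0 x" using m1 by linarith
        have l: "lam x \<le> real (Suc m)" by (rule order_trans[OF m2]) (simp add: m_def)
        have "subspace (W x)" using data(1)[OF good] by (simp add: linear_plane_def)
        from \<C>(2)[rule_format, OF this] obtain c where c: "c \<in> \<C>" "W x \<in> c" ..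
        have "x \<in> A m c" unfolding A_def using good l r c(2) by (intro CollectI conjI)
        moreover obtain n where "from_nat_into \<C> n = c"
          using from_nat_into_surj[OF countable_finite[OF \<C>(1)] c(1)] ..
        ultimately have "x \<in> S (prod_encode (m, n))" by (simp add: S_def)
        then show False using x by blast
      qed
    qed
    from hausdorff_mono[OF this, of k] show ?thesis using assms(6) unfolding bad_def[symmetric] by simp
  qed
  ultimately have "graph_coverable k \<alpha> E" by (rule graph_coverable_UN_null)
  then show ?thesis
    unfolding C1_alpha_rectifiable_def graph_coverable_def using assms(4) by blast
qed

end
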